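(* Let $\Gamma$ be a (finite) special mixed graph with associated twisted right-angled Artin group $T(\Gamma)$. Then: (i) If $\Gamma$ is rigid, then it has no satellites (i.e. no sinkhole of $\Gamma$ has a satellite). (ii) If $\Gamma$ has a sinkhole which is joined to every other vertex, then $\Gamma$ is rigid. (iii) If $\Gamma$ is a Droms mixed graph, then $\Gamma$ is rigid if, and only if, it has no satellites.
   Context: A mixed graph $\Gamma=(V,E,D,o,t)$ consists of a simplicial graph $\overline{\Gamma}=(V,E)$ (the underlying simplicial graph; $E$ is a set of two-element subsets of the finite set $V$), a subset $D\subseteq E$ of directed edges, and maps $o,t\colon D\to V$ (origin, terminus) with $\mathbf e=\{o(\mathbf e),t(\mathbf e)\}$ for all $\mathbf e\in D$. Write $[x,y]$ for an undirected edge $\{x,y\}\in E\smallsetminus D$ and $[x,y\rangle$ for a directed edge with origin $x$ and terminus $y$. Two vertices $x,y$ are joined if $\{x,y\}\in E$. Isomorphisms of mixed graphs are bijections of vertices preserving edges, directed edges, origins and termini (and reflecting them). The T-RAAG of $\Gamma$ is $$T(\Gamma)=\langle V\mid ab=ba \text{ if } [a,b]\in E\smallsetminus D,\ \ aba=b \text{ if } [a,b\rangle\in D\rangle .$$ A vertex is negative if it is the terminus of some directed edge. $\Gamma$ is special if for every negative vertex $x$ and every $y$ with $\{x,y\}\in E$ one has $[y,x\rangle\in D$. In a special mixed graph, the vertices that are termini of directed edges are called sinkholes. If $\Gamma$ is special and $w$ is a sinkhole, a satellite of $w$ is a vertex $v$ at distance $2$ from $w$ in $\overline\Gamma$ (so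 $v\ne w$, $\{v,w\}\notin E$, and there is a vertex joined to both $v$ and $w$) such that every vertex of $\Gamma$ joined to $v$ is also joined to $w$. $\Gamma$ is a Droms mixed graph if: (1) $\overline{\Gamma}$ contains neither the path $\mathrm P_4$ on four vertices nor the cycle $\mathrm C_4$ on four vertices as an induced subgraph; (2) $\Gamma$ is special; (3) $\Gamma$ does not contain as an induced subgraph the mixed graph with three vertices $a_1,b,a_2$ and exactly two edges, the directed edges $[a_1,b\rangle$ and $[a_2,b\rangle$. A mixed graph $\Gamma$ is rigid if, whenever $\Gamma'$ is a (finite) mixed graph with $T(\Gamma)\cong T(\Gamma')$, the mixed graphs $\Gamma$ and $\Gamma'$ are isomorphic. *)

theory Defs
  imports "HOL-Algebra.Group"
begin

section \<open>Mixed graphs\<close>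

record 'v mixed_graph =
  verts :: "'v set"
  edges :: "'v set set"
  dedges :: "'v set set"
  origin :: "'v set \<Rightarrow> 'v"
  terminus :: "'v set \<Rightarrow> 'v"

text \<open>The maps \<^term>\<open>origin G\<close> and \<^term>\<open>terminus G\<close> are total functions here; their values
  outside \<^term>\<open>dedges G\<close> are never used.\<close>

definition mixed_graph :: "'v mixed_graph \<Rightarrow> bool" where
  "mixed_graph G \<longleftrightarrow>
     finite (verts G) \<and>
     (\<forall>e\<in>edges G. e \<subseteq> verts G \<and> card e = 2) \<and>
     dedges G \<subseteq> edges G \<and>
     (\<forall>e\<in>dedges G. e = {origin G e, terminus G e})"

definition joined :: "'v mixed_graph \<Rightarrow> 'v \<Rightarrow> 'v \<Rightarrow> bool" where
  "joined G x y \<longleftrightarrow> {x, y} \<in> edges G"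

text \<open>The undirected edge $[x,y]$ and the directed edge $[x,y\rangle$.\<close>

definition undirected_edge :: "'v mixed_graph \<Rightarrow> 'v \<Rightarrow> 'v \<Rightarrow> bool" where
  "undirected_edge G x y \<longleftrightarrow> {x, y} \<in> edges G - dedges G"

definition directed_edge :: "'v mixed_graph \<Rightarrow> 'v \<Rightarrow> 'v \<Rightarrow> bool" where
  "directed_edge G x y \<longleftrightarrow>
     {x, y} \<in> dedges G \<and> origin G {x, y} = x \<and> terminus G {x, y} = y"

definition mixed_graph_isomorphism :: "('v \<Rightarrow> 'w) \<Rightarrow> 'v mixed_graph \<Rightarrow> 'w mixed_graph \<Rightarrow> bool" where
  "mixed_graph_isomorphism f G H \<longleftrightarrow>
     bij_betw f (verts G) (verts H) \<and>
     (\<forall>x\<in>verts G. \<forall>y\<in>verts G. {x, y} \<in> edges G \<longleftrightarrow> {f x, f y} \<in> edges H) \<and>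
     (\<forall>x\<in>verts G. \<forall>y\<in>verts G. {x, y} \<in> dedges G \<longleftrightarrow> {f x, f y} \<in> dedges H) \<and>
     (\<forall>e\<in>dedges G. origin H (f ` e) = f (origin G e) \<and> terminus H (f ` e) = f (terminus G e))"

definition mixed_graphs_isomorphic :: "'v mixed_graph \<Rightarrow> 'w mixed_graph \<Rightarrow> bool" where
  "mixed_graphs_isomorphic G H \<longleftrightarrow> (\<exists>f. mixed_graph_isomorphism f G H)"


section \<open>Group presentations\<close>

text \<open>A letter \<open>(x, True)\<close> stands for the generator \<open>x\<close>, and \<open>(x, False)\<close> for its inverse.\<close>

type_synonym 'v word = "('v \<times> bool) list"

abbreviation words :: "'v set \<Rightarrow> 'v word set" where
  "words V \<equiv> lists (V \<times> UNIV)"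

text \<open>The least congruence on the words over \<open>V\<close> and its formal inverses that contains the
  free cancellations and the relations \<open>l = r\<close> for \<open>(l, r) \<in> R\<close>.\<close>

inductive pres_eq :: "'v set \<Rightarrow> ('v word \<times> 'v word) set \<Rightarrow> 'v word \<Rightarrow> 'v word \<Rightarrow> bool"
  for V R where
  refl: "u \<in> words V \<Longrightarrow> pres_eq V R u u"
| sym: "pres_eq V R u v \<Longrightarrow> pres_eq V R v u"
| trans: "pres_eq V R u v \<Longrightarrow> pres_eq V R v w \<Longrightarrow> pres_eq V R u w"
| app: "pres_eq V R u u' \<Longrightarrow> pres_eq V R v v' \<Longrightarrow> pres_eq V R (u @ v) (u' @ v')"
| cancel: "x \<in> V \<Longrightarrow> pres_eq V R [(x, b), (x, \<not> b)] []"
| rel: "(l, r) \<in> R \<Longrightarrow> l \<in> words V \<Longrightarrow> r \<in> words V \<Longrightarrow> pres_eq V R l r"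

definition pres_rel :: "'v set \<Rightarrow> ('v word \<times> 'v word) set \<Rightarrow> 'v word rel" where
  "pres_rel V R = {(u, v). pres_eq V R u v}"

definition presented_group :: "'v set \<Rightarrow> ('v word \<times> 'v word) set \<Rightarrow> 'v word set monoid" where
  "presented_group V R =
     \<lparr>carrier = words V // pres_rel V R,
      mult = (\<lambda>A B. \<Union>a\<in>A. \<Union>b\<in>B. pres_rel V R `` {a @ b}),
      one = pres_rel V R `` {[]}\<rparr>"


section \<open>Twisted right-angled Artin groups\<close>

definition TRAAG_relations :: "'v mixed_graph \<Rightarrow> ('v word \<times> 'v word) set" where
  "TRAAG_relations G =
     {([(a, True), (b, True)], [(b, True), (a, True)]) |a b. undirected_edge G a b} \<union>
     {([(a, True), (b, True), (a, True)], [(b, True)]) |a b. directed_edge G a b}"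

definition TRAAG :: "'v mixed_graph \<Rightarrow> 'v word set monoid" where
  "TRAAG G = presented_group (verts G) (TRAAG_relations G)"

text \<open>A definition cannot quantify over types, so the mixed graphs \<open>H\<close> are taken with vertices in
  \<^typ>\<open>nat\<close>; every finite mixed graph is isomorphic to such a one. Lemma \<open>rigidD\<close> below gives the
  property for mixed graphs over an arbitrary type.\<close>

definition rigid :: "'v mixed_graph \<Rightarrow> bool" where
  "rigid G \<longleftrightarrow>
     (\<forall>H :: nat mixed_graph.
        mixed_graph H \<longrightarrow> TRAAG G \<cong> TRAAG H \<longrightarrow> mixed_graphs_isomorphic G H)"


section \<open>Special mixed graphs, sinkholes and satellites\<close>

definition negative :: "'v mixed_graph \<Rightarrow> 'v \<Rightarrow> bool" where
  "negative G x \<longleftrightarrow> (\<exists>y. directed_edge G y x)"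

definition special :: "'v mixed_graph \<Rightarrow> bool" where
  "special G \<longleftrightarrow> (\<forall>x y. negative G x \<longrightarrow> {x, y} \<in> edges G \<longrightarrow> directed_edge G y x)"

text \<open>This notion is only used for special mixed graphs.\<close>

definition sinkhole :: "'v mixed_graph \<Rightarrow> 'v \<Rightarrow> bool" where
  "sinkhole G w \<longleftrightarrow> negative G w"

definition satellite :: "'v mixed_graph \<Rightarrow> 'v \<Rightarrow> 'v \<Rightarrow> bool" where
  "satellite G w v \<longleftrightarrow>
     v \<in> verts G \<and> v \<noteq> w \<and> \<not> joined G v w \<and>
     (\<exists>u\<in>verts G. joined G u v \<and> joined G u w) \<and>
     (\<forall>u\<in>verts G. joined G u v \<longrightarrow> joined G u w)"

definition has_satellites :: "'v mixed_graph \<Rightarrow> bool" where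
  "has_satellites G \<longleftrightarrow> (\<exists>w v. sinkhole G w \<and> satellite G w v)"


section \<open>Droms mixed graphs\<close>

definition induced_subgraph :: "'v mixed_graph \<Rightarrow> 'v set \<Rightarrow> 'v mixed_graph" where
  "induced_subgraph G W =
     \<lparr>verts = W, edges = {e \<in> edges G. e \<subseteq> W}, dedges = {e \<in> dedges G. e \<subseteq> W},
      origin = origin G, terminus = terminus G\<rparr>"

definition contains_induced :: "'v mixed_graph \<Rightarrow> 'w mixed_graph \<Rightarrow> bool" where
  "contains_induced G H \<longleftrightarrow>
     (\<exists>W\<subseteq>verts G. mixed_graphs_isomorphic H (induced_subgraph G W))"

text \<open>Simplicial graphs are treated as mixed graphs without directed edges.\<close>

definition simplicial_graph :: "'v set \<Rightarrow> 'v set set \<Rightarrow> 'v mixed_graph" where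
  "simplicial_graph V E =
     \<lparr>verts = V, edges = E, dedges = {}, origin = undefined, terminus = undefined\<rparr>"

definition underlying :: "'v mixed_graph \<Rightarrow> 'v mixed_graph" where
  "underlying G = simplicial_graph (verts G) (edges G)"

definition P4 :: "nat mixed_graph" where
  "P4 = simplicial_graph {0, 1, 2, 3} {{0, 1}, {1, 2}, {2, 3}}"

definition C4 :: "nat mixed_graph" where
  "C4 = simplicial_graph {0, 1, 2, 3} {{0, 1}, {1, 2}, {2, 3}, {3, 0}}"

text \<open>The directed edges $[0,1\rangle$ and $[2,1\rangle$ on three vertices.\<close>

definition two_arrows :: "nat mixed_graph" where
  "two_arrows =
     \<lparr>verts = {0, 1, 2}, edges = {{0, 1}, {2, 1}}, dedges = {{0, 1}, {2, 1}},
      origin = (\<lambda>e. if e = {0, 1} then 0 else 2), terminus = (\<lambda>e. 1)\<rparr>"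

definition droms :: "'v mixed_graph \<Rightarrow> bool" where
  "droms G \<longleftrightarrow>
     \<not> contains_induced (underlying G) P4 \<and> \<not> contains_induced (underlying G) C4 \<and>
     special G \<and>
     \<not> contains_induced G two_arrows"


section \<open>Basic facts\<close>

lemma pres_eq_words: "pres_eq V R u v \<Longrightarrow> u \<in> words V \<and> v \<in> words V"
  by (induction rule: pres_eq.induct) auto

lemma equiv_pres_rel: "equiv (words V) (pres_rel V R)"
proof (rule equivI)
  show "pres_rel V R \<subseteq> words V \<times> words V"
    by (auto simp: pres_rel_def dest: pres_eq_words)
  show "refl_on (words V) (pres_rel V R)"
    by (auto simp: refl_on_def pres_rel_def intro: pres_eq.refl)
  show "sym (pres_rel V R)"
    by (auto simp: sym_def pres_rel_def intro: pres_eq.sym)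
  show "trans (pres_rel V R)"
    by (auto simp: trans_def pres_rel_def intro: pres_eq.trans)
qed

lemma pres_class_eq:
  assumes "u \<in> words V" "v \<in> words V"
  shows "pres_rel V R `` {u} = pres_rel V R `` {v} \<longleftrightarrow> pres_eq V R u v"
  using eq_equiv_class_iff[OF equiv_pres_rel assms] by (simp add: pres_rel_def)

lemma presented_group_mult:
  assumes "u \<in> words V" "v \<in> words V"
  shows "(pres_rel V R `` {u}) \<otimes>\<^bsub>presented_group V R\<^esub> (pres_rel V R `` {v})
           = pres_rel V R `` {u @ v}"
proof -
  have cl: "pres_rel V R `` {a @ b} = pres_rel V R `` {u @ v}"
    if "pres_eq V R u a" "pres_eq V R v b" for a b
  proof -
    have "pres_eq V R (a @ b) (u @ v)"
      using pres_eq.sym[OF pres_eq.app[OF that]] .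
    with pres_eq_words[OF this] show ?thesis by (simp add: pres_class_eq)
  qed
  have "u \<in> pres_rel V R `` {u}" "v \<in> pres_rel V R `` {v}"
    using assms by (auto simp: pres_rel_def intro: pres_eq.refl)
  moreover have "\<forall>a \<in> pres_rel V R `` {u}. \<forall>b \<in> pres_rel V R `` {v}.
      pres_rel V R `` {a @ b} = pres_rel V R `` {u @ v}"
    using cl by (simp add: pres_rel_def)
  ultimately have "(\<Union>a\<in>pres_rel V R `` {u}. \<Union>b\<in>pres_rel V R `` {v}. pres_rel V R `` {a @ b})
      = pres_rel V R `` {u @ v}"
    by blast
  then show ?thesis by (simp add: presented_group_def)
qed

definition word_inv :: "'v word \<Rightarrow> 'v word" where
  "word_inv w = rev (map (\<lambda>(x, b). (x, \<not> b)) w)"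

lemma word_inv_words: "w \<in> words V \<Longrightarrow> word_inv w \<in> words V"
  by (auto simp: word_inv_def in_lists_conv_set)

lemma word_inv_cancel: "w \<in> words V \<Longrightarrow> pres_eq V R (word_inv w @ w) []"
proof (induction w)
  case Nil
  then show ?case by (auto simp: word_inv_def intro: pres_eq.refl)
next
  case (Cons l w)
  obtain x b where l: "l = (x, b)" by (cases l)
  have w: "w \<in> words V" and x: "x \<in> V" using Cons.prems l by auto
  have "pres_eq V R ([(x, \<not> b), (x, \<not> \<not> b)] @ w) ([] @ w)"
    by (intro pres_eq.app pres_eq.cancel pres_eq.refl x w)
  then have "pres_eq V R (word_inv w @ [(x, \<not> b), (x, b)] @ w) (word_inv w @ w)"
    by (intro pres_eq.app pres_eq.refl word_inv_words w) simp
  then have "pres_eq V R (word_inv w @ [(x, \<not> b), (x, b)] @ w) []"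
    using Cons.IH[OF w] by (rule pres_eq.trans)
  then show ?case by (simp add: word_inv_def l)
qed

lemma presented_group_carrierE:
  assumes "A \<in> carrier (presented_group V R)"
  obtains u where "u \<in> words V" "A = pres_rel V R `` {u}"
proof -
  have "A \<in> words V // pres_rel V R" using assms by (simp add: presented_group_def)
  then show thesis by (rule quotientE) (rule that)
qed

lemma presented_group_carrierI:
  "u \<in> words V \<Longrightarrow> pres_rel V R `` {u} \<in> carrier (presented_group V R)"
  by (auto simp: presented_group_def intro: quotientI)

lemma presented_group_one: "\<one>\<^bsub>presented_group V R\<^esub> = pres_rel V R `` {[]}"
  by (simp add: presented_group_def)

lemma group_presented_group: "group (presented_group V R)"
proof (rule groupI)
  fix A B C
  assume "A \<in> carrier (presented_group V R)" "B \<in> carrier (presented_group V R)"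
    "C \<in> carrier (presented_group V R)"
  then obtain a b c where abc: "a \<in> words V" "b \<in> words V" "c \<in> words V"
      "A = pres_rel V R `` {a}" "B = pres_rel V R `` {b}" "C = pres_rel V R `` {c}"
    by (metis presented_group_carrierE)
  have "a @ b \<in> words V" "b @ c \<in> words V" using abc by auto
  then show "A \<otimes>\<^bsub>presented_group V R\<^esub> B \<otimes>\<^bsub>presented_group V R\<^esub> C =
      A \<otimes>\<^bsub>presented_group V R\<^esub> (B \<otimes>\<^bsub>presented_group V R\<^esub> C)"
    using abc by (simp add: presented_group_mult del: append_in_lists_conv)
next
  fix A B
  assume "A \<in> carrier (presented_group V R)" "B \<in> carrier (presented_group V R)"
  then obtain a b where ab: "a \<in> words V" "b \<in> words V"
      "A = pres_rel V R `` {a}" "B = pres_rel V R `` {b}"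
    by (metis presented_group_carrierE)
  then have "a @ b \<in> words V" by simp
  then show "A \<otimes>\<^bsub>presented_group V R\<^esub> B \<in> carrier (presented_group V R)"
    unfolding ab(3,4) presented_group_mult[OF ab(1,2)] by (rule presented_group_carrierI)
next
  show "\<one>\<^bsub>presented_group V R\<^esub> \<in> carrier (presented_group V R)"
    by (simp add: presented_group_one presented_group_carrierI)
next
  fix A
  assume "A \<in> carrier (presented_group V R)"
  then obtain a where a: "a \<in> words V" "A = pres_rel V R `` {a}"
    by (rule presented_group_carrierE)
  show "\<one>\<^bsub>presented_group V R\<^esub> \<otimes>\<^bsub>presented_group V R\<^esub> A = A"
    using presented_group_mult[of "[]" V a R] a by (simp add: presented_group_one)
  have "pres_rel V R `` {word_inv a} \<otimes>\<^bsub>presented_group V R\<^esub> A = \<one>\<^bsub>presented_group V R\<^esub>"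
    using a word_inv_words[OF a(1)] word_inv_cancel[OF a(1), of R]
    by (simp add: presented_group_mult presented_group_one pres_class_eq del: in_lists_conv_set)
  then show "\<exists>B\<in>carrier (presented_group V R).
      B \<otimes>\<^bsub>presented_group V R\<^esub> A = \<one>\<^bsub>presented_group V R\<^esub>"
    using presented_group_carrierI word_inv_words[OF a(1)] by blast
qed

text \<open>The universal property of \<^const>\<open>presented_group\<close>.\<close>

definition word_eval :: "('g, 'm) monoid_scheme \<Rightarrow> ('v \<Rightarrow> 'g) \<Rightarrow> 'v word \<Rightarrow> 'g" where
  "word_eval K f w = foldr (\<lambda>(x, b) y. (if b then f x else inv\<^bsub>K\<^esub> f x) \<otimes>\<^bsub>K\<^esub> y) w \<one>\<^bsub>K\<^esub>"

lemma word_eval_closed: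
  assumes "group K" "f \<in> V \<rightarrow> carrier K" "w \<in> words V"
  shows "word_eval K f w \<in> carrier K"
proof -
  interpret group K by fact
  show ?thesis using assms(3)
  proof (induction w)
    case (Cons l w)
    obtain x b where l: "l = (x, b)" by (cases l)
    have "f x \<in> carrier K" using Cons.hyps assms(2) l by (auto simp: Pi_def)
    then show ?case using Cons.IH by (simp add: word_eval_def l)
  qed (simp add: word_eval_def)
qed

lemma word_eval_append:
  assumes "group K" "f \<in> V \<rightarrow> carrier K" "u \<in> words V" "v \<in> words V"
  shows "word_eval K f (u @ v) = word_eval K f u \<otimes>\<^bsub>K\<^esub> word_eval K f v"
  using assms(3)
proof (induction u)
  interpret group K by fact
  case Nil
  then show ?case using word_eval_closed[OF assms(1,2,4)] by (simp add: word_eval_def)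
next
  interpret group K by fact
  case (Cons l u)
  obtain x b where l: "l = (x, b)" by (cases l)
  have *: "word_eval K f (l # w) = (if b then f x else inv\<^bsub>K\<^esub> f x) \<otimes>\<^bsub>K\<^esub> word_eval K f w" for w
    by (simp add: word_eval_def l)
  have "x \<in> V" and u: "u \<in> words V" using Cons.hyps l by auto
  then have "f x \<in> carrier K" using assms(2) by blast
  with u show ?case
    using word_eval_closed[OF assms(1,2)] assms(4) Cons.IH
    by (simp add: * m_assoc del: in_lists_conv_set)
qed

lemma pres_eq_word_eval:
  assumes "group K" "f \<in> V \<rightarrow> carrier K"
    and "\<And>l r. (l, r) \<in> R \<Longrightarrow> l \<in> words V \<Longrightarrow> r \<in> words V \<Longrightarrow> word_eval K f l = word_eval K f r"
    and "pres_eq V R u v"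
  shows "word_eval K f u = word_eval K f v"
  using assms(4)
proof (induction rule: pres_eq.induct)
  interpret group K by fact
  case (app u u' v v')
  then show ?case
    using pres_eq_words[OF app.hyps(1)] pres_eq_words[OF app.hyps(2)]
    by (metis word_eval_append[OF assms(1,2)])
next
  interpret group K by fact
  case (cancel x b)
  then have "f x \<in> carrier K" using assms(2) by auto
  then show ?case by (cases b) (simp_all add: word_eval_def)
qed (simp_all add: assms(3))

lemma presented_group_universal:
  assumes "group K" "f \<in> V \<rightarrow> carrier K"
    and "\<And>l r. (l, r) \<in> R \<Longrightarrow> l \<in> words V \<Longrightarrow> r \<in> words V \<Longrightarrow> word_eval K f l = word_eval K f r"
  shows "\<exists>h \<in> hom (presented_group V R) K.
           \<forall>w \<in> words V. h (pres_rel V R `` {w}) = word_eval K f w"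
proof -
  define h where "h A = word_eval K f (SOME w. w \<in> A)" for A
  have h: "h (pres_rel V R `` {w}) = word_eval K f w" if w: "w \<in> words V" for w
  proof -
    have "w \<in> pres_rel V R `` {w}" using w by (auto simp: pres_rel_def intro: pres_eq.refl)
    then have "(SOME v. v \<in> pres_rel V R `` {w}) \<in> pres_rel V R `` {w}" by (rule someI)
    then have "pres_eq V R w (SOME v. v \<in> pres_rel V R `` {w})" by (simp add: pres_rel_def)
    then show ?thesis unfolding h_def using pres_eq_word_eval[OF assms] by metis
  qed
  have "h \<in> hom (presented_group V R) K"
  proof (rule homI)
    fix A assume "A \<in> carrier (presented_group V R)"
    then show "h A \<in> carrier K"
      by (metis presented_group_carrierE h word_eval_closed[OF assms(1,2)])
  next
    fix A B assume "A \<in> carrier (presented_group V R)" "B \<in> carrier (presented_group V R)"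
    then obtain a b where ab: "a \<in> words V" "b \<in> words V"
        "A = pres_rel V R `` {a}" "B = pres_rel V R `` {b}"
      by (metis presented_group_carrierE)
    then have "a @ b \<in> words V" by simp
    with ab show "h (A \<otimes>\<^bsub>presented_group V R\<^esub> B) = h A \<otimes>\<^bsub>K\<^esub> h B"
      by (simp add: presented_group_mult h word_eval_append[OF assms(1,2)]
          del: append_in_lists_conv in_lists_conv_set)
  qed
  with h show ?thesis by blast
qed

text \<open>Isomorphic mixed graphs have isomorphic T-RAAGs.\<close>

lemma mixed_graph_isomorphism_inv:
  assumes "mixed_graph G" "mixed_graph H" "mixed_graph_isomorphism f G H"
  shows "mixed_graph_isomorphism (inv_into (verts G) f) H G"
proof -
  let ?g = "inv_into (verts G) f"
  have bij: "bij_betw f (verts G) (verts H)"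
    and E: "\<And>x y. x \<in> verts G \<Longrightarrow> y \<in> verts G \<Longrightarrow> {x, y} \<in> edges G \<longleftrightarrow> {f x, f y} \<in> edges H"
    and D: "\<And>x y. x \<in> verts G \<Longrightarrow> y \<in> verts G \<Longrightarrow> {x, y} \<in> dedges G \<longleftrightarrow> {f x, f y} \<in> dedges H"
    and ot: "\<And>e. e \<in> dedges G \<Longrightarrow>
        origin H (f ` e) = f (origin G e) \<and> terminus H (f ` e) = f (terminus G e)"
    using assms(3) unfolding mixed_graph_isomorphism_def by auto
  have gV: "?g y \<in> verts G" and fg: "f (?g y) = y" if "y \<in> verts H" for y
    using that bij by (auto simp: bij_betw_def inv_into_into f_inv_into_f)
  have gf: "?g (f x) = x" if "x \<in> verts G" for x
    using that bij by (simp add: bij_betw_def inv_into_f_f)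
  have "origin G (?g ` e) = ?g (origin H e) \<and> terminus G (?g ` e) = ?g (terminus H e)"
    if e: "e \<in> dedges H" for e
  proof -
    have eq: "e = {origin H e, terminus H e}" and sub: "e \<subseteq> verts H"
      using e assms(2) unfolding mixed_graph_def by blast+
    define x y where "x = origin H e" and "y = terminus H e"
    have exy: "e = {x, y}" using eq x_def y_def by simp
    have xy: "x \<in> verts H" "y \<in> verts H" using sub exy by auto
    have d: "{?g x, ?g y} \<in> dedges G"
      using D[of "?g x" "?g y"] gV fg xy e exy by simp
    have im: "f ` {?g x, ?g y} = e" using fg xy exy by simp
    have Gd: "origin G e' \<in> verts G \<and> terminus G e' \<in> verts G" if "e' \<in> dedges G" for e'
    proof -
      have "e' = {origin G e', terminus G e'}" "e' \<subseteq> verts G"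
        using that assms(1) unfolding mixed_graph_def by blast+
      then show ?thesis by (metis insert_subset)
    qed
    have "origin G {?g x, ?g y} \<in> verts G" "terminus G {?g x, ?g y} \<in> verts G"
      using Gd[OF d] by simp_all
    moreover have "x = f (origin G {?g x, ?g y})" "y = f (terminus G {?g x, ?g y})"
      using ot[OF d] unfolding im x_def[symmetric] y_def[symmetric] by simp_all
    ultimately have "?g x = origin G {?g x, ?g y}" "?g y = terminus G {?g x, ?g y}"
      by (metis gf)+
    then show ?thesis unfolding x_def[symmetric] y_def[symmetric] by (simp add: exy)
  qed
  moreover have "{x, y} \<in> edges H \<longleftrightarrow> {?g x, ?g y} \<in> edges G"
    "{x, y} \<in> dedges H \<longleftrightarrow> {?g x, ?g y} \<in> dedges G"
    if "x \<in> verts H" "y \<in> verts H" for x y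
    using E[of "?g x" "?g y"] D[of "?g x" "?g y"] gV fg that by simp_all
  moreover have "bij_betw ?g (verts H) (verts G)"
    using bij by (rule bij_betw_inv_into)
  ultimately show ?thesis unfolding mixed_graph_isomorphism_def by blast
qed

lemma mixed_graph_isomorphism_undirected_edge:
  assumes "mixed_graph_isomorphism f G H" "x \<in> verts G" "y \<in> verts G"
  shows "undirected_edge G x y \<Longrightarrow> undirected_edge H (f x) (f y)"
  using assms unfolding mixed_graph_isomorphism_def undirected_edge_def by blast

lemma mixed_graph_isomorphism_directed_edge:
  assumes "mixed_graph_isomorphism f G H" "x \<in> verts G" "y \<in> verts G" "directed_edge G x y"
  shows "directed_edge H (f x) (f y)"
proof -
  have d: "{x, y} \<in> dedges G" "origin G {x, y} = x" "terminus G {x, y} = y"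
    using assms(4) by (auto simp: directed_edge_def)
  have "origin H (f ` {x, y}) = f x" "terminus H (f ` {x, y}) = f y"
    using assms(1) d unfolding mixed_graph_isomorphism_def by metis+
  moreover have "{f x, f y} \<in> dedges H"
    using assms(1,2,3) d(1) unfolding mixed_graph_isomorphism_def by blast
  ultimately show ?thesis by (simp add: directed_edge_def)
qed

definition word_map :: "('v \<Rightarrow> 'w) \<Rightarrow> 'v word \<Rightarrow> 'w word" where
  "word_map f = map (map_prod f id)"

lemma pres_eq_word_map:
  assumes "mixed_graph_isomorphism f G H" "pres_eq (verts G) (TRAAG_relations G) u v"
  shows "pres_eq (verts H) (TRAAG_relations H) (word_map f u) (word_map f v)"
proof -
  have fV: "f x \<in> verts H" if "x \<in> verts G" for x
    using assms(1) that by (auto simp: mixed_graph_isomorphism_def bij_betw_def)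
  have fw: "word_map f w \<in> words (verts H)" if "w \<in> words (verts G)" for w
    using that fV by (auto simp: word_map_def in_lists_conv_set)
  show ?thesis using assms(2)
  proof (induction rule: pres_eq.induct)
    case (refl u)
    show ?case by (rule pres_eq.refl[OF fw[OF refl]])
  next
    case (sym u v)
    then show ?case by (blast intro: pres_eq.sym)
  next
    case (trans u v w)
    then show ?case by (blast intro: pres_eq.trans)
  next
    case (app u u' v v')
    then show ?case by (auto simp: word_map_def intro: pres_eq.app)
  next
    case (cancel x b)
    show ?case using pres_eq.cancel[OF fV[OF cancel]] by (simp add: word_map_def)
  next
    case (rel l r)
    from rel(1) consider
        (und) a b where "l = [(a, True), (b, True)]" "r = [(b, True), (a, True)]"
          "undirected_edge G a b"
      | (dir) a b where "l = [(a, True), (b, True), (a, True)]" "r = [(b, True)]"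
          "directed_edge G a b"
      unfolding TRAAG_relations_def by blast
    then have "(word_map f l, word_map f r) \<in> TRAAG_relations H"
    proof cases
      case und
      then have "undirected_edge H (f a) (f b)"
        using rel(2) mixed_graph_isomorphism_undirected_edge[OF assms(1)] by simp
      then show ?thesis by (simp add: und TRAAG_relations_def word_map_def)
    next
      case dir
      then have "directed_edge H (f a) (f b)"
        using rel(2) mixed_graph_isomorphism_directed_edge[OF assms(1)] by simp
      then show ?thesis by (simp add: dir TRAAG_relations_def word_map_def)
    qed
    then show ?case using fw rel by (blast intro: pres_eq.rel)
  qed
qed

lemma TRAAG_iso_of_isomorphism:
  assumes "mixed_graph G" "mixed_graph H" "mixed_graph_isomorphism f G H"
  shows "TRAAG G \<cong> TRAAG H"
proof -
  let ?g = "inv_into (verts G) f"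
  note inv = mixed_graph_isomorphism_inv[OF assms]
  let ?r = "pres_rel (verts G) (TRAAG_relations G)"
  let ?s = "pres_rel (verts H) (TRAAG_relations H)"
  have bij: "bij_betw f (verts G) (verts H)"
    using assms(3) by (simp add: mixed_graph_isomorphism_def)
  have gf: "word_map ?g (word_map f w) = w" if "w \<in> words (verts G)" for w
    using that bij by (induction w) (auto simp: word_map_def bij_betw_def)
  have fg: "word_map f (word_map ?g w) = w" if "w \<in> words (verts H)" for w
    using that bij by (induction w) (auto simp: word_map_def bij_betw_def f_inv_into_f)
  have fw: "word_map f w \<in> words (verts H)" if "w \<in> words (verts G)" for w
    using pres_eq_words[OF pres_eq_word_map[OF assms(3) pres_eq.refl[OF that]]] by blast
  have gw: "word_map ?g w \<in> words (verts G)" if "w \<in> words (verts H)" for w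
    using pres_eq_words[OF pres_eq_word_map[OF inv pres_eq.refl[OF that]]] by blast
  have cl: "word_map f ` (?r `` {u}) = ?s `` {word_map f u}" if u: "u \<in> words (verts G)" for u
  proof (intro equalityI subsetI)
    fix w assume "w \<in> word_map f ` (?r `` {u})"
    then show "w \<in> ?s `` {word_map f u}"
      using pres_eq_word_map[OF assms(3)] by (auto simp: pres_rel_def)
  next
    fix w assume "w \<in> ?s `` {word_map f u}"
    then have w: "pres_eq (verts H) (TRAAG_relations H) (word_map f u) w"
      by (simp add: pres_rel_def)
    from pres_eq_word_map[OF inv this] gf[OF u] have "word_map ?g w \<in> ?r `` {u}"
      by (simp add: pres_rel_def)
    moreover have "w = word_map f (word_map ?g w)"
      using fg pres_eq_words[OF w] by simp
    ultimately show "w \<in> word_map f ` (?r `` {u})" by blast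
  qed
  let ?h = "\<lambda>A. word_map f ` A"
  have "?h \<in> iso (TRAAG G) (TRAAG H)"
  proof (rule isoI)
    show "?h \<in> hom (TRAAG G) (TRAAG H)"
    proof (rule homI)
      fix A assume "A \<in> carrier (TRAAG G)"
      then show "?h A \<in> carrier (TRAAG H)"
        unfolding TRAAG_def by (metis presented_group_carrierE presented_group_carrierI cl fw)
    next
      fix A B assume "A \<in> carrier (TRAAG G)" "B \<in> carrier (TRAAG G)"
      then obtain a b where ab: "a \<in> words (verts G)" "b \<in> words (verts G)"
          "A = ?r `` {a}" "B = ?r `` {b}"
        unfolding TRAAG_def by (metis presented_group_carrierE)
      then have "a @ b \<in> words (verts G)" by simp
      from cl[OF this] cl[OF ab(1)] cl[OF ab(2)] fw[OF ab(1)] fw[OF ab(2)] ab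
      show "?h (A \<otimes>\<^bsub>TRAAG G\<^esub> B) = ?h A \<otimes>\<^bsub>TRAAG H\<^esub> ?h B"
        unfolding TRAAG_def
        by (simp add: presented_group_mult word_map_def del: in_lists_conv_set)
    qed
    have "inj_on ?h (carrier (TRAAG G))"
    proof (rule inj_onI)
      fix A B assume "A \<in> carrier (TRAAG G)" "B \<in> carrier (TRAAG G)" and eq: "?h A = ?h B"
      then obtain a b where ab: "a \<in> words (verts G)" "b \<in> words (verts G)"
          "A = ?r `` {a}" "B = ?r `` {b}"
        unfolding TRAAG_def by (metis presented_group_carrierE)
      then have "pres_eq (verts H) (TRAAG_relations H) (word_map f a) (word_map f b)"
        using eq cl pres_class_eq[OF fw[OF ab(1)] fw[OF ab(2)]] by simp
      from pres_eq_word_map[OF inv this]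
      have "pres_eq (verts G) (TRAAG_relations G) a b" using gf ab by simp
      then show "A = B" using ab pres_class_eq[OF ab(1,2)] by simp
    qed
    moreover have "?h ` carrier (TRAAG G) = carrier (TRAAG H)"
    proof (intro equalityI subsetI)
      fix B assume "B \<in> ?h ` carrier (TRAAG G)"
      then show "B \<in> carrier (TRAAG H)"
        unfolding TRAAG_def
        by (elim imageE presented_group_carrierE)
           (simp add: cl fw presented_group_carrierI del: in_lists_conv_set)
    next
      fix B assume "B \<in> carrier (TRAAG H)"
      then obtain b where b: "b \<in> words (verts H)" "B = ?s `` {b}"
        unfolding TRAAG_def by (metis presented_group_carrierE)
      then have "B = ?h (?r `` {word_map ?g b})" using cl[OF gw[OF b(1)]] fg by simp
      then show "B \<in> ?h ` carrier (TRAAG G)"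
        unfolding TRAAG_def using presented_group_carrierI[OF gw[OF b(1)]] by blast
    qed
    ultimately show "bij_betw ?h (carrier (TRAAG G)) (carrier (TRAAG H))"
      by (simp add: bij_betw_def)
  qed
  then show ?thesis by (auto simp: is_iso_def)
qed

lemma mixed_graph_isomorphism_comp:
  assumes "mixed_graph G" "mixed_graph_isomorphism f G H" "mixed_graph_isomorphism g H K"
  shows "mixed_graph_isomorphism (g \<circ> f) G K"
proof -
  have f: "bij_betw f (verts G) (verts H)"
    "\<And>x y. x \<in> verts G \<Longrightarrow> y \<in> verts G \<Longrightarrow> {x, y} \<in> edges G \<longleftrightarrow> {f x, f y} \<in> edges H"
    "\<And>x y. x \<in> verts G \<Longrightarrow> y \<in> verts G \<Longrightarrow> {x, y} \<in> dedges G \<longleftrightarrow> {f x, f y} \<in> dedges H"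
    "\<And>e. e \<in> dedges G \<Longrightarrow>
        origin H (f ` e) = f (origin G e) \<and> terminus H (f ` e) = f (terminus G e)"
    using assms(2) unfolding mixed_graph_isomorphism_def by auto
  have g: "bij_betw g (verts H) (verts K)"
    "\<And>x y. x \<in> verts H \<Longrightarrow> y \<in> verts H \<Longrightarrow> {x, y} \<in> edges H \<longleftrightarrow> {g x, g y} \<in> edges K"
    "\<And>x y. x \<in> verts H \<Longrightarrow> y \<in> verts H \<Longrightarrow> {x, y} \<in> dedges H \<longleftrightarrow> {g x, g y} \<in> dedges K"
    "\<And>e. e \<in> dedges H \<Longrightarrow>
        origin K (g ` e) = g (origin H e) \<and> terminus K (g ` e) = g (terminus H e)"
    using assms(3) unfolding mixed_graph_isomorphism_def by auto
  have fV: "f x \<in> verts H" if "x \<in> verts G" for x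
    using f(1) that by (auto simp: bij_betw_def)
  have "origin K ((g \<circ> f) ` e) = (g \<circ> f) (origin G e) \<and>
      terminus K ((g \<circ> f) ` e) = (g \<circ> f) (terminus G e)" if e: "e \<in> dedges G" for e
  proof -
    have "e = {origin G e, terminus G e}" "e \<subseteq> verts G"
      using e assms(1) unfolding mixed_graph_def by blast+
    then have "f ` e \<in> dedges H"
      using f(3)[of "origin G e" "terminus G e"] e
      by (metis (no_types) image_empty image_insert insert_subset)
    from g(4)[OF this] f(4)[OF e] show ?thesis by (simp add: image_image)
  qed
  moreover have "bij_betw (g \<circ> f) (verts G) (verts K)" using f(1) g(1) by (rule bij_betw_trans)
  ultimately show ?thesis
    unfolding mixed_graph_isomorphism_def using f(2,3) g(2,3) fV by simp
qed

lemma mixed_graph_nat_copy: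
  assumes "mixed_graph (G :: 'v mixed_graph)"
  shows "\<exists>H :: nat mixed_graph. mixed_graph H \<and> mixed_graphs_isomorphic G H"
proof -
  have fin: "finite (verts G)"
    and GE: "\<And>e. e \<in> edges G \<Longrightarrow> e \<subseteq> verts G \<and> card e = 2"
    and GD: "dedges G \<subseteq> edges G" "\<And>e. e \<in> dedges G \<Longrightarrow> e = {origin G e, terminus G e}"
    using assms unfolding mixed_graph_def by auto
  from finite_imp_inj_to_nat_seg[OF fin] obtain f :: "'v \<Rightarrow> nat" where f: "inj_on f (verts G)"
    by blast
  let ?g = "inv_into (verts G) f"
  have gim: "?g ` f ` e = e" if "e \<subseteq> verts G" for e
    by (rule inv_into_image_cancel[OF f that])
  define H :: "nat mixed_graph" where "H =
    \<lparr>verts = f ` verts G, edges = (`) f ` edges G, dedges = (`) f ` dedges G,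
     origin = (\<lambda>e. f (origin G (?g ` e))), terminus = (\<lambda>e. f (terminus G (?g ` e)))\<rparr>"
  have Gsub: "e \<subseteq> verts G" if "e \<in> edges G \<or> e \<in> dedges G" for e
    using that GE GD by blast
  have "mixed_graph H"
    unfolding mixed_graph_def
  proof (intro conjI ballI)
    show "finite (verts H)" using fin by (simp add: H_def)
    show "dedges H \<subseteq> edges H" using GD by (auto simp: H_def)
  next
    fix e assume "e \<in> edges H"
    then obtain d where d: "d \<in> edges G" "e = f ` d" by (auto simp: H_def)
    show "e \<subseteq> verts H" using d GE by (auto simp: H_def)
    show "card e = 2" using d GE f card_image inj_on_subset by metis
  next
    fix e assume "e \<in> dedges H"
    then obtain d where d: "d \<in> dedges G" "e = f ` d" by (auto simp: H_def)
    have "?g ` e = d" unfolding d(2) using gim Gsub d(1) by simp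
    then have "{origin H e, terminus H e} = f ` {origin G d, terminus G d}" by (simp add: H_def)
    then show "e = {origin H e, terminus H e}" using GD(2)[OF d(1)] d(2) by simp
  qed
  moreover have "mixed_graph_isomorphism f G H"
    unfolding mixed_graph_isomorphism_def
  proof (intro conjI ballI)
    show "bij_betw f (verts G) (verts H)" using f by (simp add: H_def bij_betw_def)
  next
    fix e assume e: "e \<in> dedges G"
    then have "?g ` f ` e = e" using Gsub gim by simp
    then show "origin H (f ` e) = f (origin G e)" "terminus H (f ` e) = f (terminus G e)"
      by (simp_all add: H_def)
  next
    fix x y assume xy: "x \<in> verts G" "y \<in> verts G"
    have *: "{x, y} \<in> S \<longleftrightarrow> {f x, f y} \<in> (`) f ` S" if S: "\<And>e. e \<in> S \<Longrightarrow> e \<subseteq> verts G" for S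
    proof
      assume "{x, y} \<in> S"
      then have "f ` {x, y} \<in> (`) f ` S" by (rule imageI)
      then show "{f x, f y} \<in> (`) f ` S" by simp
    next
      assume "{f x, f y} \<in> (`) f ` S"
      then obtain d where d: "d \<in> S" "f ` {x, y} = f ` d" by auto
      have "{x, y} \<subseteq> verts G" using xy by simp
      from gim[OF this] gim[OF S[OF d(1)]] have "{x, y} = d" unfolding d(2) by (rule subst)
      then show "{x, y} \<in> S" using d by simp
    qed
    show "{x, y} \<in> edges G \<longleftrightarrow> {f x, f y} \<in> edges H"
      using *[of "edges G"] Gsub by (simp add: H_def)
    show "{x, y} \<in> dedges G \<longleftrightarrow> {f x, f y} \<in> dedges H"
      using *[of "dedges G"] Gsub by (simp add: H_def)
  qed
  ultimately show ?thesis unfolding mixed_graphs_isomorphic_def by blast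
qed

lemma rigidD:
  fixes G :: "'v mixed_graph" and H :: "'w mixed_graph"
  assumes "rigid G" "mixed_graph G" "mixed_graph H" "TRAAG G \<cong> TRAAG H"
  shows "mixed_graphs_isomorphic G H"
proof -
  obtain K :: "nat mixed_graph" and f where K: "mixed_graph K" "mixed_graph_isomorphism f H K"
    using mixed_graph_nat_copy[OF assms(3)] unfolding mixed_graphs_isomorphic_def by blast
  have "TRAAG G \<cong> TRAAG K"
    using assms(4) TRAAG_iso_of_isomorphism[OF assms(3) K] by (rule iso_trans)
  then obtain k where "mixed_graph_isomorphism k G K"
    using assms(1) K(1) unfolding rigid_def mixed_graphs_isomorphic_def by blast
  then have "mixed_graph_isomorphism (inv_into (verts H) f \<circ> k) G H"
    using mixed_graph_isomorphism_comp[OF assms(2)]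
      mixed_graph_isomorphism_inv[OF assms(3) K] by blast
  then show ?thesis unfolding mixed_graphs_isomorphic_def by blast
qed

end

theory Submission
  imports Defs "HOL-Library.Z2" "HOL-Library.FuncSet"
begin

text \<open>
  Multiplying a satellite \<open>v\<close> of a sinkhole \<open>w\<close> by \<open>w\<close> turns commuting with its neighbours into
  inverting them and conversely, without changing the group; this changes the number of directed
  edges, so satellites prevent rigidity.

  For the converse, consider the bilinear forms on \<open>H\<^sub>1(T(\<Gamma>), \<F>\<^sub>2)\<close>, which has the vertices as a
  basis, that become coboundaries on \<open>T(\<Gamma>)\<close>. By means of Heisenberg groups these are described by
  one linear condition for each edge. If \<open>\<Gamma>\<close> is special and \<open>\<chi>\<close> is the indicator function of its
  sinkholes, then all forms \<open>y \<otimes> (y + \<chi>)\<close> are of this kind, and transporting them along an isomorphism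
  \<open>T(\<Gamma>') \<cong> T(\<Gamma>)\<close> shows that \<open>\<Gamma>'\<close> is special up to isolated vertices. The isomorphism induces an
  invertible matrix \<open>M\<close> over \<open>\<F>\<^sub>2\<close>; choose a bijection \<open>\<sigma>\<close> of the vertices with
  \<open>M (\<sigma> a) a = 1\<close> for all \<open>a\<close>. Comparing the dimensions of (twisted) centralizers shows that \<open>\<sigma>\<close>
  does not decrease degrees, hence preserves them, and in the case of equality the support of the
  column \<open>a\<close> consists of vertices dominating \<open>\<sigma> a\<close>. In the absence of satellites this makes \<open>\<sigma>\<close>
  respect sinkholes, and every such \<open>\<sigma>\<close> is an isomorphism of mixed graphs. The induced-subgraph
  conditions enter only through the fact that the neighbours of a sinkhole form a clique.
\<close>

section \<open>Linear algebra over the field with two elements\<close>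

declare add_bit_eq_xor [simp del] mult_bit_eq_and [simp del]

lemma bit_add_self [simp]: "(x::bit) + x = 0"
  by (cases x) simp_all

lemma bit_mult_self [simp]: "(x::bit) * x = x"
  by (cases x) simp_all

lemma bit_add_eq_0_iff [simp]: "(x::bit) + y = 0 \<longleftrightarrow> x = y"
  by (cases x; cases y) simp_all

lemma bit_mult_eq_1_iff [simp]: "(x::bit) * y = 1 \<longleftrightarrow> x = 1 \<and> y = 1"
  by (cases x; cases y) simp_all

text \<open>Over the two-element field this is counting: \<open>M\<close> is injective between
  finite function spaces of sizes 2^|A| and 2^|B|, and an injection between sets of equal size is
  onto.\<close>

lemma linear_system_rank:
  fixes M :: "'w \<Rightarrow> 'v \<Rightarrow> bit"
  assumes fin: "finite A" "finite B"
    and ker: "\<And>x. (\<And>u. u \<in> B \<Longrightarrow> (\<Sum>a\<in>A. M u a * x a) = 0) \<Longrightarrow> \<forall>a\<in>A. x a = 0"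
  shows "card A \<le> card B"
    and "card A = card B \<Longrightarrow> \<exists>x. \<forall>u\<in>B. (\<Sum>a\<in>A. M u a * x a) = y u"
proof -
  let ?F = "\<lambda>S. S \<rightarrow>\<^sub>E (UNIV :: bit set)"
  let ?f = "\<lambda>x. restrict (\<lambda>u. \<Sum>a\<in>A. M u a * x a) B"
  have U: "(UNIV :: bit set) = {0, 1}" using bit_not_zero_iff by auto
  have cU: "card (UNIV :: bit set) = 2" "finite (UNIV :: bit set)" unfolding U by simp_all
  have cF: "card (?F A) = 2 ^ card A" "card (?F B) = 2 ^ card B"
    using fin by (simp_all add: card_PiE cU)
  have fF: "finite (?F A)" "finite (?F B)"
    using fin cU by (simp_all add: finite_PiE)
  have inj: "inj_on ?f (?F A)"
  proof (rule inj_onI)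
    fix x x' assume x: "x \<in> ?F A" "x' \<in> ?F A" and eq: "?f x = ?f x'"
    have "\<forall>a\<in>A. x a + x' a = 0"
    proof (rule ker)
      fix u assume "u \<in> B"
      then have "(\<Sum>a\<in>A. M u a * x a) = (\<Sum>a\<in>A. M u a * x' a)"
        using fun_cong[OF eq, of u] by simp
      then show "(\<Sum>a\<in>A. M u a * (x a + x' a)) = 0"
        by (simp add: distrib_left sum.distrib)
    qed
    then show "x = x'" using x by (intro PiE_ext) auto
  qed
  have im: "?f ` ?F A \<subseteq> ?F B" by auto
  have "card (?F A) \<le> card (?F B)" by (rule card_inj_on_le[OF inj im fF(2)])
  then show "card A \<le> card B" by (simp add: cF)
  assume eq: "card A = card B"
  have "?f ` ?F A = ?F B"
    by (rule card_subset_eq[OF fF(2) im]) (simp add: card_image[OF inj] cF eq)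
  then have "restrict y B \<in> ?f ` ?F A" by simp
  then obtain x where x: "restrict y B = ?f x" by blast
  have "(\<Sum>a\<in>A. M u a * x a) = y u" if "u \<in> B" for u
    using fun_cong[OF x, of u] that by simp
  then show "\<exists>x. \<forall>u\<in>B. (\<Sum>a\<in>A. M u a * x a) = y u" by blast
qed

lemma left_inverse_transversal:
  fixes M :: "'w \<Rightarrow> 'v \<Rightarrow> bit"
  assumes "finite A" "finite B"
    and "\<And>a c. a \<in> A \<Longrightarrow> c \<in> A \<Longrightarrow> (\<Sum>u\<in>B. N a u * M u c) = of_bool (a = c)"
  shows "\<exists>\<sigma>. inj_on \<sigma> A \<and> (\<forall>a\<in>A. \<sigma> a \<in> B \<and> M (\<sigma> a) a = 1)"
  using assms
proof (induction A arbitrary: B N rule: finite_induct)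
  case empty
  then show ?case by simp
next
  case (insert v A)
  have "(\<Sum>u\<in>B. N v u * M u v) \<noteq> 0" using insert.prems(2)[of v v] by simp
  then obtain u where u: "u \<in> B" "N v u * M u v \<noteq> 0" by (meson sum.neutral)
  then have uv: "N v u = 1" "M u v = 1" by auto
  define N' where "N' a t = N a t + N a u * N v t" for a t
  have "(\<Sum>t\<in>B - {u}. N' a t * M t c) = of_bool (a = c)" if ac: "a \<in> A" "c \<in> A" for a c
  proof -
    have "(\<Sum>t\<in>B - {u}. N' a t * M t c) = (\<Sum>t\<in>B. N' a t * M t c)"
      using sum.remove[OF insert.prems(1) u(1), of "\<lambda>t. N' a t * M t c"] by (simp add: N'_def uv)
    also have "\<dots> = (\<Sum>t\<in>B. N a t * M t c) + N a u * (\<Sum>t\<in>B. N v t * M t c)"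
      unfolding N'_def by (simp only: distrib_right sum.distrib sum_distrib_left mult.assoc)
    also have "\<dots> = of_bool (a = c)"
    proof -
      have "v \<noteq> c" using ac insert.hyps(2) by blast
      then show ?thesis using insert.prems(2)[of a c] insert.prems(2)[of v c] ac by simp
    qed
    finally show ?thesis .
  qed
  then obtain \<sigma> where s: "inj_on \<sigma> A" "\<forall>a\<in>A. \<sigma> a \<in> B - {u} \<and> M (\<sigma> a) a = 1"
    using insert.IH[of "B - {u}" N'] insert.prems(1) by auto
  have "inj_on (\<sigma>(v := u)) (insert v A) \<and>
      (\<forall>a\<in>insert v A. (\<sigma>(v := u)) a \<in> B \<and> M ((\<sigma>(v := u)) a) a = 1)"
    using s insert.hyps(2) u(1) uv(2) by (auto simp: inj_on_def)
  then show ?case by blast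
qed

section \<open>Twisted graphs and their forms\<close>

definition link :: "'v mixed_graph \<Rightarrow> 'v \<Rightarrow> 'v set" where
  "link G v = {u. {u, v} \<in> edges G}"

definition star :: "'v mixed_graph \<Rightarrow> 'v \<Rightarrow> 'v set" where
  "star G v = insert v (link G v)"

text \<open>Exactly the conditions under which the elements \<open>(e_a, 0)\<close> of the
  Heisenberg group with cocycle \<open>b\<close> satisfy the defining relations: commutation
  compares \<open>b x y\<close> with \<open>b y x\<close>, and the central part of x y x differs
  from that of y by \<open>b x y + b y x + b x x\<close>.\<close>

definition form :: "'v mixed_graph \<Rightarrow> ('v \<Rightarrow> 'v \<Rightarrow> bit) \<Rightarrow> bool" where
  "form G b \<longleftrightarrow>
     (\<forall>x y. undirected_edge G x y \<longrightarrow> b x y = b y x) \<and>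
     (\<forall>x y. directed_edge G x y \<longrightarrow> b x y + b y x + b x x = 0)"

lemma mixed_graph_edgeD:
  assumes "mixed_graph G" "{x, y} \<in> edges G"
  shows "x \<in> verts G" "y \<in> verts G" "x \<noteq> y"
proof -
  have "\<forall>e\<in>edges G. e \<subseteq> verts G \<and> card e = 2" using assms(1) by (simp add: mixed_graph_def)
  from bspec[OF this assms(2)] have *: "{x, y} \<subseteq> verts G" "card {x, y} = 2" by simp_all
  then show "x \<in> verts G" "y \<in> verts G" by simp_all
  show "x \<noteq> y"
  proof
    assume "x = y"
    with *(2) show False by simp
  qed
qed

lemma mixed_graph_edge_cases:
  assumes "mixed_graph G" "{x, y} \<in> edges G"
  shows "undirected_edge G x y \<or> directed_edge G x y \<or> directed_edge G y x"
proof (cases "{x, y} \<in> dedges G")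
  case True
  have "\<forall>e\<in>dedges G. e = {origin G e, terminus G e}"
    using assms(1) by (simp add: mixed_graph_def)
  from bspec[OF this True] have "{origin G {x, y}, terminus G {x, y}} = {x, y}" by (rule HOL.sym)
  then have "origin G {x, y} = x \<and> terminus G {x, y} = y \<or>
      origin G {x, y} = y \<and> terminus G {x, y} = x"
    unfolding doubleton_eq_iff .
  moreover have "{y, x} = {x, y}" by (rule insert_commute)
  ultimately show ?thesis using True unfolding directed_edge_def by presburger
next
  case False
  then show ?thesis using assms(2) by (simp add: undirected_edge_def)
qed

lemma undirected_edgeD: "undirected_edge G x y \<Longrightarrow> {x, y} \<in> edges G"
  by (simp add: undirected_edge_def)

lemma directed_edgeD: "mixed_graph G \<Longrightarrow> directed_edge G x y \<Longrightarrow> {x, y} \<in> edges G"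
  by (auto simp: directed_edge_def mixed_graph_def)

lemma link_sym: "u \<in> link G v \<longleftrightarrow> v \<in> link G u"
  by (simp add: link_def insert_commute)

lemma link_irrefl: "mixed_graph G \<Longrightarrow> v \<notin> link G v"
  using mixed_graph_edgeD(3)[of G v v] by (auto simp: link_def)

lemma link_subset: "mixed_graph G \<Longrightarrow> link G v \<subseteq> verts G"
  using mixed_graph_edgeD(1) by (fastforce simp: link_def)

lemma finite_link: "mixed_graph G \<Longrightarrow> finite (link G v)"
  using link_subset[of G v] by (auto simp: mixed_graph_def intro: finite_subset)

lemma card_star: "mixed_graph G \<Longrightarrow> card (star G v) = Suc (card (link G v))"
  by (simp add: star_def finite_link link_irrefl)

text \<open>Special graphs, with \<open>W\<close> consisting of the sinkholes and possibly some
  isolated vertices. This freedom is needed because a group isomorphism yields such a set in the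
  other graph only through a linear functional, which may take the value 1 at isolated
  vertices.\<close>

locale twisted_graph =
  fixes G :: "'v mixed_graph" and W :: "'v set"
  assumes mixed_graph: "mixed_graph G"
    and W_verts: "W \<subseteq> verts G"
    and undirected: "undirected_edge G x y \<Longrightarrow> x \<notin> W"
    and directed: "directed_edge G x y \<Longrightarrow> x \<notin> W \<and> y \<in> W"
begin

lemmas edgeD = mixed_graph_edgeD[OF mixed_graph]

lemma finite_verts [simp]: "finite (verts G)"
  using mixed_graph by (simp add: mixed_graph_def)

lemma finite_W [simp]: "finite W"
  using finite_subset[OF W_verts] by simp

lemma edge_W:
  assumes "{x, y} \<in> edges G" "y \<in> W"
  shows "directed_edge G x y"
  using mixed_graph_edge_cases[OF mixed_graph assms(1)] assms(2) undirected directed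
  by (metis insert_commute undirected_edge_def)

lemma edge_not_W:
  assumes "{x, y} \<in> edges G" "x \<notin> W" "y \<notin> W"
  shows "undirected_edge G x y"
  using mixed_graph_edge_cases[OF mixed_graph assms(1)] assms(2,3) directed by blast

lemma link_W: "w \<in> W \<Longrightarrow> u \<in> link G w \<Longrightarrow> u \<notin> W"
  using edge_W directed by (fastforce simp: link_def)

lemma form_nonedge:
  assumes "u \<noteq> v" "{u, v} \<notin> edges G"
  shows "form G (\<lambda>p q. of_bool (p = u \<and> q = v))"
  unfolding form_def
proof (intro conjI allI impI)
  fix x y assume "undirected_edge G x y"
  then have "{x, y} \<in> edges G" by (rule undirected_edgeD)
  then show "of_bool (x = u \<and> y = v) = (of_bool (y = u \<and> x = v) :: bit)"
    using assms by (auto simp: insert_commute)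
next
  fix x y assume "directed_edge G x y"
  then have "{x, y} \<in> edges G" by (rule directed_edgeD[OF mixed_graph])
  then show "of_bool (x = u \<and> y = v) + of_bool (y = u \<and> x = v) +
      (of_bool (x = u \<and> x = v) :: bit) = 0"
    using assms by (auto simp: insert_commute)
qed

text \<open>A diagonal value enters the conditions only at origins of directed edges, and these lie
  outside \<open>W\<close>.\<close>

lemma form_W:
  assumes "w \<in> W"
  shows "form G (\<lambda>p q. of_bool (p = w \<and> q = w))"
  unfolding form_def
proof (intro conjI allI impI)
  fix x y assume "undirected_edge G x y"
  then show "of_bool (x = w \<and> y = w) = (of_bool (y = w \<and> x = w) :: bit)" by auto
next
  fix x y assume "directed_edge G x y"
  then show "of_bool (x = w \<and> y = w) + of_bool (y = w \<and> x = w) +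
      (of_bool (x = w \<and> x = w) :: bit) = 0"
    using directed assms by auto
qed

end

definition pull :: "'w set \<Rightarrow> ('w \<Rightarrow> 'v \<Rightarrow> bit) \<Rightarrow> ('w \<Rightarrow> 'w \<Rightarrow> bit) \<Rightarrow> 'v \<Rightarrow> 'v \<Rightarrow> bit" where
  "pull S M b = (\<lambda>a c. \<Sum>u\<in>S. \<Sum>v\<in>S. b u v * (M u a * M v c))"

lemma pull_rank_one:
  "pull S M (\<lambda>p q. f p * g q) a c = (\<Sum>u\<in>S. f u * M u a) * (\<Sum>v\<in>S. g v * M v c)"
  by (simp add: pull_def sum_product mult_ac)

lemma sum_delta_bit:
  "finite S \<Longrightarrow> (\<Sum>u\<in>S. of_bool (u = v) * f u) = (if v \<in> S then f v else (0::bit))"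
  "finite S \<Longrightarrow> (\<Sum>u\<in>S. f u * of_bool (u = v)) = (if v \<in> S then f v else (0::bit))"
proof -
  have *: "of_bool (u = v) * f u = (if u = v then f u else 0)"
    "f u * of_bool (u = v) = (if u = v then f u else 0)" for u
    by simp_all
  show "finite S \<Longrightarrow> (\<Sum>u\<in>S. of_bool (u = v) * f u) = (if v \<in> S then f v else 0)"
    "finite S \<Longrightarrow> (\<Sum>u\<in>S. f u * of_bool (u = v)) = (if v \<in> S then f v else 0)"
    unfolding * by (simp_all add: sum.delta)
qed

lemma pull_unit:
  assumes "finite S" "u \<in> S" "v \<in> S"
  shows "pull S M (\<lambda>p q. of_bool (p = u \<and> q = v)) = (\<lambda>a c. M u a * M v c)"
  using pull_rank_one[of S M "\<lambda>p. of_bool (p = u)" "\<lambda>q. of_bool (q = v)"] assms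
  by (simp add: fun_eq_iff sum_delta_bit of_bool_conj)

section \<open>The trace of a group isomorphism on mod 2 homology\<close>

locale transfer =
  source: twisted_graph G W + target: twisted_graph H U
  for G :: "'v mixed_graph" and W and H :: "'w mixed_graph" and U +
  fixes M :: "'w \<Rightarrow> 'v \<Rightarrow> bit" and N :: "'v \<Rightarrow> 'w \<Rightarrow> bit"
  assumes NM: "a \<in> verts G \<Longrightarrow> c \<in> verts G \<Longrightarrow> (\<Sum>u\<in>verts H. N a u * M u c) = of_bool (a = c)"
    and MN: "u \<in> verts H \<Longrightarrow> v \<in> verts H \<Longrightarrow> (\<Sum>a\<in>verts G. M u a * N a v) = of_bool (u = v)"
    and pull_M: "form H b \<Longrightarrow> form G (pull (verts H) M b)"
    and pull_N: "form G b' \<Longrightarrow> form H (pull (verts G) N b')"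
    and sum_U_M: "a \<in> verts G \<Longrightarrow> (\<Sum>w\<in>U. M w a) = of_bool (a \<in> W)"
    and sum_W_N: "u \<in> verts H \<Longrightarrow> (\<Sum>w\<in>W. N w u) = of_bool (u \<in> U)"
begin

text \<open>The hypotheses are symmetric in the two graphs, so every result about \<open>M\<close>
  also holds for \<open>N\<close> with source and target exchanged.\<close>

lemma flip: "transfer H U G W N M"
  by unfold_locales (fact NM MN pull_M pull_N sum_U_M sum_W_N)+

text \<open>A rank one form pulls back to a product of two rows of \<open>M\<close>. Evaluated on an
  edge of \<open>G\<close> it makes the minor of these rows in the two end columns vanish, with a
  diagonal correction if the edge is directed.\<close>

lemma form_M_nonedge:
  assumes "u \<in> verts H" "v \<in> verts H" "u \<noteq> v" "{u, v} \<notin> edges H"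
  shows "form G (\<lambda>a c. M u a * M v c)"
  using pull_M[OF target.form_nonedge[OF assms(3,4)]] assms by (simp add: pull_unit)

lemma form_M_U:
  assumes "w \<in> U"
  shows "form G (\<lambda>a c. M w a * M w c)"
  using pull_M[OF target.form_W[OF assms]] assms target.W_verts by (simp add: pull_unit subset_iff)

lemma undirected_nonedge:
  assumes "u \<in> verts H" "v \<in> verts H" "u \<noteq> v" "{u, v} \<notin> edges H" "undirected_edge G a c"
  shows "M u a * M v c = M u c * M v a"
  using form_M_nonedge[OF assms(1-4)] assms(5) unfolding form_def by blast

lemma directed_nonedge:
  assumes "u \<in> verts H" "v \<in> verts H" "u \<noteq> v" "{u, v} \<notin> edges H" "directed_edge G a c"
  shows "M u a * M v c + M u c * M v a + M u a * M v a = 0"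
  using form_M_nonedge[OF assms(1-4)] assms(5) unfolding form_def by blast

text \<open>In the pulled back square of row \<open>w\<close> the two mixed terms are equal and
  cancel, so the condition of the directed edge leaves only the diagonal term at its origin.\<close>

lemma directed_U:
  assumes "w \<in> U" "directed_edge G a c"
  shows "M w a = 0"
  using form_M_U[OF assms(1)] assms(2) unfolding form_def by (fastforce simp: mult.commute[of "M w c"])

lemma N_inj:
  assumes "\<And>u. u \<in> verts H \<Longrightarrow> (\<Sum>a\<in>verts G. M u a * x a) = 0" "a \<in> verts G"
  shows "x a = 0"
proof -
  have "x a = (\<Sum>c\<in>verts G. of_bool (a = c) * x c)"
    using assms(2) by (simp add: sum_delta_bit eq_commute[of a])
  also have "\<dots> = (\<Sum>c\<in>verts G. (\<Sum>u\<in>verts H. N a u * M u c) * x c)"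
    using NM assms(2) by simp
  also have "\<dots> = (\<Sum>u\<in>verts H. N a u * (\<Sum>c\<in>verts G. M u c * x c))"
    by (simp add: sum_distrib_left sum_distrib_right mult.assoc) (rule sum.swap)
  finally show ?thesis using assms(1) by simp
qed

lemma ker_subset:
  assumes "A \<subseteq> verts G" "\<And>u. u \<in> verts H \<Longrightarrow> (\<Sum>a\<in>A. M u a * x a) = 0"
  shows "\<forall>a\<in>A. x a = 0"
proof -
  define x' where "x' a = (if a \<in> A then x a else 0)" for a
  have "(\<Sum>a\<in>verts G. M u a * x' a) = 0" if "u \<in> verts H" for u
    using assms(2)[OF that] assms(1) sum.mono_neutral_right[of "verts G" A "\<lambda>a. M u a * x' a"]
    by (simp add: x'_def)
  then show ?thesis using N_inj[of x'] assms(1) by (metis x'_def subsetD)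
qed

text \<open>The columns of \<open>M\<close> indexed by \<open>A\<close> are independent by
  \<open>ker_subset\<close>; if they live on the rows \<open>B\<close>, the block \<open>B\<close>
  by \<open>A\<close> is injective, and onto when it is square.\<close>

lemma support_rank:
  assumes "A \<subseteq> verts G" "B \<subseteq> verts H"
    and "\<And>a u. a \<in> A \<Longrightarrow> u \<in> verts H \<Longrightarrow> M u a = 1 \<Longrightarrow> u \<in> B"
  shows "card A \<le> card B"
    and "card A = card B \<Longrightarrow> \<exists>x. \<forall>u\<in>B. (\<Sum>a\<in>A. M u a * x a) = y u"
proof -
  have fin: "finite A" "finite B"
    using finite_subset[OF assms(1)] finite_subset[OF assms(2)] by simp_all
  have ker: "\<forall>a\<in>A. x a = 0" if "\<And>u. u \<in> B \<Longrightarrow> (\<Sum>a\<in>A. M u a * x a) = 0" for x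
  proof (rule ker_subset[OF assms(1)])
    fix u assume u: "u \<in> verts H"
    show "(\<Sum>a\<in>A. M u a * x a) = 0"
    proof (cases "u \<in> B")
      case False
      then have "M u a = 0" if "a \<in> A" for a using assms(3) that u bit_not_zero_iff by metis
      then show ?thesis by simp
    qed (rule that)
  qed
  show "card A \<le> card B" by (rule linear_system_rank(1)[OF fin ker])
  show "card A = card B \<Longrightarrow> \<exists>x. \<forall>u\<in>B. (\<Sum>a\<in>A. M u a * x a) = y u"
    by (rule linear_system_rank(2)[OF fin ker])
qed

lemma support_rank_surj:
  assumes "A \<subseteq> verts G" "B \<subseteq> verts H" "card A = card B"
    and "\<And>a u. a \<in> A \<Longrightarrow> u \<in> verts H \<Longrightarrow> M u a = 1 \<Longrightarrow> u \<in> B"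
    and "u \<in> B"
  shows "\<exists>a\<in>A. M u a = 1"
proof -
  have "\<exists>x. \<forall>u\<in>B. (\<Sum>a\<in>A. M u a * x a) = 1"
  proof (rule support_rank(2)[where y = "\<lambda>_. 1"])
    show "A \<subseteq> verts G" "B \<subseteq> verts H" "card A = card B" by (fact assms)+
    show "v \<in> B" if "a \<in> A" "v \<in> verts H" "M v a = 1" for a v by (rule assms(4)[OF that])
  qed
  then obtain x where "(\<Sum>a\<in>A. M u a * x a) = 1" using assms(5) by blast
  then have "(\<Sum>a\<in>A. M u a * x a) \<noteq> 0" by simp
  then obtain a where "a \<in> A" "M u a * x a \<noteq> 0" by (meson sum.neutral)
  then show ?thesis by auto
qed

lemma transversal:
  obtains \<sigma> where "bij_betw \<sigma> (verts G) (verts H)" "\<And>a. a \<in> verts G \<Longrightarrow> M (\<sigma> a) a = 1"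
proof -
  obtain \<sigma> where s: "inj_on \<sigma> (verts G)" "\<forall>a\<in>verts G. \<sigma> a \<in> verts H \<and> M (\<sigma> a) a = 1"
    using left_inverse_transversal[of "verts G" "verts H" N M] NM by auto
  obtain \<tau> where t: "inj_on \<tau> (verts H)" "\<forall>a\<in>verts H. \<tau> a \<in> verts G \<and> N (\<tau> a) a = 1"
    using left_inverse_transversal[of "verts H" "verts G" M N] MN by auto
  have "card (verts H) \<le> card (verts G)" using t by (intro card_inj_on_le[of \<tau>]) auto
  then have "\<sigma> ` verts G = verts H"
    using s by (intro card_seteq) (auto simp: card_image)
  then have "bij_betw \<sigma> (verts G) (verts H)" using s(1) by (simp add: bij_betw_def)
  with s that show thesis by blast
qed

text \<open>Puts both kinds of edges and the trivial case \<open>c = a\<close> into one identity. It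
  is linear in column \<open>c\<close> and the bit \<open>of_bool (c \<in> W)\<close>, so it extends
  to linear combinations over the star.\<close>

lemma star_nonedge:
  assumes "a \<notin> W" "c \<in> star G a" "u \<in> verts H" "v \<in> verts H" "u \<noteq> v" "{u, v} \<notin> edges H"
  shows "M u a * M v c + M v a * M u c = of_bool (c \<in> W) * (M u a * M v a)"
proof (cases "c = a")
  case True
  then show ?thesis using assms(1) by (simp add: mult.commute)
next
  case False
  then have e: "{a, c} \<in> edges G" using assms(2) by (simp add: star_def link_def insert_commute)
  show ?thesis
  proof (cases "c \<in> W")
    case True
    have "M u a * M v c + M u c * M v a + M u a * M v a = 0"
      by (rule directed_nonedge[OF assms(3-6) source.edge_W[OF e True]])
    then show ?thesis using True by (simp add: mult.commute)
  next
    case False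
    have "M u a * M v c = M u c * M v a"
      by (rule undirected_nonedge[OF assms(3-6) source.edge_not_W[OF e assms(1) False]])
    then show ?thesis using False by (simp add: mult.commute)
  qed
qed

lemma star_U:
  assumes "a \<notin> W" "c \<in> star G a" "c \<in> W" "w \<in> U"
  shows "M w a = 0"
proof -
  have "{a, c} \<in> edges G" using assms(1-3) by (auto simp: star_def link_def insert_commute)
  then show ?thesis using directed_U[OF assms(4)] source.edge_W assms(3) by blast
qed

section \<open>Twisted centralizers: combinations of the columns in a star\<close>

context
  fixes a u and x :: "'v \<Rightarrow> bit" and y :: "'w \<Rightarrow> bit" and \<epsilon> :: bit
  assumes a: "a \<in> verts G" "a \<notin> W" and u: "u \<in> verts H" "M u a = 1"
  defines "y \<equiv> \<lambda>v. \<Sum>c\<in>star G a. M v c * x c"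
    and "\<epsilon> \<equiv> \<Sum>c\<in>star G a. of_bool (c \<in> W) * x c"
begin

lemma star_verts: "star G a \<subseteq> verts G"
  using a(1) link_subset[OF source.mixed_graph] by (auto simp: star_def)

lemma combination_nonedge:
  assumes "s \<in> verts H" "t \<in> verts H" "s \<noteq> t" "{s, t} \<notin> edges H"
  shows "M s a * y t + M t a * y s = \<epsilon> * (M s a * M t a)"
proof -
  have "M s a * y t + M t a * y s = (\<Sum>c\<in>star G a. (M s a * M t c + M t a * M s c) * x c)"
    unfolding y_def by (simp only: sum_distrib_left sum.distrib distrib_right mult.assoc)
  also have "\<dots> = (\<Sum>c\<in>star G a. (of_bool (c \<in> W) * (M s a * M t a)) * x c)"
    by (rule sum.cong[OF HOL.refl], rule arg_cong2[where f = "(*)", OF _ HOL.refl],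
        rule star_nonedge[OF a(2) _ assms])
  also have "\<dots> = \<epsilon> * (M s a * M t a)"
    unfolding \<epsilon>_def sum_distrib_right by (simp only: mult_ac)
  finally show ?thesis .
qed

lemma combination_U:
  assumes "w \<in> U" "\<epsilon> = 1"
  shows "M w a = 0"
proof -
  have "\<epsilon> \<noteq> 0" using assms(2) by simp
  then obtain c where c: "c \<in> star G a" "of_bool (c \<in> W) * x c \<noteq> 0"
    unfolding \<epsilon>_def by (meson sum.neutral)
  then have "c \<in> W" by (cases "c \<in> W") simp_all
  with c(1) show ?thesis using star_U[OF a(2)] assms(1) by blast
qed

lemma sum_U_combination: "(\<Sum>w\<in>U. y w) = \<epsilon>"
proof -
  have "(\<Sum>w\<in>U. y w) = (\<Sum>c\<in>star G a. (\<Sum>w\<in>U. M w c) * x c)"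
    unfolding y_def sum_distrib_right by (rule sum.swap)
  also have "\<dots> = \<epsilon>"
    unfolding \<epsilon>_def using star_verts
    by (intro sum.cong[OF HOL.refl] arg_cong2[where f = "(*)", OF _ HOL.refl] sum_U_M) blast
  finally show ?thesis .
qed

text \<open>The identity of \<open>combination_nonedge\<close> for the pair \<open>u\<close>,
  \<open>v\<close>, with \<open>M u a = 1\<close> and \<open>y u = 0\<close>: outside the star of
  \<open>u\<close> the vector \<open>y\<close> is determined by \<open>\<epsilon>\<close>.\<close>

lemma combination_off_star:
  assumes "y u = 0" "v \<in> verts H" "v \<notin> star H u"
  shows "y v = \<epsilon> * M v a"
proof -
  have "u \<noteq> v" "{u, v} \<notin> edges H"
    using assms(3) link_sym[of v H u] by (auto simp: star_def link_def)
  from combination_nonedge[OF u(1) assms(2) this] show ?thesis using assms(1) u(2) by simp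
qed

text \<open>Off the star of \<open>u\<close>, \<open>y\<close> equals \<open>\<epsilon>\<close>
  times column \<open>a\<close>. If \<open>\<epsilon>\<close> were 1, column \<open>a\<close> and
  hence \<open>y\<close> would vanish on \<open>U\<close>, whereas the sum of \<open>y\<close> over
  \<open>U\<close> is \<open>\<epsilon>\<close>.\<close>

lemma combination_kernel:
  assumes "\<And>v. v \<in> star H u \<Longrightarrow> y v = 0" "v \<in> verts H"
  shows "y v = 0"
proof -
  have yu: "y u = 0" using assms(1) by (simp add: star_def)
  have off: "y v = \<epsilon> * M v a" if "v \<in> verts H" "v \<notin> star H u" for v
    using combination_off_star[OF yu] that by simp
  have "\<epsilon> = 0"
  proof (rule ccontr)
    assume "\<epsilon> \<noteq> 0"
    then have e: "\<epsilon> = 1" by simp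
    have "y w = 0" if "w \<in> U" for w
      using combination_U[OF that e] assms(1) off that target.W_verts
      by (cases "w \<in> star H u") auto
    then have "(\<Sum>w\<in>U. y w) = 0" by simp
    then show False using sum_U_combination e by simp
  qed
  then show ?thesis using off assms by (cases "v \<in> star H u") auto
qed

text \<open>If \<open>c\<close> were not in the star of \<open>s\<close>, the identity for the pair
  \<open>c\<close>, \<open>s\<close> would apply. It fails at once when \<open>s\<close> is outside
  the star of \<open>u\<close>; when \<open>s\<close> is inside, it forces \<open>\<epsilon>\<close>
  and \<open>M c a\<close> to be 1, so that \<open>y\<close> vanishes on \<open>U\<close> although
  its sum there is \<open>\<epsilon>\<close>.\<close>

lemma combination_unit:
  assumes "c \<in> link H u" "s \<in> verts H" "M s a = 1"
    and "\<And>v. v \<in> star H u \<Longrightarrow> y v = of_bool (v = c)"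
  shows "c \<in> star H s"
proof (rule ccontr)
  assume c: "c \<notin> star H s"
  have cV: "c \<in> verts H" "c \<noteq> u"
    using assms(1) link_subset[OF target.mixed_graph] link_irrefl[OF target.mixed_graph] by auto
  then have yu: "y u = 0" and yc: "y c = 1" using assms(1,4) by (auto simp: star_def)
  have "c \<noteq> s" "{c, s} \<notin> edges H" using c by (auto simp: star_def link_def)
  from combination_nonedge[OF cV(1) assms(2) this] yc assms(3)
  have *: "M c a * y s + 1 = \<epsilon> * M c a" by simp
  show False
  proof (cases "s \<in> star H u")
    case True
    then have "y s = 0" using assms(4) \<open>c \<noteq> s\<close> by simp
    with * have e: "\<epsilon> = 1" "M c a = 1" by (cases \<epsilon>; cases "M c a"; simp)+
    \<comment> \<open>On the star of \<open>u\<close> the vector \<open>y\<close> is 1 only at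
      \<open>c\<close>, and \<open>c\<close> is not in \<open>U\<close> because
      \<open>M c a = 1\<close>.\<close>
    have "y w = 0" if "w \<in> U" for w
    proof (cases "w \<in> star H u")
      case True
      then show ?thesis using combination_U[OF that e(1)] e(2) assms(4) by (cases "w = c") auto
    next
      case False
      then show ?thesis
        using combination_off_star[OF yu _ False] combination_U[OF that e(1)] that target.W_verts
        by auto
    qed
    then have "(\<Sum>w\<in>U. y w) = 0" by simp
    then show False using sum_U_combination e(1) by simp
  next
    case False
    with combination_off_star[OF yu assms(2)] assms(3) * show False
      by (cases \<epsilon>; cases "M c a"; simp)
  qed
qed

end

lemma star_kernel:
  assumes "a \<in> verts G" "a \<notin> W" "u \<in> verts H" "M u a = 1"
    and "\<And>v. v \<in> star H u \<Longrightarrow> (\<Sum>c\<in>star G a. M v c * x c) = 0"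
  shows "\<forall>c\<in>star G a. x c = 0"
proof (rule ker_subset[OF star_verts[OF assms(1-4)]])
  fix v assume v: "v \<in> verts H"
  show "(\<Sum>c\<in>star G a. M v c * x c) = 0"
    by (rule combination_kernel[OF assms(1-4) _ v]) (rule assms(5))
qed

lemma finite_star: "finite (star G a)" "finite (star H u)"
  by (simp_all add: star_def finite_link source.mixed_graph target.mixed_graph)

text \<open>The block of \<open>M\<close> with rows \<open>star H u\<close> and columns
  \<open>star G a\<close> is injective by \<open>star_kernel\<close>. Hence degrees do not decrease
  from \<open>a\<close> to any vertex in the support of its column.\<close>

lemma card_star_le:
  assumes "a \<in> verts G" "a \<notin> W" "u \<in> verts H" "M u a = 1"
  shows "card (star G a) \<le> card (star H u)"
  by (rule linear_system_rank(1)[OF finite_star star_kernel[OF assms]])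

text \<open>When the degrees agree this block is also onto, so the unit vector at any neighbour
  \<open>c\<close> of \<open>u\<close> is a combination to which \<open>combination_unit\<close>
  applies.\<close>

lemma link_subset_star:
  assumes "a \<in> verts G" "a \<notin> W" "u \<in> verts H" "M u a = 1" "card (link G a) = card (link H u)"
    and "s \<in> verts H" "M s a = 1"
  shows "link H u \<subseteq> star H s"
proof
  fix c assume c: "c \<in> link H u"
  have "card (star G a) = card (star H u)"
    using assms(5) by (simp add: card_star source.mixed_graph target.mixed_graph)
  from linear_system_rank(2)[OF finite_star star_kernel[OF assms(1-4)] this,
      where y = "\<lambda>v. of_bool (v = c)"]
  obtain x where "\<forall>v\<in>star H u. (\<Sum>c\<in>star G a. M v c * x c) = of_bool (v = c)" by blast
  then show "c \<in> star H s" using combination_unit[OF assms(1-4) c assms(6,7)] by blast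
qed

section \<open>Columns of twisted vertices and of their neighbours\<close>

lemma W_meets_U:
  assumes "w \<in> W"
  obtains s where "s \<in> U" "M s w = 1"
proof -
  have "(\<Sum>s\<in>U. M s w) \<noteq> 0" using sum_U_M assms source.W_verts by auto
  then obtain s where "s \<in> U" "M s w \<noteq> 0" by (meson sum.neutral)
  then show thesis using that by simp
qed

lemma link_W_directed: "a \<in> link G w \<Longrightarrow> w \<in> W \<Longrightarrow> directed_edge G a w"
  by (simp add: link_def source.edge_W)

text \<open>The directed edge from \<open>a\<close> to \<open>w\<close> kills row \<open>s\<close>
  at \<open>a\<close>. If \<open>u\<close> and \<open>s\<close> were not adjacent, the minor
  condition of their rows would then reduce to \<open>M u a * M s w = 0\<close>.\<close>

lemma link_W_support:
  assumes "w \<in> W" "s \<in> U" "M s w = 1" "a \<in> link G w" "u \<in> verts H" "M u a = 1"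
  shows "u \<in> link H s"
proof (rule ccontr)
  assume n: "u \<notin> link H s"
  note d = link_W_directed[OF assms(4,1)]
  have sa: "M s a = 0" by (rule directed_U[OF assms(2) d])
  then have "u \<noteq> s" "{u, s} \<notin> edges H" using n assms(6) by (auto simp: link_def)
  from directed_nonedge[OF assms(5) _ this d] show False
    using assms(2,3,6) sa target.W_verts by auto
qed

text \<open>By \<open>link_W_support\<close> row \<open>u\<close> vanishes at \<open>a\<close>, as
  row \<open>s\<close> does; the previous argument then repeats with \<open>u\<close> in the place
  of \<open>s\<close>, although \<open>u\<close> need not lie in \<open>U\<close>.\<close>

lemma link_W_support':
  assumes "w \<in> W" "s \<in> U" "M s w = 1" "u \<in> verts H" "M u w = 1" "u \<notin> link H s"
    and "a \<in> link G w" "b \<in> verts H" "M b a = 1"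
  shows "b \<in> link H u"
proof (rule ccontr)
  assume n: "b \<notin> link H u"
  note d = link_W_directed[OF assms(7,1)]
  have ua: "M u a = 0" using link_W_support[OF assms(1-3,7,4)] assms(6) bit_not_one_iff by blast
  then have "u \<noteq> b" "{u, b} \<notin> edges H" using n assms(9) by (auto simp: link_def insert_commute)
  from directed_nonedge[OF assms(4,8) this d] show False using assms(5,9) ua by simp
qed

lemma clique_link_card:
  assumes clique: "\<And>b c. b \<in> link H s \<Longrightarrow> c \<in> link H s \<Longrightarrow> b \<noteq> c \<Longrightarrow> {b, c} \<in> edges H"
    and "u \<in> link H s"
  shows "insert s (link H s - {u}) \<subseteq> link H u" "card (insert s (link H s - {u})) = card (link H s)"
proof -
  show "insert s (link H s - {u}) \<subseteq> link H u"
    using assms(2) clique[OF _ assms(2)] link_sym[of s H u] by (auto simp: link_def)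
  have "s \<notin> link H s" by (rule link_irrefl[OF target.mixed_graph])
  then show "card (insert s (link H s - {u})) = card (link H s)"
    using assms(2) finite_link[OF target.mixed_graph, of s] card.remove[of "link H s" u] by simp
qed

text \<open>Either \<open>u\<close> lies in the clique \<open>link H s\<close>, whose size bounds
  the degree of \<open>w\<close> and is at most the degree of \<open>u\<close>, or the columns of
  the neighbours of \<open>w\<close> are supported in \<open>link H u\<close>.\<close>

lemma card_link_W_le:
  assumes clique: "\<And>s b c. s \<in> U \<Longrightarrow> b \<in> link H s \<Longrightarrow> c \<in> link H s \<Longrightarrow> b \<noteq> c \<Longrightarrow> {b, c} \<in> edges H"
    and w: "w \<in> W" and u: "u \<in> verts H" "M u w = 1"
  shows "card (link G w) \<le> card (link H u)"
proof -
  obtain s where s: "s \<in> U" "M s w = 1" using W_meets_U[OF w] .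
  note V = link_subset[OF source.mixed_graph] link_subset[OF target.mixed_graph]
  show ?thesis
  proof (cases "u \<in> link H s")
    case True
    have "card (link G w) \<le> card (link H s)"
      using link_W_support[OF w s] by (intro support_rank(1)[OF V]) blast
    also have "\<dots> \<le> card (link H u)"
      using clique_link_card[of s u] clique[OF s(1)] True
        card_mono[OF finite_link[OF target.mixed_graph, of u]] by metis
    finally show ?thesis .
  next
    case False
    then show ?thesis
      using link_W_support'[OF w s u] by (intro support_rank(1)[OF V]) blast
  qed
qed

text \<open>For non-adjacent \<open>a\<close>, \<open>c\<close> the unit form at the pair
  \<open>a\<close>, \<open>c\<close> is not symmetric there. Its transport \<open>F\<close> to
  \<open>H\<close> is, however, symmetric wherever columns \<open>a\<close> and \<open>c\<close> of
  \<open>M\<close> live, since they are supported in the clique \<open>link H s\<close>, whose edges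
  are undirected.\<close>

lemma clique_transfer:
  assumes clique: "\<And>s b c. s \<in> U \<Longrightarrow> b \<in> link H s \<Longrightarrow> c \<in> link H s \<Longrightarrow> b \<noteq> c \<Longrightarrow> {b, c} \<in> edges H"
    and w: "w \<in> W" and ac: "a \<in> link G w" "c \<in> link G w" "a \<noteq> c"
  shows "{a, c} \<in> edges G"
proof (rule ccontr)
  assume n: "{a, c} \<notin> edges G"
  interpret flip: transfer H U G W N M by (rule flip)
  obtain s where s: "s \<in> U" "M s w = 1" using W_meets_U[OF w] .
  have V: "a \<in> verts G" "c \<in> verts G" using ac link_subset[OF source.mixed_graph] by auto
  define F where "F p q = N a p * N c q" for p q
  have F: "form H F" unfolding F_def by (rule flip.form_M_nonedge[OF V ac(3) n])
  have sym: "F p q * (M p a * M q c) = F q p * (M p a * M q c)"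
    if pq: "p \<in> verts H" "q \<in> verts H" for p q
  proof (cases "M p a = 1 \<and> M q c = 1")
    case True
    then have l: "p \<in> link H s" "q \<in> link H s"
      using link_W_support[OF w s] ac pq by auto
    show ?thesis
    proof (cases "p = q")
      case False
      then have "undirected_edge H p q"
        using clique[OF s(1) l] target.link_W[OF s(1)] l target.edge_not_W by blast
      then have "F p q = F q p" using F unfolding form_def by blast
      then show ?thesis by simp
    qed simp
  next
    case False
    then show ?thesis by auto
  qed
  let ?S = "\<lambda>f g. \<Sum>p\<in>verts H. \<Sum>q\<in>verts H. F p q * (M p f * M q g)"
  \<comment> \<open>Transporting \<open>F\<close> back along \<open>M\<close> returns the unit form,
    by \<open>NM\<close>.\<close>
  have S: "?S f g = of_bool (a = f) * of_bool (c = g)" if "f \<in> verts G" "g \<in> verts G" for f g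
  proof -
    have "?S f g = (\<Sum>p\<in>verts H. N a p * M p f) * (\<Sum>q\<in>verts H. N c q * M q g)"
      unfolding F_def sum_product by (simp only: mult_ac)
    then show ?thesis using NM V that by simp
  qed
  have "?S c a = (\<Sum>q\<in>verts H. \<Sum>p\<in>verts H. F p q * (M p c * M q a))" by (rule sum.swap)
  also have "\<dots> = (\<Sum>q\<in>verts H. \<Sum>p\<in>verts H. F q p * (M q a * M p c))"
  proof (intro sum.cong[OF HOL.refl])
    fix p q assume "p \<in> verts H" "q \<in> verts H"
    from sym[OF this(2,1)] show "F p q * (M p c * M q a) = F q p * (M q a * M p c)"
      by (simp only: mult.commute[of "M p c"])
  qed
  finally have "?S c a = ?S a c" .
  then show False using S[of c a] S[of a c] V ac(3) by simp
qed

end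

text \<open>Domination of vertices, \<open>link G u \<subseteq> star G s\<close>, is a preorder;
  only the neighbour \<open>p = s\<close> of \<open>u\<close> needs an argument.\<close>

lemma link_star_trans:
  assumes "link G u \<subseteq> star G s" "link G s \<subseteq> star G t"
  shows "link G u \<subseteq> star G t"
proof
  fix p assume p: "p \<in> link G u"
  show "p \<in> star G t"
  proof (cases "p = s")
    case True
    then have "u \<in> link G s" using p by (simp add: link_sym)
    then have "u = t \<or> t \<in> link G u" using assms(2) link_sym[of u G t] by (auto simp: star_def)
    then show ?thesis
    proof
      assume "u = t"
      then show ?thesis using p by (simp add: star_def)
    next
      assume "t \<in> link G u"
      then have "t = s \<or> t \<in> link G s" using assms(1) by (auto simp: star_def)
      then show ?thesis using True link_sym[of t G s] by (auto simp: star_def)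
    qed
  next
    case False
    then show ?thesis using p assms by (auto simp: star_def)
  qed
qed

section \<open>Degree-preserving transversals in the absence of satellites\<close>

locale matched_transfer = transfer +
  fixes \<sigma> :: "'a \<Rightarrow> 'b"
  assumes bij: "bij_betw \<sigma> (verts G) (verts H)"
    and M_\<sigma>: "a \<in> verts G \<Longrightarrow> M (\<sigma> a) a = 1"
    and card_link_\<sigma>: "a \<in> verts G \<Longrightarrow> card (link H (\<sigma> a)) = card (link G a)"
    and no_satellite:
      "\<lbrakk>w \<in> U; v \<in> verts H; v \<noteq> w; v \<notin> link H w; link H v \<noteq> {}\<rbrakk> \<Longrightarrow> \<not> link H v \<subseteq> link H w"
begin

lemma \<sigma>_verts: "a \<in> verts G \<Longrightarrow> \<sigma> a \<in> verts H"
  using bij by (auto simp: bij_betw_def)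

lemma link_\<sigma>_empty: "a \<in> verts G \<Longrightarrow> link H (\<sigma> a) = {} \<longleftrightarrow> link G a = {}"
  using card_link_\<sigma>[of a] finite_link[OF source.mixed_graph, of a]
    finite_link[OF target.mixed_graph, of "\<sigma> a"] by (metis card_eq_0_iff)

lemma link_\<sigma>_star:
  assumes "a \<in> verts G" "a \<notin> W" "s \<in> verts H" "M s a = 1"
  shows "link H (\<sigma> a) \<subseteq> star H s"
  using link_subset_star[OF assms(1,2) \<sigma>_verts[OF assms(1)] M_\<sigma>[OF assms(1)]
      card_link_\<sigma>[OF assms(1), symmetric] assms(3,4)] .

text \<open>Column \<open>a\<close> has even sum over \<open>U\<close>, so a support vertex in
  \<open>U\<close> brings a second one. Both dominate \<open>\<sigma> a\<close>, and they are not
  adjacent. One of them differs from \<open>\<sigma> a\<close>; its link contains that of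
  \<open>\<sigma> a\<close>, which is therefore its satellite.\<close>

lemma support_not_U:
  assumes a: "a \<in> verts G" "a \<notin> W" "link G a \<noteq> {}" and s: "M s a = 1"
  shows "s \<notin> U"
proof
  assume "s \<in> U"
  let ?u = "\<sigma> a"
  have sum: "(\<Sum>w\<in>U. M w a) = 0" using sum_U_M a by simp
  have "\<exists>t\<in>U. t \<noteq> s \<and> M t a = 1"
  proof (rule ccontr)
    assume "\<not> ?thesis"
    then have "M t a = 0" if "t \<in> U - {s}" for t using that by auto
    then have "(\<Sum>w\<in>U. M w a) = 1" using sum.remove[of U s "\<lambda>w. M w a"] \<open>s \<in> U\<close> s by simp
    with sum show False by simp
  qed
  then obtain t where t: "t \<in> U" "t \<noteq> s" "M t a = 1" by blast
  have *: False if w: "w \<in> U" "w' \<in> U" "w \<noteq> w'" "w \<noteq> ?u" "M w a = 1" "M w' a = 1" for w w'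
  proof -
    have V: "w \<in> verts H" "w' \<in> verts H" using w(1,2) target.W_verts by auto
    have sub: "link H ?u \<subseteq> star H w" "link H ?u \<subseteq> star H w'"
      using link_\<sigma>_star[OF a(1,2)] V w(5,6) by simp_all
    have "w \<notin> star H w'" using w(1-3) target.link_W[of w' w] by (auto simp: star_def)
    then have n: "w \<notin> link H ?u" using sub(2) by blast
    then have "link H ?u \<subseteq> link H w" using sub(1) by (auto simp: star_def)
    moreover have "link H ?u \<noteq> {}" using link_\<sigma>_empty a by simp
    moreover have "?u \<notin> link H w" using n link_sym[of w H ?u] by simp
    ultimately show False using no_satellite[OF w(1) \<sigma>_verts[OF a(1)]] w(4) by blast
  qed
  show False using *[of s t] *[of t s] \<open>s \<in> U\<close> s t by metis
qed

text \<open>Suppose \<open>\<sigma> w\<close> is outside \<open>U\<close>, and let \<open>s\<close>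
  in \<open>U\<close> belong to the support of column \<open>w\<close>. If \<open>\<sigma> w\<close>
  is adjacent to \<open>s\<close>, equal sizes force \<open>\<sigma>\<close> to map
  \<open>link G w\<close> onto \<open>link H s\<close>, so \<open>\<sigma> w\<close> would be the
  image of a neighbour of \<open>w\<close>. Otherwise the supports of the neighbouring columns cover
  \<open>link H (\<sigma> w)\<close> and lie in \<open>link H s\<close>, so
  \<open>\<sigma> w\<close> is a satellite of \<open>s\<close>.\<close>

lemma \<sigma>_W_of_clique:
  assumes clique: "\<And>s b c. s \<in> U \<Longrightarrow> b \<in> link H s \<Longrightarrow> c \<in> link H s \<Longrightarrow> b \<noteq> c \<Longrightarrow> {b, c} \<in> edges H"
    and w: "w \<in> W" "link G w \<noteq> {}"
  shows "\<sigma> w \<in> U"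
proof (rule ccontr)
  let ?u = "\<sigma> w"
  assume uU: "?u \<notin> U"
  obtain s where s: "s \<in> U" "M s w = 1" using W_meets_U[OF w(1)] .
  note V = link_subset[OF source.mixed_graph, of w] link_subset[OF target.mixed_graph]
  have wV: "w \<in> verts G" using w(1) source.W_verts by blast
  note u = \<sigma>_verts[OF wV] M_\<sigma>[OF wV]
  note fin = finite_link[OF source.mixed_graph] finite_link[OF target.mixed_graph]
  have sup: "v \<in> link H s" if "a \<in> link G w" "v \<in> verts H" "M v a = 1" for a v
    using link_W_support[OF w(1) s that] .
  show False
  proof (cases "?u \<in> link H s")
    case True
    have "card (link H s) \<le> card (link H ?u)"
      using clique_link_card[of s ?u] clique[OF s(1)] True card_mono[OF fin(2), of _ ?u] by metis
    then have le: "card (link H s) \<le> card (link G w)" using card_link_\<sigma>[OF wV] by simp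
    have sub: "\<sigma> ` link G w \<subseteq> link H s"
      using sup \<sigma>_verts M_\<sigma> V(1) by blast
    have inj: "inj_on \<sigma> (verts G)" using bij by (simp add: bij_betw_def)
    have "card (\<sigma> ` link G w) = card (link G w)"
      by (rule card_image[OF inj_on_subset[OF inj V(1)]])
    then have "card (link H s) \<le> card (\<sigma> ` link G w)" using le by simp
    from card_seteq[OF fin(2) sub this] True have "?u \<in> \<sigma> ` link G w" by simp
    then obtain a where a: "a \<in> link G w" "?u = \<sigma> a" by blast
    have "a \<in> verts G" using a(1) V(1) by blast
    from inj_onD[OF inj a(2) wV this] have "w \<in> link G w" using a(1) by simp
    then show False using link_irrefl[OF source.mixed_graph] by blast
  next
    case False
    have sup': "v \<in> link H ?u" if "a \<in> link G w" "v \<in> verts H" "M v a = 1" for a v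
      using link_W_support'[OF w(1) s u False that] .
    have "link H ?u \<subseteq> link H s"
    proof
      fix b assume b: "b \<in> link H ?u"
      have "\<exists>a\<in>link G w. M b a = 1"
        by (rule support_rank_surj[OF V card_link_\<sigma>[OF wV, symmetric] _ b]) (rule sup')
      then obtain a where "a \<in> link G w" "M b a = 1" by blast
      then show "b \<in> link H s" using sup b V(2) by blast
    qed
    moreover have "?u \<noteq> s" using uU s(1) by blast
    ultimately show False
      using no_satellite[OF s(1) u(1)] False link_\<sigma>_empty[OF wV] w(2) by simp
  qed
qed

end

section \<open>The transversal is an isomorphism of mixed graphs\<close>

locale sorted_transfer = matched_transfer +
  assumes \<sigma>_W: "w \<in> W \<Longrightarrow> link G w \<noteq> {} \<Longrightarrow> \<sigma> w \<in> U"
begin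

lemma \<sigma>_edge_W:
  assumes "w \<in> W" "{a, w} \<in> edges G"
  shows "{\<sigma> a, \<sigma> w} \<in> edges H"
proof -
  have a: "a \<in> link G w" using assms(2) by (simp add: link_def)
  then have "\<sigma> w \<in> U" using \<sigma>_W[OF assms(1)] by blast
  moreover have "w \<in> verts G" "a \<in> verts G" using source.edgeD[OF assms(2)] by simp_all
  ultimately have "\<sigma> a \<in> link H (\<sigma> w)"
    using link_W_support[OF assms(1) _ _ a] M_\<sigma> \<sigma>_verts by simp
  then show ?thesis by (simp add: link_def)
qed

text \<open>If the images were not adjacent they would be twins, and modulo the vertices strictly
  dominating them the columns of the two ends would coincide, although \<open>M\<close> is invertible.\<close>

lemma \<sigma>_edge_not_W:
  assumes e: "{a, c} \<in> edges G" and W: "a \<notin> W" "c \<notin> W"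
  shows "{\<sigma> a, \<sigma> c} \<in> edges H"
proof (rule ccontr)
  assume n: "{\<sigma> a, \<sigma> c} \<notin> edges H"
  define u v where "u = \<sigma> a" and "v = \<sigma> c"
  note ac = source.edgeD[OF e]
  have inj: "inj_on \<sigma> (verts G)" and im: "\<sigma> ` verts G = verts H"
    using bij by (simp_all add: bij_betw_def)
  have uv: "u \<in> verts H" "v \<in> verts H" "u \<noteq> v"
    unfolding u_def v_def using \<sigma>_verts ac inj by (auto dest: inj_onD)
  note und = source.edge_not_W[OF e W]
  have Mu: "M u a = 1" "M v c = 1" unfolding u_def v_def using M_\<sigma> ac by simp_all
  have n': "{u, v} \<notin> edges H" using n unfolding u_def v_def .
  have "M u a * M v c = M u c * M v a" by (rule undirected_nonedge[OF uv n' und])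
  then have Muv: "M u c = 1" "M v a = 1" using Mu by auto
  have uv_link: "u \<notin> link H v" "v \<notin> link H u" using n' link_sym[of v H u] by (auto simp: link_def)
  have "link H u \<subseteq> star H v" "link H v \<subseteq> star H u"
    unfolding u_def v_def using link_\<sigma>_star ac W uv Muv unfolding u_def v_def by simp_all
  then have luv: "link H u = link H v" using uv_link by (auto simp: star_def)
  have "c \<in> link G a" "a \<in> link G c" using e by (simp_all add: link_def insert_commute)
  then have ne: "link G a \<noteq> {}" "link G c \<noteq> {}" by blast+
  then have neu: "link H u \<noteq> {}" unfolding u_def using link_\<sigma>_empty ac by simp
  \<comment> \<open>\<open>P\<close> consists of the vertices outside \<open>U\<close> that dominate
    \<open>u\<close>, and \<open>Q\<close> of those that dominate it strictly.\<close>
  define P where "P = {s \<in> verts H. s \<notin> U \<and> link H u \<subseteq> star H s}"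
  define Q where "Q = {s \<in> P. \<not> link H s \<subseteq> star H u}"
  \<comment> \<open>A vertex in the support of column \<open>b\<close> dominates
    \<open>\<sigma> b\<close>, so columns over \<open>P\<close> stay in \<open>P\<close>. The
    neighbour \<open>p\<close> of \<open>u\<close> shows that \<open>b\<close> is not isolated, as
    \<open>support_not_U\<close> requires.\<close>
  have supp: "t \<in> P \<and> link H (\<sigma> b) \<subseteq> star H t"
    if b: "b \<in> verts G" "\<sigma> b \<in> P" "t \<in> verts H" "M t b = 1" for b t
  proof -
    obtain p where p: "p \<in> link H u" using neu by blast
    have "link H (\<sigma> b) \<noteq> {}"
    proof (cases "p = \<sigma> b")
      case True
      then have "u \<in> link H (\<sigma> b)" using p by (simp add: link_sym)
      then show ?thesis by blast
    next
      case False
      then show ?thesis using p b(2) by (auto simp: P_def star_def)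
    qed
    then have nb: "link G b \<noteq> {}" using link_\<sigma>_empty b(1) by simp
    have bW: "b \<notin> W" using \<sigma>_W[OF _ nb] b(2) by (auto simp: P_def)
    have l: "link H (\<sigma> b) \<subseteq> star H t" by (rule link_\<sigma>_star[OF b(1) bW b(3,4)])
    moreover have "t \<notin> U" by (rule support_not_U[OF b(1) bW nb b(4)])
    moreover have "link H u \<subseteq> star H t"
      using link_star_trans[OF _ l] b(2) by (auto simp: P_def)
    ultimately show ?thesis using b(3) by (simp add: P_def)
  qed
  have uP: "u \<in> P" "v \<in> P"
    using support_not_U[OF ac(1) W(1) ne(1)] Mu(1) Muv(2) uv luv
    by (auto simp: P_def star_def)
  define A where "A = {b \<in> verts G. \<sigma> b \<in> Q}"
  have AV: "A \<subseteq> verts G" and QV: "Q \<subseteq> verts H" by (auto simp: A_def Q_def P_def)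
  have "\<sigma> ` A = Q" using im QV by (auto simp: A_def)
  then have cardA: "card A = card Q" using card_image[OF inj_on_subset[OF inj AV]] by simp
  have suppA: "t \<in> Q" if b: "b \<in> A" and t: "t \<in> verts H" "M t b = 1" for b t
  proof -
    have bQ: "\<sigma> b \<in> P" "\<not> link H (\<sigma> b) \<subseteq> star H u" "b \<in> verts G"
      using b by (simp_all add: A_def Q_def)
    from supp[OF bQ(3,1) t] have "t \<in> P" "link H (\<sigma> b) \<subseteq> star H t" by simp_all
    then show ?thesis using bQ(2) link_star_trans[of H "\<sigma> b" t u] by (auto simp: Q_def)
  qed
  \<comment> \<open>The columns over \<open>Q\<close> form a square block that is onto, so on
    \<open>Q\<close> they combine to the sum of columns \<open>a\<close> and
    \<open>c\<close>.\<close>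
  have "\<exists>x. \<forall>t\<in>Q. (\<Sum>b\<in>A. M t b * x b) = M t a + M t c"
    by (rule support_rank(2)[OF AV QV _ cardA]) (rule suppA)
  then obtain x where x: "\<forall>t\<in>Q. (\<Sum>b\<in>A. M t b * x b) = M t a + M t c" by blast
  \<comment> \<open>A vertex of \<open>P\<close> outside \<open>Q\<close> is \<open>u\<close> or a
    twin of \<open>u\<close> not adjacent to it, where the minor condition applies; outside
    \<open>P\<close> both entries are 0.\<close>
  have off: "M t a = M t c" if t: "t \<in> verts H" "t \<notin> Q" for t
  proof (cases "t \<in> P")
    case True
    then have tu: "link H t \<subseteq> star H u" using t(2) by (auto simp: Q_def)
    show ?thesis
    proof (cases "t = u")
      case False
      have "t \<notin> link H u"
      proof
        assume "t \<in> link H u"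
        then have "v \<in> link H t" using luv link_sym[of v H t] by simp
        then show False using tu uv(3) uv_link by (auto simp: star_def)
      qed
      then have "{u, t} \<notin> edges H" by (simp add: link_def insert_commute)
      from undirected_nonedge[OF uv(1) t(1) _ this und] show ?thesis
        using False Mu Muv by simp
    qed (use Mu Muv in simp)
  next
    case False
    have "M t a \<noteq> 1" using supp[of a t] ac(1) uP(1) t(1) False unfolding u_def by blast
    moreover have "M t c \<noteq> 1" using supp[of c t] ac(2) uP(2) t(1) False unfolding v_def by blast
    ultimately show ?thesis by simp
  qed
  have "u \<notin> Q" "v \<notin> Q" using luv by (auto simp: Q_def star_def)
  then have acA: "a \<notin> A" "c \<notin> A" unfolding A_def u_def v_def by auto
  \<comment> \<open>With coefficient 1 at \<open>a\<close> and \<open>c\<close> this becomes a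
    nontrivial dependency of columns.\<close>
  define x' where "x' = x(a := 1, c := 1)"
  have "\<forall>b\<in>insert a (insert c A). x' b = 0"
  proof (rule ker_subset)
    show "insert a (insert c A) \<subseteq> verts G" using ac AV by simp
    fix t assume t: "t \<in> verts H"
    have "(\<Sum>b\<in>A. M t b * x' b) = (\<Sum>b\<in>A. M t b * x b)"
      using acA by (intro sum.cong) (auto simp: x'_def)
    also have "\<dots> = M t a + M t c"
    proof (cases "t \<in> Q")
      case False
      then have "M t b = 0" if "b \<in> A" for b
        using suppA[OF that t] False bit_not_one_iff by blast
      then show ?thesis using off[OF t False] by simp
    qed (use x in blast)
    finally have "(\<Sum>b\<in>A. M t b * x' b) = M t a + M t c" .
    moreover have "finite A" using finite_subset[OF AV] by simp
    moreover have "x' a = 1" "x' c = 1" using ac(3) by (simp_all add: x'_def)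
    ultimately show "(\<Sum>b\<in>insert a (insert c A). M t b * x' b) = 0"
      using acA ac(3) by (simp add: add.assoc[symmetric])
  qed
  then have "x' a = 0" by blast
  then show False using ac(3) by (simp add: x'_def)
qed

lemma \<sigma>_edge:
  assumes "{a, c} \<in> edges G"
  shows "{\<sigma> a, \<sigma> c} \<in> edges H"
proof -
  have "{c, a} \<in> edges G" "{\<sigma> c, \<sigma> a} = {\<sigma> a, \<sigma> c}" using assms by (simp_all add: insert_commute)
  then show ?thesis using \<sigma>_edge_W[of c a] \<sigma>_edge_W[of a c] \<sigma>_edge_not_W[OF assms] assms by metis
qed

lemma link_\<sigma>:
  assumes "a \<in> verts G"
  shows "link H (\<sigma> a) = \<sigma> ` link G a"
proof -
  have "\<sigma> ` link G a \<subseteq> link H (\<sigma> a)" using \<sigma>_edge by (auto simp: link_def)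
  moreover have "card (\<sigma> ` link G a) = card (link G a)"
    using bij link_subset[OF source.mixed_graph, of a]
    by (intro card_image) (auto simp: bij_betw_def intro: inj_on_subset)
  ultimately show ?thesis
    using card_link_\<sigma>[OF assms] card_seteq[OF finite_link[OF target.mixed_graph]] by (metis order_refl)
qed

lemma \<sigma>_edge_iff:
  assumes "a \<in> verts G" "c \<in> verts G"
  shows "{a, c} \<in> edges G \<longleftrightarrow> {\<sigma> a, \<sigma> c} \<in> edges H"
proof
  assume "{\<sigma> a, \<sigma> c} \<in> edges H"
  then have "\<sigma> a \<in> \<sigma> ` link G c" unfolding link_\<sigma>[OF assms(2), symmetric] by (simp add: link_def)
  then obtain b where "b \<in> link G c" "\<sigma> a = \<sigma> b" by blast
  moreover from this have "b \<in> verts G" using link_subset[OF source.mixed_graph] by blast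
  ultimately have "a \<in> link G c"
    using bij assms(1) unfolding bij_betw_def by (metis inj_onD)
  then show "{a, c} \<in> edges G" by (simp add: link_def)
qed (rule \<sigma>_edge)

lemma \<sigma>_W_iff:
  assumes "a \<in> verts G" "link G a \<noteq> {}"
  shows "\<sigma> a \<in> U \<longleftrightarrow> a \<in> W"
  using support_not_U[OF assms(1) _ assms(2) M_\<sigma>[OF assms(1)]] \<sigma>_W[OF _ assms(2)] by blast

text \<open>The direction of an edge is determined by which of its ends lies in \<open>W\<close> or
  \<open>U\<close>, so it suffices that \<open>\<sigma>\<close> respects edges and, off isolated
  vertices, these sets.\<close>

lemma \<sigma>_isomorphism: "mixed_graph_isomorphism \<sigma> G H"
proof -
  have dir: "directed_edge H (\<sigma> x) (\<sigma> y)" if "directed_edge G x y" for x y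
  proof -
    have e: "{x, y} \<in> edges G" by (rule directed_edgeD[OF source.mixed_graph that])
    then have "y \<in> verts G" "link G y \<noteq> {}" using source.edgeD[OF e] by (auto simp: link_def)
    then have "\<sigma> y \<in> U" using \<sigma>_W_iff source.directed[OF that] by blast
    then show ?thesis using target.edge_W \<sigma>_edge[OF e] by blast
  qed
  have und: "undirected_edge H (\<sigma> x) (\<sigma> y)" if "undirected_edge G x y" for x y
  proof -
    have e: "{x, y} \<in> edges G" by (rule undirected_edgeD[OF that])
    have "undirected_edge G y x" using that by (simp add: undirected_edge_def insert_commute)
    then have W: "x \<notin> W" "y \<notin> W" using that source.undirected by blast+
    have "x \<in> verts G" "y \<in> verts G" "link G y \<noteq> {}" "link G x \<noteq> {}"
      using source.edgeD[OF e] e link_sym[of x G y] by (auto simp: link_def)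
    then have "\<sigma> x \<notin> U" "\<sigma> y \<notin> U" using \<sigma>_W_iff W by blast+
    then show ?thesis using target.edge_not_W \<sigma>_edge[OF e] by blast
  qed
  have dedge: "directed_edge G x y \<Longrightarrow> {x, y} \<in> dedges G" for x y by (simp add: directed_edge_def)
  show ?thesis
    unfolding mixed_graph_isomorphism_def
  proof (intro conjI ballI)
    show "bij_betw \<sigma> (verts G) (verts H)" by (rule bij)
  next
    fix x y assume "x \<in> verts G" "y \<in> verts G"
    then show "{x, y} \<in> edges G \<longleftrightarrow> {\<sigma> x, \<sigma> y} \<in> edges H" by (rule \<sigma>_edge_iff)
  next
    fix x y assume xy: "x \<in> verts G" "y \<in> verts G"
    show "{x, y} \<in> dedges G \<longleftrightarrow> {\<sigma> x, \<sigma> y} \<in> dedges H"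
    proof
      assume d: "{x, y} \<in> dedges G"
      then have e: "{x, y} \<in> edges G" using source.mixed_graph by (auto simp: mixed_graph_def)
      with d have "directed_edge G x y \<or> directed_edge G y x"
        using mixed_graph_edge_cases[OF source.mixed_graph e] by (auto simp: undirected_edge_def)
      then have "directed_edge H (\<sigma> x) (\<sigma> y) \<or> directed_edge H (\<sigma> y) (\<sigma> x)" using dir by blast
      then show "{\<sigma> x, \<sigma> y} \<in> dedges H" by (auto simp: directed_edge_def insert_commute)
    next
      assume d: "{\<sigma> x, \<sigma> y} \<in> dedges H"
      then have "{\<sigma> x, \<sigma> y} \<in> edges H" using target.mixed_graph by (auto simp: mixed_graph_def)
      then have e: "{x, y} \<in> edges G" using \<sigma>_edge_iff[OF xy] by simp
      show "{x, y} \<in> dedges G"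
      proof (rule ccontr)
        assume "\<not> ?thesis"
        then have "undirected_edge G x y" using e by (simp add: undirected_edge_def)
        from und[OF this] d show False by (simp add: undirected_edge_def)
      qed
    qed
  next
    fix e assume e: "e \<in> dedges G"
    have "\<forall>e\<in>dedges G. e = {origin G e, terminus G e}"
      using source.mixed_graph by (simp add: mixed_graph_def)
    from bspec[OF this e] have eq: "{origin G e, terminus G e} = e" by (rule HOL.sym)
    have "directed_edge G (origin G e) (terminus G e)"
      unfolding directed_edge_def eq using e by simp
    from dir[OF this] have d: "origin H {\<sigma> (origin G e), \<sigma> (terminus G e)} = \<sigma> (origin G e)"
      "terminus H {\<sigma> (origin G e), \<sigma> (terminus G e)} = \<sigma> (terminus G e)"
      by (simp_all add: directed_edge_def)
    have "\<sigma> ` e = \<sigma> ` {origin G e, terminus G e}" by (simp only: eq)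
    then have "\<sigma> ` e = {\<sigma> (origin G e), \<sigma> (terminus G e)}" by simp
    with d show "origin H (\<sigma> ` e) = \<sigma> (origin G e)" "terminus H (\<sigma> ` e) = \<sigma> (terminus G e)"
      by simp_all
  qed
qed

end

section \<open>Homomorphisms from T-RAAGs to Heisenberg groups\<close>

definition bil :: "'v set \<Rightarrow> ('v \<Rightarrow> 'v \<Rightarrow> bit) \<Rightarrow> ('v \<Rightarrow> bit) \<Rightarrow> ('v \<Rightarrow> bit) \<Rightarrow> bit" where
  "bil S b x y = (\<Sum>u\<in>S. \<Sum>v\<in>S. b u v * (x u * y v))"

lemma bil_add:
  "bil S b (\<lambda>v. x v + x' v) y = bil S b x y + bil S b x' y"
  "bil S b x (\<lambda>v. y v + y' v) = bil S b x y + bil S b x y'"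
  by (simp_all add: bil_def distrib_left distrib_right sum.distrib)

lemma bil_zero: "bil S b (\<lambda>_. 0) y = 0" "bil S b x (\<lambda>_. 0) = 0"
  by (simp_all add: bil_def)

lemma bil_unit:
  assumes "finite S" "a \<in> S" "c \<in> S"
  shows "bil S b (\<lambda>v. of_bool (v = a)) (\<lambda>v. of_bool (v = c)) = b a c"
proof -
  have "bil S b (\<lambda>v. of_bool (v = a)) (\<lambda>v. of_bool (v = c)) =
      (\<Sum>u\<in>S. of_bool (u = a) * (\<Sum>v\<in>S. b u v * of_bool (v = c)))"
    unfolding bil_def sum_distrib_left by (simp only: mult_ac)
  then show ?thesis using assms by (simp add: sum_delta_bit)
qed

text \<open>The central extension of the additive group of functions \<open>'v => bit\<close> by the
  two-element group, with the bilinear form \<open>b\<close> on \<open>S\<close> as cocycle. Taking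
  all functions as carrier removes closure conditions.\<close>

definition heis :: "'v set \<Rightarrow> ('v \<Rightarrow> 'v \<Rightarrow> bit) \<Rightarrow> (('v \<Rightarrow> bit) \<times> bit) monoid" where
  "heis S b =
     \<lparr>carrier = UNIV,
      mult = (\<lambda>(x, s) (y, t). (\<lambda>v. x v + y v, s + t + bil S b x y)),
      one = (\<lambda>_. 0, 0)\<rparr>"

lemma heis_simps [simp]:
  "carrier (heis S b) = UNIV"
  "(x, s) \<otimes>\<^bsub>heis S b\<^esub> (y, t) = (\<lambda>v. x v + y v, s + t + bil S b x y)"
  "\<one>\<^bsub>heis S b\<^esub> = (\<lambda>_. 0, 0)"
  by (simp_all add: heis_def)

lemma group_heis: "group (heis S b)"
proof (rule groupI)
  fix X Y Z :: "('a \<Rightarrow> bit) \<times> bit"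
  obtain x s y t z r where XYZ: "X = (x, s)" "Y = (y, t)" "Z = (z, r)"
    by (cases X; cases Y; cases Z)
  show "X \<otimes>\<^bsub>heis S b\<^esub> Y \<otimes>\<^bsub>heis S b\<^esub> Z = X \<otimes>\<^bsub>heis S b\<^esub> (Y \<otimes>\<^bsub>heis S b\<^esub> Z)"
    unfolding XYZ heis_simps bil_add by (simp only: add_ac)
  show "\<one>\<^bsub>heis S b\<^esub> \<otimes>\<^bsub>heis S b\<^esub> X = X"
    by (simp add: XYZ bil_zero)
  have "(x, s + bil S b x x) \<otimes>\<^bsub>heis S b\<^esub> X = \<one>\<^bsub>heis S b\<^esub>"
    by (simp add: XYZ)
  then show "\<exists>Y\<in>carrier (heis S b). Y \<otimes>\<^bsub>heis S b\<^esub> X = \<one>\<^bsub>heis S b\<^esub>" by auto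
qed simp_all

text \<open>Signs of letters are ignored because a generator and its inverse have the same image mod
  2.\<close>

primrec expo :: "'v word \<Rightarrow> 'v \<Rightarrow> bit" where
  "expo [] = (\<lambda>_. 0)"
| "expo (l # w) = (\<lambda>v. of_bool (v = fst l) + expo w v)"

lemma expo_append: "expo (u @ w) v = expo u v + expo w v"
  by (induction u) (simp_all only: expo.simps append.simps add_0 add.assoc)

lemma fst_inv_heis: "fst (inv\<^bsub>heis S b\<^esub> X) = fst X"
proof -
  interpret group "heis S b" by (rule group_heis)
  obtain x s where X: "X = (x, s)" by (cases X)
  obtain y t where Y: "inv\<^bsub>heis S b\<^esub> X = (y, t)" by (cases "inv\<^bsub>heis S b\<^esub> X")
  have "inv\<^bsub>heis S b\<^esub> X \<otimes>\<^bsub>heis S b\<^esub> X = \<one>\<^bsub>heis S b\<^esub>" by (rule l_inv) simp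
  from this[unfolded Y, unfolded X]
  have "(y, t) \<otimes>\<^bsub>heis S b\<^esub> (x, s) = \<one>\<^bsub>heis S b\<^esub>" .
  then show ?thesis unfolding Y unfolding X by (simp add: fun_eq_iff)
qed

lemma fst_mult_heis: "fst (X \<otimes>\<^bsub>heis S b\<^esub> Y) = (\<lambda>v. fst X v + fst Y v)"
  by (cases X; cases Y) simp

lemma fst_word_eval_heis: "fst (word_eval (heis S b) (\<lambda>u. (\<lambda>v. of_bool (v = u), 0)) w) = expo w"
proof (induction w)
  case (Cons l w)
  show ?case using Cons unfolding word_eval_def
    by (cases l) (simp add: fst_mult_heis fst_inv_heis)
qed (simp add: word_eval_def)

section \<open>Word classes and the mod 2 abelianization of a T-RAAG\<close>

definition cls :: "'v mixed_graph \<Rightarrow> 'v word \<Rightarrow> 'v word set" where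
  "cls G w = pres_rel (verts G) (TRAAG_relations G) `` {w}"

definition gen :: "'v mixed_graph \<Rightarrow> 'v \<Rightarrow> 'v word set" where
  "gen G a = cls G [(a, True)]"

lemma cls_carrier: "w \<in> words (verts G) \<Longrightarrow> cls G w \<in> carrier (TRAAG G)"
  unfolding cls_def TRAAG_def by (rule presented_group_carrierI)

lemma cls_mult:
  "u \<in> words (verts G) \<Longrightarrow> w \<in> words (verts G) \<Longrightarrow> cls G u \<otimes>\<^bsub>TRAAG G\<^esub> cls G w = cls G (u @ w)"
  unfolding cls_def TRAAG_def by (rule presented_group_mult)

lemma cls_one: "\<one>\<^bsub>TRAAG G\<^esub> = cls G []"
  unfolding cls_def TRAAG_def by (rule presented_group_one)

lemma cls_eq:
  "u \<in> words (verts G) \<Longrightarrow> w \<in> words (verts G) \<Longrightarrow>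
    cls G u = cls G w \<longleftrightarrow> pres_eq (verts G) (TRAAG_relations G) u w"
  unfolding cls_def by (rule pres_class_eq)

lemma carrier_cls:
  assumes "A \<in> carrier (TRAAG G)"
  obtains w where "w \<in> words (verts G)" "A = cls G w"
  using presented_group_carrierE[OF assms[unfolded TRAAG_def]] unfolding cls_def by metis

lemma gen_carrier: "a \<in> verts G \<Longrightarrow> gen G a \<in> carrier (TRAAG G)"
  unfolding gen_def by (rule cls_carrier) simp

lemma group_TRAAG: "group (TRAAG G)"
  unfolding TRAAG_def by (rule group_presented_group)

lemma gen_undirected:
  assumes "mixed_graph G" "undirected_edge G a c"
  shows "gen G a \<otimes>\<^bsub>TRAAG G\<^esub> gen G c = gen G c \<otimes>\<^bsub>TRAAG G\<^esub> gen G a"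
proof -
  have V: "a \<in> verts G" "c \<in> verts G"
    using mixed_graph_edgeD[OF assms(1) undirected_edgeD[OF assms(2)]] by simp_all
  have "([(a, True), (c, True)], [(c, True), (a, True)]) \<in> TRAAG_relations G"
    using assms(2) by (auto simp: TRAAG_relations_def)
  then have "pres_eq (verts G) (TRAAG_relations G) [(a, True), (c, True)] [(c, True), (a, True)]"
    by (rule pres_eq.rel) (use V in simp_all)
  then show ?thesis using V by (simp add: gen_def cls_mult cls_eq)
qed

lemma gen_directed:
  assumes "mixed_graph G" "directed_edge G a c"
  shows "gen G a \<otimes>\<^bsub>TRAAG G\<^esub> (gen G c \<otimes>\<^bsub>TRAAG G\<^esub> gen G a) = gen G c"
proof -
  have V: "a \<in> verts G" "c \<in> verts G"
    using mixed_graph_edgeD[OF assms(1) directed_edgeD[OF assms]] by simp_all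
  have "([(a, True), (c, True), (a, True)], [(c, True)]) \<in> TRAAG_relations G"
    using assms(2) by (auto simp: TRAAG_relations_def)
  then have "pres_eq (verts G) (TRAAG_relations G) [(a, True), (c, True), (a, True)] [(c, True)]"
    by (rule pres_eq.rel) (use V in simp_all)
  then show ?thesis using V by (simp add: gen_def cls_mult cls_eq)
qed

lemma TRAAG_universal:
  assumes "mixed_graph G" "group K" "f \<in> verts G \<rightarrow> carrier K"
    and und: "\<And>a c. undirected_edge G a c \<Longrightarrow> f a \<otimes>\<^bsub>K\<^esub> f c = f c \<otimes>\<^bsub>K\<^esub> f a"
    and dir: "\<And>a c. directed_edge G a c \<Longrightarrow> f a \<otimes>\<^bsub>K\<^esub> (f c \<otimes>\<^bsub>K\<^esub> f a) = f c"
  shows "\<exists>h\<in>hom (TRAAG G) K. \<forall>w\<in>words (verts G). h (cls G w) = word_eval K f w"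
  unfolding TRAAG_def cls_def
proof (rule presented_group_universal[OF assms(2,3)])
  interpret group K by fact
  fix l r assume lr: "(l, r) \<in> TRAAG_relations G" "l \<in> words (verts G)" "r \<in> words (verts G)"
  then consider
      a c where "l = [(a, True), (c, True)]" "r = [(c, True), (a, True)]" "undirected_edge G a c"
    | a c where "l = [(a, True), (c, True), (a, True)]" "r = [(c, True)]" "directed_edge G a c"
    unfolding TRAAG_relations_def by blast
  then show "word_eval K f l = word_eval K f r"
  proof cases
    case 1
    then have "f a \<in> carrier K" "f c \<in> carrier K" using lr(2) assms(3) by auto
    then show ?thesis using und[OF 1(3)] 1 by (simp add: word_eval_def)
  next
    case 2
    then have "f a \<in> carrier K" "f c \<in> carrier K" using lr(2) assms(3) by auto
    then show ?thesis using dir[OF 2(3)] 2 by (simp add: word_eval_def)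
  qed
qed

text \<open>In a b a = b the letter a occurs an even number of times on each side, so exponents mod
  2 survive both kinds of relations.\<close>

lemma expo_pres_eq:
  "pres_eq V (TRAAG_relations G) u w \<Longrightarrow> expo u = expo w"
proof (induction rule: pres_eq.induct)
  case (app u u' v v')
  then show ?case by (simp add: fun_eq_iff expo_append)
next
  case (rel l r)
  then show ?case
    by (auto simp: TRAAG_relations_def fun_eq_iff add_ac)
qed (simp_all add: fun_eq_iff)

definition ab :: "'v word set \<Rightarrow> 'v \<Rightarrow> bit" where
  "ab A = expo (SOME w. w \<in> A)"

lemma ab_cls:
  assumes "w \<in> words (verts G)"
  shows "ab (cls G w) = expo w"
proof -
  have "w \<in> cls G w" using assms by (auto simp: cls_def pres_rel_def intro: pres_eq.refl)
  then have "(SOME v. v \<in> cls G w) \<in> cls G w" by (rule someI)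
  then have "pres_eq (verts G) (TRAAG_relations G) w (SOME v. v \<in> cls G w)"
    by (simp add: cls_def pres_rel_def)
  then show ?thesis unfolding ab_def using expo_pres_eq by metis
qed

lemma ab_mult:
  assumes "A \<in> carrier (TRAAG G)" "B \<in> carrier (TRAAG G)"
  shows "ab (A \<otimes>\<^bsub>TRAAG G\<^esub> B) v = ab A v + ab B v"
proof -
  obtain u where u: "u \<in> words (verts G)" "A = cls G u" using assms(1) by (rule carrier_cls)
  obtain w where w: "w \<in> words (verts G)" "B = cls G w" using assms(2) by (rule carrier_cls)
  have "u @ w \<in> words (verts G)" using u(1) w(1) by simp
  then show ?thesis
    unfolding u(2) w(2) by (simp only: cls_mult[OF u(1) w(1)] ab_cls u(1) w(1) expo_append)
qed

lemma additive_expo: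
  assumes "finite (verts G)"
    and q: "\<And>A B. A \<in> carrier (TRAAG G) \<Longrightarrow> B \<in> carrier (TRAAG G) \<Longrightarrow>
      q (A \<otimes>\<^bsub>TRAAG G\<^esub> B) = q A + (q B :: bit)"
    and "w \<in> words (verts G)"
  shows "q (cls G w) = (\<Sum>a\<in>verts G. expo w a * q (gen G a))"
  using assms(3)
proof (induction w)
  interpret group "TRAAG G" by (rule group_TRAAG)
  case Nil
  have "q \<one>\<^bsub>TRAAG G\<^esub> = 0" using q[OF one_closed one_closed] by simp
  then show ?case by (simp add: cls_one)
next
  interpret group "TRAAG G" by (rule group_TRAAG)
  case (Cons l w)
  obtain x b where l: "l = (x, b)" by (cases l)
  have x: "x \<in> verts G" and w: "w \<in> words (verts G)" using Cons.hyps l by auto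
  have "q \<one>\<^bsub>TRAAG G\<^esub> = 0" using q[OF one_closed one_closed] by simp
  then have one: "q (cls G []) = 0" by (simp add: cls_one)
  have "q (cls G [(x, b)]) = q (gen G x)"
  proof (cases b)
    case False
    have "pres_eq (verts G) (TRAAG_relations G) [(x, True), (x, \<not> True)] []"
      by (rule pres_eq.cancel[OF x])
    then have "cls G ([(x, True)] @ [(x, False)]) = cls G []" using x by (simp add: cls_eq)
    then have "q (gen G x \<otimes>\<^bsub>TRAAG G\<^esub> cls G [(x, False)]) = 0"
      using x one by (simp add: gen_def cls_mult)
    then show ?thesis using q[of "gen G x" "cls G [(x, False)]"] x False
      by (simp add: gen_carrier cls_carrier)
  qed (simp add: gen_def)
  moreover have "q (cls G ([(x, b)] @ w)) = q (cls G [(x, b)]) + q (cls G w)"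
    using q[of "cls G [(x, b)]" "cls G w"] x w cls_mult[of "[(x, b)]" G w]
    by (simp add: cls_carrier del: in_lists_conv_set)
  ultimately have "q (cls G (l # w)) = q (gen G x) + (\<Sum>a\<in>verts G. expo w a * q (gen G a))"
    using Cons.IH l by simp
  also have "\<dots> = (\<Sum>a\<in>verts G. expo (l # w) a * q (gen G a))"
    using x assms(1) by (simp add: l distrib_right sum.distrib sum_delta_bit)
  finally show ?case .
qed

section \<open>Pulling forms back along homomorphisms of T-RAAGs\<close>

lemma heis_hom:
  assumes G: "mixed_graph G" and "form G b"
  shows "\<exists>h\<in>hom (TRAAG G) (heis (verts G) b). \<forall>A\<in>carrier (TRAAG G). fst (h A) = ab A"
proof -
  let ?K = "heis (verts G) b" and ?f = "\<lambda>u. (\<lambda>v. of_bool (v = u), 0 :: bit)"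
  have fin: "finite (verts G)" using G by (simp add: mixed_graph_def)
  have "\<exists>h\<in>hom (TRAAG G) ?K. \<forall>w\<in>words (verts G). h (cls G w) = word_eval ?K ?f w"
  proof (rule TRAAG_universal[OF G group_heis])
    fix a c assume e: "undirected_edge G a c"
    then have "b a c = b c a" using assms(2) unfolding form_def by blast
    moreover have "a \<in> verts G" "c \<in> verts G"
      using mixed_graph_edgeD[OF G undirected_edgeD[OF e]] by simp_all
    ultimately show "?f a \<otimes>\<^bsub>?K\<^esub> ?f c = ?f c \<otimes>\<^bsub>?K\<^esub> ?f a"
      using fin by (simp add: bil_unit add.commute)
  next
    fix a c assume e: "directed_edge G a c"
    then have "b a c + b c a + b a a = 0" using assms(2) unfolding form_def by blast
    moreover have "a \<in> verts G" "c \<in> verts G"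
      using mixed_graph_edgeD[OF G directed_edgeD[OF G e]] by simp_all
    ultimately show "?f a \<otimes>\<^bsub>?K\<^esub> (?f c \<otimes>\<^bsub>?K\<^esub> ?f a) = ?f c"
      using fin by (simp add: bil_add bil_unit add_ac)
  qed simp
  then obtain h where h: "h \<in> hom (TRAAG G) ?K"
    "\<And>w. w \<in> words (verts G) \<Longrightarrow> h (cls G w) = word_eval ?K ?f w" by blast
  have "fst (h A) = ab A" if A: "A \<in> carrier (TRAAG G)" for A
  proof -
    obtain w where "w \<in> words (verts G)" "A = cls G w" using A by (rule carrier_cls)
    then show ?thesis using h(2) fst_word_eval_heis ab_cls by metis
  qed
  with h(1) show ?thesis by blast
qed

text \<open>Composing \<open>f\<close> with the Heisenberg homomorphism of \<open>b\<close> sends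
  each generator of \<open>G\<close> to a pair whose first coordinate is its column. The relations
  of \<open>G\<close> hold for these pairs, and in their second coordinates the unknown central
  parts cancel, leaving the conditions for the pulled back form.\<close>

lemma form_pull_hom:
  assumes G: "mixed_graph G" and H: "mixed_graph H" and f: "f \<in> hom (TRAAG G) (TRAAG H)"
    and b: "form H b"
  shows "form G (pull (verts H) (\<lambda>u a. ab (f (gen G a)) u) b)"
proof -
  let ?K = "heis (verts H) b"
  obtain h where h: "h \<in> hom (TRAAG H) ?K" "\<And>A. A \<in> carrier (TRAAG H) \<Longrightarrow> fst (h A) = ab A"
    using heis_hom[OF H b] by blast
  define k where "k A = h (f A)" for A
  have k: "k \<in> hom (TRAAG G) ?K"
    using hom_compose[OF f h(1)] by (simp add: comp_def k_def[abs_def])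
  have kg: "k (gen G a) = (ab (f (gen G a)), snd (k (gen G a)))" if "a \<in> verts G" for a
    using h(2)[OF hom_in_carrier[OF f gen_carrier[OF that]]] unfolding k_def by (metis prod.collapse)
  have pull: "pull (verts H) (\<lambda>u a. ab (f (gen G a)) u) b a c =
      bil (verts H) b (ab (f (gen G a))) (ab (f (gen G c)))" for a c
    by (simp add: pull_def bil_def)
  note km = hom_mult[OF k]
  show ?thesis
    unfolding form_def pull
  proof (intro conjI allI impI)
    fix a c assume e: "undirected_edge G a c"
    have V: "a \<in> verts G" "c \<in> verts G"
      using mixed_graph_edgeD[OF G undirected_edgeD[OF e]] by simp_all
    then have "k (gen G a) \<otimes>\<^bsub>?K\<^esub> k (gen G c) = k (gen G c) \<otimes>\<^bsub>?K\<^esub> k (gen G a)"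
      using arg_cong[OF gen_undirected[OF G e], of k] by (simp only: km gen_carrier)
    then show "bil (verts H) b (ab (f (gen G a))) (ab (f (gen G c))) =
        bil (verts H) b (ab (f (gen G c))) (ab (f (gen G a)))"
      by (subst (asm) (1 2) kg[OF V(1)], subst (asm) (1 2) kg[OF V(2)])
        (simp add: add.commute[of "snd (k (gen G a))"])
  next
    fix a c assume e: "directed_edge G a c"
    define x y s t where xy: "x = ab (f (gen G a))" "y = ab (f (gen G c))"
      "s = snd (k (gen G a))" "t = snd (k (gen G c))"
    have V: "a \<in> verts G" "c \<in> verts G"
      using mixed_graph_edgeD[OF G directed_edgeD[OF G e]] by simp_all
    interpret TG: group "TRAAG G" by (rule group_TRAAG)
    have "k (gen G a) \<otimes>\<^bsub>?K\<^esub> (k (gen G c) \<otimes>\<^bsub>?K\<^esub> k (gen G a)) = k (gen G c)"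
      using arg_cong[OF gen_directed[OF G e], of k] V
      by (simp only: km gen_carrier TG.m_closed)
    then have "(x, s) \<otimes>\<^bsub>?K\<^esub> ((y, t) \<otimes>\<^bsub>?K\<^esub> (x, s)) = (y, t)"
      using kg[OF V(1)] kg[OF V(2)] unfolding xy by simp
    then have "s + (t + s + bil (verts H) b y x) + (bil (verts H) b x y + bil (verts H) b x x) = t"
      by (simp add: bil_add)
    then show "bil (verts H) b (ab (f (gen G a))) (ab (f (gen G c))) +
        bil (verts H) b (ab (f (gen G c))) (ab (f (gen G a))) +
        bil (verts H) b (ab (f (gen G a))) (ab (f (gen G a))) = 0"
      unfolding xy[symmetric]
      by (cases s; cases t; cases "bil (verts H) b x y"; cases "bil (verts H) b y x";
          cases "bil (verts H) b x x"; simp)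
  qed
qed

text \<open>Functoriality of mod 2 homology: \<open>additive_expo\<close> evaluates
  \<open>ab\<close> after \<open>g\<close> on \<open>f (gen G c)\<close> as a product of
  matrices.\<close>

lemma hom_left_inverse:
  assumes G: "mixed_graph G" and H: "mixed_graph H"
    and f: "f \<in> hom (TRAAG G) (TRAAG H)" and g: "g \<in> hom (TRAAG H) (TRAAG G)"
    and gf: "g (f (gen G c)) = gen G c" and c: "c \<in> verts G"
  shows "(\<Sum>u\<in>verts H. ab (g (gen H u)) a * ab (f (gen G c)) u) = of_bool (a = c)"
proof -
  have fin: "finite (verts H)" using H by (simp add: mixed_graph_def)
  obtain w where w: "w \<in> words (verts H)" "f (gen G c) = cls H w"
    using hom_in_carrier[OF f gen_carrier[OF c]] by (rule carrier_cls)
  have "ab (g (cls H w)) a = (\<Sum>u\<in>verts H. expo w u * ab (g (gen H u)) a)"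
  proof (rule additive_expo[OF fin _ w(1)])
    fix A B assume "A \<in> carrier (TRAAG H)" "B \<in> carrier (TRAAG H)"
    then show "ab (g (A \<otimes>\<^bsub>TRAAG H\<^esub> B)) a = ab (g A) a + ab (g B) a"
      using hom_mult[OF g] ab_mult hom_in_carrier[OF g] by metis
  qed
  moreover have "ab (g (cls H w)) a = of_bool (a = c)"
    using gf c unfolding w(2) by (simp add: gen_def ab_cls)
  ultimately show ?thesis unfolding w(2) ab_cls[OF w(1)] by (simp add: mult.commute)
qed

lemma TRAAG_iso_matrices:
  assumes G: "mixed_graph G" and H: "mixed_graph H" and iso: "TRAAG G \<cong> TRAAG H"
  obtains M N where
    "\<And>a c. a \<in> verts G \<Longrightarrow> c \<in> verts G \<Longrightarrow> (\<Sum>u\<in>verts H. N a u * M u c) = of_bool (a = c)"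
    "\<And>u v. u \<in> verts H \<Longrightarrow> v \<in> verts H \<Longrightarrow> (\<Sum>a\<in>verts G. M u a * N a v) = of_bool (u = v)"
    "\<And>b. form H b \<Longrightarrow> form G (pull (verts H) M b)"
    "\<And>b. form G b \<Longrightarrow> form H (pull (verts G) N b)"
proof -
  interpret TG: group "TRAAG G" by (rule group_TRAAG)
  obtain f where f: "f \<in> Group.iso (TRAAG G) (TRAAG H)" using iso by (auto simp: is_iso_def)
  define g where "g = inv_into (carrier (TRAAG G)) f"
  have g: "g \<in> Group.iso (TRAAG H) (TRAAG G)" unfolding g_def by (rule TG.iso_set_sym[OF f])
  have fh: "f \<in> hom (TRAAG G) (TRAAG H)" and gh: "g \<in> hom (TRAAG H) (TRAAG G)"
    and bij: "bij_betw f (carrier (TRAAG G)) (carrier (TRAAG H))"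
    using f g by (simp_all add: Group.iso_def)
  have gf: "g (f A) = A" if "A \<in> carrier (TRAAG G)" for A
    using bij that unfolding g_def bij_betw_def by (simp add: inv_into_f_f)
  have fg: "f (g B) = B" if "B \<in> carrier (TRAAG H)" for B
    using bij that unfolding g_def bij_betw_def by (simp add: f_inv_into_f)
  show thesis
  proof
    show "(\<Sum>u\<in>verts H. ab (g (gen H u)) a * ab (f (gen G c)) u) = of_bool (a = c)"
      if "c \<in> verts G" for a c
      by (rule hom_left_inverse[OF G H fh gh gf[OF gen_carrier[OF that]] that])
    show "(\<Sum>a\<in>verts G. ab (f (gen G a)) u * ab (g (gen H v)) a) = of_bool (u = v)"
      if "v \<in> verts H" for u v
      by (rule hom_left_inverse[OF H G gh fh fg[OF gen_carrier[OF that]] that])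
    show "form G (pull (verts H) (\<lambda>u a. ab (f (gen G a)) u) b)" if "form H b" for b
      by (rule form_pull_hom[OF G H fh that])
    show "form H (pull (verts G) (\<lambda>a u. ab (g (gen H u)) a) b)" if "form G b" for b
      by (rule form_pull_hom[OF H G gh that])
  qed
qed

section \<open>From isomorphic groups to a transfer\<close>

context twisted_graph
begin

text \<open>In mod 2 cohomology this says that the square of y is y times the indicator class of
  \<open>W\<close>. On an undirected edge the indicator vanishes at both ends; on a directed one it
  is 0 at the origin and 1 at the terminus.\<close>

lemma form_chi: "form G (\<lambda>p q. y p * (y q + of_bool (q \<in> W)))"
  unfolding form_def
proof (intro conjI allI impI)
  fix a c assume e: "undirected_edge G a c"
  have "undirected_edge G c a" using e by (simp add: undirected_edge_def insert_commute)
  then show "y a * (y c + of_bool (c \<in> W)) = y c * (y a + of_bool (a \<in> W))"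
    using undirected e by (simp add: mult.commute)
next
  fix a c assume "directed_edge G a c"
  then have "a \<notin> W" "c \<in> W" using directed by blast+
  then show "y a * (y c + of_bool (c \<in> W)) + y c * (y a + of_bool (a \<in> W)) +
      y a * (y a + of_bool (a \<in> W)) = 0"
    by (cases "y a"; cases "y c"; simp)
qed

text \<open>\<open>U\<close> is where the functional of \<open>W\<close>, transported by
  \<open>M\<close>, takes the value 1. With row \<open>a\<close> of \<open>N\<close> as
  \<open>y\<close>, the form of \<open>form_chi\<close> pulls back to the product of the indicator
  of \<open>a\<close> with that indicator plus \<open>\<chi>\<close>. Taking \<open>a\<close> to be
  one end of an edge of \<open>H\<close> reads off \<open>\<chi>\<close> at the other end.\<close>

lemma transfer_of_iso:
  assumes H: "mixed_graph H" and iso: "TRAAG H \<cong> TRAAG G"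
  obtains U M N where "transfer H U G W M N"
proof -
  obtain M N where
    NM: "\<And>a c. a \<in> verts H \<Longrightarrow> c \<in> verts H \<Longrightarrow> (\<Sum>u\<in>verts G. N a u * M u c) = of_bool (a = c)"
    and MN: "\<And>u v. u \<in> verts G \<Longrightarrow> v \<in> verts G \<Longrightarrow> (\<Sum>a\<in>verts H. M u a * N a v) = of_bool (u = v)"
    and pM: "\<And>b. form G b \<Longrightarrow> form H (pull (verts G) M b)"
    and pN: "\<And>b. form H b \<Longrightarrow> form G (pull (verts H) N b)"
    by (rule TRAAG_iso_matrices[OF H mixed_graph iso]) (rule that, assumption+)
  define \<chi> where "\<chi> a = (\<Sum>w\<in>W. M w a)" for a
  define U where "U = {a \<in> verts H. \<chi> a = 1}"
  have finH: "finite (verts H)" using H by (simp add: mixed_graph_def)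
  have chi: "(\<Sum>v\<in>verts G. of_bool (v \<in> W) * M v q) = \<chi> q" for q
  proof -
    have "(\<Sum>v\<in>verts G. of_bool (v \<in> W) * M v q) = (\<Sum>v\<in>W. of_bool (v \<in> W) * M v q)"
      by (rule sum.mono_neutral_right) (use W_verts in auto)
    then show ?thesis by (simp add: \<chi>_def)
  qed
  have F: "form H (pull (verts G) M (\<lambda>u v. N a u * (N a v + of_bool (v \<in> W))))" for a
    by (rule pM[OF form_chi])
  have val: "pull (verts G) M (\<lambda>u v. N a u * (N a v + of_bool (v \<in> W))) p q =
      of_bool (a = p) * (of_bool (a = q) + \<chi> q)"
    if "a \<in> verts H" "p \<in> verts H" "q \<in> verts H" for a p q
    using NM that chi by (simp add: pull_rank_one distrib_right sum.distrib)
  have Us: "a \<in> U \<longleftrightarrow> \<chi> a = 1" if "a \<in> verts H" for a using that by (simp add: U_def)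
  interpret H: twisted_graph H U
  proof
    show "mixed_graph H" by (rule H)
    show "U \<subseteq> verts H" by (auto simp: U_def)
  next
    fix x y assume e: "undirected_edge H x y"
    note V = mixed_graph_edgeD[OF H undirected_edgeD[OF e]]
    have "pull (verts G) M (\<lambda>u v. N y u * (N y v + of_bool (v \<in> W))) x y =
        pull (verts G) M (\<lambda>u v. N y u * (N y v + of_bool (v \<in> W))) y x"
      using F[of y] e unfolding form_def by blast
    then have "\<chi> x = 0" using val V by simp
    then show "x \<notin> U" by (simp add: U_def)
  next
    fix x y assume e: "directed_edge H x y"
    note V = mixed_graph_edgeD[OF H directed_edgeD[OF H e]]
    have eq: "pull (verts G) M (\<lambda>u v. N a u * (N a v + of_bool (v \<in> W))) x y +
        pull (verts G) M (\<lambda>u v. N a u * (N a v + of_bool (v \<in> W))) y x +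
        pull (verts G) M (\<lambda>u v. N a u * (N a v + of_bool (v \<in> W))) x x = 0" for a
      using F[of a] e unfolding form_def by blast
    have x0: "\<chi> x = 0" using eq[of y] val[of y] V by simp
    moreover have "\<chi> y = 1" using eq[of x] val[of x] V x0 by (cases "\<chi> y") simp_all
    ultimately show "x \<notin> U \<and> y \<in> U" using Us V by simp
  qed
  have "transfer H U G W M N"
  proof unfold_locales
    show "(\<Sum>w\<in>W. M w a) = of_bool (a \<in> U)" if "a \<in> verts H" for a
      using Us[OF that] by (cases "\<chi> a") (simp_all add: \<chi>_def)
    show "(\<Sum>w\<in>U. N w u) = of_bool (u \<in> W)" if u: "u \<in> verts G" for u
    proof -
      have "(\<Sum>w\<in>U. N w u) = (\<Sum>a\<in>U. \<chi> a * N a u)" by (simp add: U_def)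
      also have "\<dots> = (\<Sum>a\<in>verts H. \<chi> a * N a u)"
        using finH by (intro sum.mono_neutral_left) (auto simp: U_def)
      also have "\<dots> = (\<Sum>w\<in>W. \<Sum>a\<in>verts H. M w a * N a u)"
        unfolding \<chi>_def sum_distrib_right by (rule sum.swap)
      also have "\<dots> = (\<Sum>w\<in>W. of_bool (w = u))"
        using MN u W_verts by (intro sum.cong) auto
      also have "\<dots> = of_bool (u \<in> W)"
        using sum_delta_bit(1)[of W u "\<lambda>_. 1"] by simp
      finally show ?thesis .
    qed
  qed (fact NM MN pM pN)+
  then show thesis by (rule that)
qed

end

section \<open>Graph isomorphisms from comparing degree sums\<close>

context transfer
begin

lemma card_link_le:
  assumes "bij_betw \<sigma> (verts G) (verts H)" "\<And>a. a \<in> verts G \<Longrightarrow> M (\<sigma> a) a = 1"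
    and "\<And>w. w \<in> W \<Longrightarrow> card (link G w) \<le> card (link H (\<sigma> w))"
    and "a \<in> verts G"
  shows "card (link G a) \<le> card (link H (\<sigma> a))"
proof (cases "a \<in> W")
  case False
  have "\<sigma> a \<in> verts H" using assms(1,4) by (auto simp: bij_betw_def)
  from card_star_le[OF assms(4) False this assms(2)[OF assms(4)]] show ?thesis
    by (simp add: card_star source.mixed_graph target.mixed_graph)
qed (rule assms(3))

lemma sum_card_link_le:
  assumes "bij_betw \<sigma> (verts G) (verts H)" "\<And>a. a \<in> verts G \<Longrightarrow> M (\<sigma> a) a = 1"
    and "\<And>w. w \<in> W \<Longrightarrow> card (link G w) \<le> card (link H (\<sigma> w))"
  shows "(\<Sum>a\<in>verts G. card (link G a)) \<le> (\<Sum>u\<in>verts H. card (link H u))"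
proof -
  have "(\<Sum>a\<in>verts G. card (link G a)) \<le> (\<Sum>a\<in>verts G. card (link H (\<sigma> a)))"
    by (intro sum_mono card_link_le[OF assms])
  also have "\<dots> = (\<Sum>u\<in>verts H. card (link H u))"
    by (rule sum.reindex_bij_betw[OF assms(1)])
  finally show ?thesis .
qed

text \<open>No degree drops along \<open>\<sigma>\<close>, so a single strict increase would make
  the degree sum of \<open>H\<close> exceed that of \<open>G\<close>.\<close>

lemma card_link_eq:
  assumes "bij_betw \<sigma> (verts G) (verts H)" "\<And>a. a \<in> verts G \<Longrightarrow> M (\<sigma> a) a = 1"
    and "\<And>w. w \<in> W \<Longrightarrow> card (link G w) \<le> card (link H (\<sigma> w))"
    and sum: "(\<Sum>u\<in>verts H. card (link H u)) \<le> (\<Sum>a\<in>verts G. card (link G a))"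
    and a: "a \<in> verts G"
  shows "card (link H (\<sigma> a)) = card (link G a)"
proof (rule ccontr)
  assume "\<not> ?thesis"
  then have "card (link G a) < card (link H (\<sigma> a))" using card_link_le[OF assms(1-3) a] by simp
  then have "(\<Sum>a\<in>verts G. card (link G a)) < (\<Sum>a\<in>verts G. card (link H (\<sigma> a)))"
    using a card_link_le[OF assms(1-3)] by (intro sum_strict_mono_ex1) auto
  also have "\<dots> = (\<Sum>u\<in>verts H. card (link H u))"
    by (rule sum.reindex_bij_betw[OF assms(1)])
  finally show False using sum by simp
qed

lemma isomorphism_of_cliques:
  assumes clique: "\<And>s b c. s \<in> U \<Longrightarrow> b \<in> link H s \<Longrightarrow> c \<in> link H s \<Longrightarrow> b \<noteq> c \<Longrightarrow> {b, c} \<in> edges H"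
    and no_sat: "\<And>w v. w \<in> U \<Longrightarrow> v \<in> verts H \<Longrightarrow> v \<noteq> w \<Longrightarrow> v \<notin> link H w \<Longrightarrow> link H v \<noteq> {} \<Longrightarrow>
      \<not> link H v \<subseteq> link H w"
  shows "\<exists>\<sigma>. mixed_graph_isomorphism \<sigma> G H"
proof -
  interpret flip: transfer H U G W N M by (rule flip)
  obtain \<sigma> where s: "bij_betw \<sigma> (verts G) (verts H)" "\<And>a. a \<in> verts G \<Longrightarrow> M (\<sigma> a) a = 1"
    by (rule transversal) blast
  obtain \<tau> where t: "bij_betw \<tau> (verts H) (verts G)" "\<And>a. a \<in> verts H \<Longrightarrow> N (\<tau> a) a = 1"
    by (rule flip.transversal) blast
  have sW: "card (link G w) \<le> card (link H (\<sigma> w))" if "w \<in> W" for w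
  proof (rule card_link_W_le[OF _ that])
    have "w \<in> verts G" using that source.W_verts by blast
    then show "\<sigma> w \<in> verts H" "M (\<sigma> w) w = 1" using s by (auto simp: bij_betw_def)
  qed (rule clique)
  have tU: "card (link H w) \<le> card (link G (\<tau> w))" if "w \<in> U" for w
  proof (rule flip.card_link_W_le[OF _ that])
    have "w \<in> verts H" using that target.W_verts by blast
    then show "\<tau> w \<in> verts G" "N (\<tau> w) w = 1" using t by (auto simp: bij_betw_def)
    \<comment> \<open>The comparison for \<open>N\<close> needs cliques in \<open>G\<close>, which
      \<open>clique_transfer\<close> carries over from \<open>H\<close>.\<close>
    show "{b, c} \<in> edges G" if "s \<in> W" "b \<in> link G s" "c \<in> link G s" "b \<noteq> c" for s b c
      by (rule clique_transfer[OF _ that]) (rule clique)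
  qed
  interpret matched_transfer G W H U M N \<sigma>
  proof
    show "card (link H (\<sigma> a)) = card (link G a)" if "a \<in> verts G" for a
      by (rule card_link_eq[OF s sW flip.sum_card_link_le[OF t tU] that])
  qed (use s no_sat in blast)+
  interpret sorted_transfer G W H U M N \<sigma>
  proof
    show "\<sigma> w \<in> U" if "w \<in> W" "link G w \<noteq> {}" for w
      by (rule \<sigma>_W_of_clique[OF _ that]) (rule clique)
  qed
  show ?thesis using \<sigma>_isomorphism by blast
qed

section \<open>Cones with a twisted apex\<close>

lemma transversal_cone:
  assumes "W = {q}" "U = {p}" "bij_betw \<sigma> (verts G) (verts H)" "\<And>a. a \<in> verts G \<Longrightarrow> M (\<sigma> a) a = 1"
  shows "\<sigma> q = p"
proof -
  have "p \<in> verts H" using target.W_verts assms(2) by simp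
  then have "p \<in> \<sigma> ` verts G" using assms(3) by (simp add: bij_betw_def)
  then obtain a where a: "a \<in> verts G" "\<sigma> a = p" by blast
  \<comment> \<open>Row \<open>p\<close> of \<open>M\<close> is the indicator of \<open>q\<close> by
    \<open>sum_U_M\<close>, so this entry forces \<open>a = q\<close>.\<close>
  then have "M p a = 1" using assms(4) by blast
  then have "a = q" using sum_U_M[OF a(1)] assms(1,2) by simp
  with a show ?thesis by simp
qed

text \<open>The functionals whose square is a form vanish off the apex, and they determine the vertices
  of \<open>G\<close> that are not origins of directed edges.\<close>

lemma cone_source:
  assumes U: "U = {p}" and p: "\<And>v. v \<in> verts H \<Longrightarrow> v \<noteq> p \<Longrightarrow> {v, p} \<in> edges H"
  shows "\<exists>q. W = {q} \<and> (\<forall>v\<in>verts G. v \<noteq> q \<longrightarrow> {v, q} \<in> edges G)"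
proof -
  interpret flip: transfer H U G W N M by (rule flip)
  have pV: "p \<in> verts H" using target.W_verts U by simp
  \<comment> \<open>The square of the functional at \<open>v\<close> pulls back to the square of row
    \<open>v\<close> of \<open>N\<close>. Each edge pointing to \<open>p\<close> kills the entry at
    its origin, and \<open>NM\<close> prevents the row from vanishing altogether.\<close>
  have row: "N v a = of_bool (a = p)"
    if v: "v \<in> verts G" "form G (\<lambda>x y. of_bool (x = v \<and> y = v))" and a: "a \<in> verts H" for v a
  proof -
    have "form H (\<lambda>x y. N v x * N v y)"
      using pull_N[OF v(2)] v(1) by (simp add: pull_unit)
    moreover have "directed_edge H x p" if "x \<in> verts H" "x \<noteq> p" for x
      using target.edge_W[OF p[OF that]] U by simp
    ultimately have *: "N v x = 0" if "x \<in> verts H" "x \<noteq> p" for x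
      using that unfolding form_def by (fastforce simp: mult.commute[of "N v p"])
    have "(\<Sum>u\<in>verts H. N v u * M u v) = 1" using NM v(1) by simp
    moreover have "(\<Sum>u\<in>verts H. N v u * M u v) = N v p * M p v"
      using sum.remove[of "verts H" p "\<lambda>u. N v u * M u v"] pV * by simp
    ultimately have "N v p = 1" by simp
    with * a show ?thesis by (cases "a = p") simp_all
  qed
  have unique: "v = v'"
    if "v \<in> verts G" "form G (\<lambda>x y. of_bool (x = v \<and> y = v))"
      and "v' \<in> verts G" "form G (\<lambda>x y. of_bool (x = v' \<and> y = v'))" for v v'
  proof -
    have "(\<Sum>u\<in>verts H. N v u * M u v) = (\<Sum>u\<in>verts H. N v' u * M u v)"
      using row[OF that(1,2)] row[OF that(3,4)] by (intro sum.cong) simp_all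
    then show ?thesis using NM[of v v] NM[of v' v] that(1,3) by (cases "v = v'") simp_all
  qed
  obtain q where q: "q \<in> W" using flip.W_meets_U[of p] U by blast
  have qV: "q \<in> verts G" using q source.W_verts by blast
  have W: "W = {q}"
  proof -
    have "w = q" if "w \<in> W" for w
      using unique[of w q] source.form_W[OF that] source.form_W[OF q] that qV source.W_verts by blast
    then show ?thesis using q by blast
  qed
  moreover have "{v, q} \<in> edges G" if v: "v \<in> verts G" "v \<noteq> q" for v
  proof (rule ccontr)
    assume n: "{v, q} \<notin> edges G"
    \<comment> \<open>All directed edges end at \<open>q\<close>, so a vertex not joined to
      \<open>q\<close> is not an origin, and its square is a form like that of
      \<open>q\<close>.\<close>
    have "form G (\<lambda>x y. of_bool (x = v \<and> y = v))"
      unfolding form_def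
    proof (intro conjI allI impI)
      fix x y assume "undirected_edge G x y"
      show "of_bool (x = v \<and> y = v) = (of_bool (y = v \<and> x = v) :: bit)" by (simp add: conj_commute)
    next
      fix x y assume d: "directed_edge G x y"
      then have "y = q" using source.directed W by blast
      then have "x \<noteq> v" using directed_edgeD[OF source.mixed_graph d] n by blast
      then show "of_bool (x = v \<and> y = v) + of_bool (y = v \<and> x = v) +
          (of_bool (x = v \<and> x = v) :: bit) = 0" by simp
    qed
    then show False using unique[OF v(1) _ qV source.form_W[OF q]] v(2) by blast
  qed
  ultimately show ?thesis by blast
qed

lemma link_cone:
  assumes "mixed_graph K" "p \<in> verts K" "\<And>v. v \<in> verts K \<Longrightarrow> v \<noteq> p \<Longrightarrow> {v, p} \<in> edges K"
  shows "link K p = verts K - {p}"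
  using assms link_irrefl[OF assms(1)] link_subset[OF assms(1)] by (auto simp: link_def)

text \<open>The apexes replace the clique hypothesis: \<open>\<sigma>\<close> and
  \<open>\<tau>\<close> exchange them, and both are joined to all other vertices, so the degree
  comparison on \<open>W\<close> and \<open>U\<close> is immediate. An apex has no satellites since
  its link omits no other vertex.\<close>

lemma isomorphism_of_cone:
  assumes U: "U = {p}" and p: "\<And>v. v \<in> verts H \<Longrightarrow> v \<noteq> p \<Longrightarrow> {v, p} \<in> edges H"
  shows "\<exists>\<sigma>. mixed_graph_isomorphism \<sigma> G H"
proof -
  interpret flip: transfer H U G W N M by (rule flip)
  obtain q where W: "W = {q}" and q: "\<And>v. v \<in> verts G \<Longrightarrow> v \<noteq> q \<Longrightarrow> {v, q} \<in> edges G"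
    using cone_source[OF assms] by blast
  have V: "p \<in> verts H" "q \<in> verts G" using target.W_verts source.W_verts U W by simp_all
  obtain \<sigma> where s: "bij_betw \<sigma> (verts G) (verts H)" "\<And>a. a \<in> verts G \<Longrightarrow> M (\<sigma> a) a = 1"
    by (rule transversal) blast
  obtain \<tau> where t: "bij_betw \<tau> (verts H) (verts G)" "\<And>a. a \<in> verts H \<Longrightarrow> N (\<tau> a) a = 1"
    by (rule flip.transversal) blast
  have sq: "\<sigma> q = p" by (rule transversal_cone[OF W U s])
  have tp: "\<tau> p = q" by (rule flip.transversal_cone[OF U W t])
  have lp: "link H p = verts H - {p}" by (rule link_cone[OF target.mixed_graph V(1) p])
  have lq: "link G q = verts G - {q}" by (rule link_cone[OF source.mixed_graph V(2) q])
  have "card (verts G) = card (verts H)" by (rule bij_betw_same_card[OF s(1)])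
  then have c: "card (link G q) = card (link H p)" using lp lq V by simp
  have sW: "card (link G w) \<le> card (link H (\<sigma> w))" if "w \<in> W" for w
    using that c W sq by simp
  have tU: "card (link H w) \<le> card (link G (\<tau> w))" if "w \<in> U" for w
    using that c U tp by simp
  interpret matched_transfer G W H U M N \<sigma>
  proof
    show "card (link H (\<sigma> a)) = card (link G a)" if "a \<in> verts G" for a
      by (rule card_link_eq[OF s sW flip.sum_card_link_le[OF t tU] that])
    show "\<not> link H v \<subseteq> link H w" if "w \<in> U" "v \<in> verts H" "v \<noteq> w" "v \<notin> link H w" for v w
      using that lp U by simp
  qed (use s in blast)+
  interpret sorted_transfer G W H U M N \<sigma>
    by unfold_locales (use sq W U in simp)
  show ?thesis using \<sigma>_isomorphism by blast
qed

end

section \<open>Special graphs\<close>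

lemma special_twisted_graph:
  assumes "mixed_graph G" "special G"
  shows "twisted_graph G {x \<in> verts G. sinkhole G x}"
proof
  show "mixed_graph G" by fact
  show "{x \<in> verts G. sinkhole G x} \<subseteq> verts G" by blast
next
  fix x y assume u: "undirected_edge G x y"
  have "\<not> sinkhole G x"
  proof
    assume "sinkhole G x"
    then have "directed_edge G y x"
      using assms(2) undirected_edgeD[OF u] unfolding special_def sinkhole_def by blast
    then show False using u by (simp add: directed_edge_def undirected_edge_def insert_commute)
  qed
  then show "x \<notin> {x \<in> verts G. sinkhole G x}" by simp
next
  fix x y assume d: "directed_edge G x y"
  note e = directed_edgeD[OF assms(1) d]
  have "sinkhole G y" using d by (auto simp: sinkhole_def negative_def)
  moreover have "\<not> sinkhole G x"
  proof
    assume "sinkhole G x"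
    then have "directed_edge G y x" using assms(2) e unfolding special_def sinkhole_def by blast
    then have "x = y" using d unfolding directed_edge_def by (metis insert_commute)
    then show False using mixed_graph_edgeD(3)[OF assms(1) e] by blast
  qed
  ultimately show "x \<notin> {x \<in> verts G. sinkhole G x} \<and> y \<in> {x \<in> verts G. sinkhole G x}"
    using mixed_graph_edgeD[OF assms(1) e] by simp
qed

lemma sinkhole_verts: "mixed_graph G \<Longrightarrow> sinkhole G w \<Longrightarrow> w \<in> verts G"
  using directed_edgeD mixed_graph_edgeD(2) by (fastforce simp: sinkhole_def negative_def)

lemma satellite_iff:
  assumes "mixed_graph G"
  shows "satellite G w v \<longleftrightarrow>
    v \<in> verts G \<and> v \<noteq> w \<and> v \<notin> link G w \<and> link G v \<noteq> {} \<and> link G v \<subseteq> link G w"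
proof -
  have *: "u \<in> verts G" if "{u, v} \<in> edges G" for u
    using mixed_graph_edgeD(1)[OF assms that] .
  then show ?thesis unfolding satellite_def joined_def link_def by blast
qed

text \<open>The isomorphism starts from \<open>H\<close> because the assumptions on cliques,
  satellites and apexes in the results on \<open>transfer\<close> concern the target graph.\<close>

lemma rigidI:
  assumes G: "mixed_graph G"
    and iso: "\<And>H :: nat mixed_graph. mixed_graph H \<Longrightarrow> TRAAG H \<cong> TRAAG G \<Longrightarrow>
      \<exists>\<sigma>. mixed_graph_isomorphism \<sigma> H G"
  shows "rigid G"
  unfolding rigid_def
proof (intro allI impI)
  fix H :: "nat mixed_graph" assume H: "mixed_graph H" "TRAAG G \<cong> TRAAG H"
  have "TRAAG H \<cong> TRAAG G" by (rule group.iso_sym[OF group_TRAAG H(2)])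
  then obtain \<sigma> where "mixed_graph_isomorphism \<sigma> H G" using iso H(1) by blast
  then show "mixed_graphs_isomorphic G H"
    using mixed_graph_isomorphism_inv[OF H(1) G] unfolding mixed_graphs_isomorphic_def by blast
qed

text \<open>In a special graph both edges point to \<open>w\<close>, so two neighbours of
  \<open>w\<close> that are not joined would span a copy of \<open>two_arrows\<close>.\<close>

lemma droms_clique:
  assumes G: "mixed_graph G" and d: "droms G" and w: "sinkhole G w"
    and ac: "a \<in> link G w" "c \<in> link G w" "a \<noteq> c"
  shows "{a, c} \<in> edges G"
proof (rule ccontr)
  assume n: "{a, c} \<notin> edges G"
  have sp: "special G" using d by (simp add: droms_def)
  have e: "{a, w} \<in> edges G" "{c, w} \<in> edges G" using ac by (simp_all add: link_def)
  have wa: "{w, a} = {a, w}" "{w, c} = {c, w}" "{c, a} = {a, c}" by (rule insert_commute)+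
  then have "{w, a} \<in> edges G" "{w, c} \<in> edges G" using e by simp_all
  then have de: "directed_edge G a w" "directed_edge G c w"
    using sp w unfolding special_def sinkhole_def by blast+
  note V = mixed_graph_edgeD[OF G e(1)] mixed_graph_edgeD[OF G e(2)]
  define f where "f = (\<lambda>n::nat. if n = 0 then a else if n = 1 then w else c)"
  have f: "f 0 = a" "f (Suc 0) = w" "f 2 = c" by (simp_all add: f_def)
  have loop: "{x} \<notin> edges G" for x using mixed_graph_edgeD(3)[OF G, of x x] by auto
  have dloop: "{x} \<notin> dedges G" for x using loop G by (auto simp: mixed_graph_def)
  have nd: "{a, c} \<notin> dedges G" "{c, a} \<notin> dedges G" "{c, a} \<notin> edges G"
    using n G unfolding wa by (auto simp: mixed_graph_def)
  have dd: "{a, w} \<in> dedges G" "{c, w} \<in> dedges G" "{w, a} \<in> dedges G" "{w, c} \<in> dedges G"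
    "{w, a} \<in> edges G" "{w, c} \<in> edges G"
    using de e unfolding wa by (simp_all add: directed_edge_def)
  have two: "{x, y} \<in> {{0, 1}, {2, 1 :: nat}} \<longleftrightarrow> {f x, f y} \<in> S"
    if xy: "x \<in> {0, 1, 2}" "y \<in> {0, 1, 2}"
      and S: "\<And>x. {x} \<notin> S" "{a, c} \<notin> S" "{c, a} \<notin> S"
        "{a, w} \<in> S" "{c, w} \<in> S" "{w, a} \<in> S" "{w, c} \<in> S" for x y S
    using xy by (elim insertE emptyE; hypsubst; simp add: f S doubleton_eq_iff)
  have "mixed_graph_isomorphism f two_arrows (induced_subgraph G {a, w, c})"
    unfolding mixed_graph_isomorphism_def
  proof (intro conjI ballI)
    show "bij_betw f (verts two_arrows) (verts (induced_subgraph G {a, w, c}))"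
      using V ac(3) by (auto simp: bij_betw_def inj_on_def two_arrows_def induced_subgraph_def f)
  next
    fix x y assume "x \<in> verts two_arrows" "y \<in> verts two_arrows"
    then have xy: "x \<in> {0, 1, 2}" "y \<in> {0, 1, 2}" by (simp_all add: two_arrows_def)
    show "{x, y} \<in> edges two_arrows \<longleftrightarrow> {f x, f y} \<in> edges (induced_subgraph G {a, w, c})"
      unfolding two_arrows_def induced_subgraph_def mixed_graph.simps
      by (rule two[OF xy]) (simp_all add: loop n nd dd e)
    show "{x, y} \<in> dedges two_arrows \<longleftrightarrow> {f x, f y} \<in> dedges (induced_subgraph G {a, w, c})"
      unfolding two_arrows_def induced_subgraph_def mixed_graph.simps
      by (rule two[OF xy]) (simp_all add: dloop nd dd)
  next
    fix e assume "e \<in> dedges two_arrows"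
    then have "e = {0, 1} \<or> e = {2, 1}" by (simp add: two_arrows_def)
    moreover have "{2, 1} \<noteq> {0, 1 :: nat}" by (simp add: doubleton_eq_iff)
    ultimately show "origin (induced_subgraph G {a, w, c}) (f ` e) = f (origin two_arrows e)"
      "terminus (induced_subgraph G {a, w, c}) (f ` e) = f (terminus two_arrows e)"
      using de by (elim disjE; hypsubst; simp add: two_arrows_def induced_subgraph_def f directed_edge_def)+
  qed
  moreover have "{a, w, c} \<subseteq> verts G" using V by simp
  ultimately have "contains_induced G two_arrows"
    unfolding contains_induced_def mixed_graphs_isomorphic_def by blast
  then show False using d by (simp add: droms_def)
qed

lemma droms_rigid:
  assumes G: "mixed_graph G" and d: "droms G" and no_sat: "\<not> has_satellites G"
  shows "rigid G"
proof (rule rigidI[OF G])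
  fix H :: "nat mixed_graph" assume H: "mixed_graph H" "TRAAG H \<cong> TRAAG G"
  let ?W = "{x \<in> verts G. sinkhole G x}"
  interpret twisted_graph G ?W
    by (rule special_twisted_graph[OF G]) (use d in \<open>simp add: droms_def\<close>)
  obtain U M N where "transfer H U G ?W M N" using transfer_of_iso[OF H] .
  then interpret transfer H U G ?W M N .
  show "\<exists>\<sigma>. mixed_graph_isomorphism \<sigma> H G"
  proof (rule isomorphism_of_cliques)
    show "{b, c} \<in> edges G" if "s \<in> ?W" "b \<in> link G s" "c \<in> link G s" "b \<noteq> c" for s b c
      using droms_clique[OF G d _ that(2-4)] that(1) by blast
    show "\<not> link G v \<subseteq> link G w"
      if "w \<in> ?W" "v \<in> verts G" "v \<noteq> w" "v \<notin> link G w" "link G v \<noteq> {}" for w v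
      using no_sat that satellite_iff[OF G] unfolding has_satellites_def by blast
  qed
qed

lemma cone_rigid:
  assumes G: "mixed_graph G" and sp: "special G" and p: "sinkhole G p"
    and cone: "\<And>v. v \<in> verts G \<Longrightarrow> v \<noteq> p \<Longrightarrow> {v, p} \<in> edges G"
  shows "rigid G"
proof (rule rigidI[OF G])
  fix H :: "nat mixed_graph" assume H: "mixed_graph H" "TRAAG H \<cong> TRAAG G"
  let ?W = "{x \<in> verts G. sinkhole G x}"
  interpret twisted_graph G ?W by (rule special_twisted_graph[OF G sp])
  have pW: "p \<in> ?W" using sinkhole_verts[OF G p] p by simp
  have W: "?W = {p}"
  proof -
    have "x = p" if "x \<in> ?W" for x
    proof (rule ccontr)
      assume "x \<noteq> p"
      then have "x \<in> link G p" using cone that by (simp add: link_def)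
      then show False using link_W[OF pW] that by blast
    qed
    then show ?thesis using pW by blast
  qed
  obtain U M N where "transfer H U G ?W M N" using transfer_of_iso[OF H] .
  then interpret transfer H U G ?W M N .
  show "\<exists>\<sigma>. mixed_graph_isomorphism \<sigma> H G" by (rule isomorphism_of_cone[OF W cone])
qed

section \<open>Flipping a satellite\<close>

lemma TRAAG_hom_eq:
  assumes "group K" "h \<in> hom (TRAAG G) K" "k \<in> hom (TRAAG G) K"
    and gens: "\<And>a. a \<in> verts G \<Longrightarrow> h (gen G a) = k (gen G a)"
    and "A \<in> carrier (TRAAG G)"
  shows "h A = k A"
proof -
  interpret T: group "TRAAG G" by (rule group_TRAAG)
  interpret K: group K by fact
  interpret h: group_hom "TRAAG G" K h by unfold_locales (rule assms(2))
  interpret k: group_hom "TRAAG G" K k by unfold_locales (rule assms(3))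
  have letter: "h (cls G [(x, b)]) = k (cls G [(x, b)])" if x: "x \<in> verts G" for x b
  proof (cases b)
    case True
    then show ?thesis using gens[OF x] by (simp add: gen_def)
  next
    case False
    have "pres_eq (verts G) (TRAAG_relations G) [(x, True), (x, \<not> True)] []"
      by (rule pres_eq.cancel[OF x])
    then have "cls G ([(x, True)] @ [(x, False)]) = cls G []" using x by (simp add: cls_eq)
    then have "gen G x \<otimes>\<^bsub>TRAAG G\<^esub> cls G [(x, False)] = \<one>\<^bsub>TRAAG G\<^esub>"
      using cls_mult[of "[(x, True)]" G "[(x, False)]"] x by (simp add: gen_def cls_one)
    moreover have c: "cls G [(x, False)] \<in> carrier (TRAAG G)" using x by (simp add: cls_carrier)
    ultimately have "inv\<^bsub>TRAAG G\<^esub> cls G [(x, False)] = gen G x"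
      by (intro T.inv_equality gen_carrier x)
    then have "cls G [(x, False)] = inv\<^bsub>TRAAG G\<^esub> gen G x" using T.inv_inv[OF c] by simp
    then show ?thesis using gens[OF x] gen_carrier[OF x] False by (simp add: h.hom_inv k.hom_inv)
  qed
  obtain w where w: "w \<in> words (verts G)" "A = cls G w" using assms(5) by (rule carrier_cls)
  have "h (cls G w) = k (cls G w)" using w(1)
  proof (induction w)
    case Nil
    then show ?case using h.hom_one k.hom_one by (simp add: cls_one)
  next
    case (Cons l w)
    obtain x b where l: "l = (x, b)" by (cases l)
    have x: "x \<in> verts G" and w: "w \<in> words (verts G)" using Cons.hyps l by auto
    have eq: "cls G (l # w) = cls G [(x, b)] \<otimes>\<^bsub>TRAAG G\<^esub> cls G w"
      using cls_mult[of "[(x, b)]" G w] x w l by simp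
    have c: "cls G [(x, b)] \<in> carrier (TRAAG G)" "cls G w \<in> carrier (TRAAG G)"
      using cls_carrier[of "[(x, b)]" G] cls_carrier[OF w] x by simp_all
    show ?case unfolding eq using c Cons.IH letter[OF x] by simp
  qed
  then show ?thesis using w(2) by simp
qed

lemma TRAAG_iso_of_inverse_homs:
  assumes h: "h \<in> hom (TRAAG G) (TRAAG H)" and k: "k \<in> hom (TRAAG H) (TRAAG G)"
    and kh: "\<And>a. a \<in> verts G \<Longrightarrow> k (h (gen G a)) = gen G a"
    and hk: "\<And>u. u \<in> verts H \<Longrightarrow> h (k (gen H u)) = gen H u"
  shows "TRAAG G \<cong> TRAAG H"
proof -
  have "k (h A) = A" if "A \<in> carrier (TRAAG G)" for A
    using TRAAG_hom_eq[OF group_TRAAG hom_compose[OF h k], of id A] kh that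
    by (simp add: hom_def)
  moreover have "h (k A) = A" if "A \<in> carrier (TRAAG H)" for A
    using TRAAG_hom_eq[OF group_TRAAG hom_compose[OF k h], of id A] hk that
    by (simp add: hom_def)
  ultimately have "bij_betw h (carrier (TRAAG G)) (carrier (TRAAG H))"
    using hom_in_carrier[OF h] hom_in_carrier[OF k] by (intro bij_betw_byWitness[of _ k]) auto
  then show ?thesis using h by (auto simp: is_iso_def Group.iso_def)
qed

lemma (in twisted_graph) dedges_eq: "dedges G = {e \<in> edges G. e \<inter> W \<noteq> {}}"
proof (intro equalityI subsetI)
  fix e assume e: "e \<in> dedges G"
  have "\<forall>e\<in>dedges G. e = {origin G e, terminus G e}"
    using mixed_graph by (simp add: mixed_graph_def)
  from bspec[OF this e] have eq: "{origin G e, terminus G e} = e" by (rule HOL.sym)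
  have "directed_edge G (origin G e) (terminus G e)"
    unfolding directed_edge_def eq using e by simp
  then have "terminus G e \<in> W" using directed by blast
  moreover have "terminus G e \<in> e" using eq by blast
  moreover have "e \<in> edges G" using e mixed_graph by (auto simp: mixed_graph_def)
  ultimately show "e \<in> {e \<in> edges G. e \<inter> W \<noteq> {}}" by blast
next
  fix e assume "e \<in> {e \<in> edges G. e \<inter> W \<noteq> {}}"
  then obtain w where e: "e \<in> edges G" "w \<in> e" "w \<in> W" by blast
  have "card e = 2" using e(1) mixed_graph by (simp add: mixed_graph_def)
  then obtain a c where "e = {a, c}" by (auto simp: card_2_iff)
  then obtain u where u: "e = {u, w}" using e(2) by blast
  then have "directed_edge G u w" using edge_W e(1,3) by simp
  then show "e \<in> dedges G" using u by (simp add: directed_edge_def)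
qed

text \<open>Applied to sets \<open>W\<close> without adjacent members: an edge that meets
  \<open>W\<close> then has exactly one end in it and one outside, so both definite descriptions are
  meaningful.\<close>

definition retwist :: "'v mixed_graph \<Rightarrow> 'v set \<Rightarrow> 'v mixed_graph" where
  "retwist G W =
     \<lparr>verts = verts G, edges = edges G, dedges = {e \<in> edges G. e \<inter> W \<noteq> {}},
      origin = (\<lambda>e. THE x. x \<in> e \<and> x \<notin> W), terminus = (\<lambda>e. THE x. x \<in> e \<and> x \<in> W)\<rparr>"

lemma twisted_graph_retwist:
  assumes G: "mixed_graph G" and W: "W \<subseteq> verts G"
    and indep: "\<And>x y. {x, y} \<in> edges G \<Longrightarrow> x \<in> W \<Longrightarrow> y \<notin> W"
  shows "twisted_graph (retwist G W) W"
proof -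
  have ot: "origin (retwist G W) {x, y} = x" "terminus (retwist G W) {x, y} = y"
    if "x \<notin> W" "y \<in> W" for x y
    using that by (auto simp: retwist_def intro!: the_equality)
  have cases: "\<exists>x y. e = {x, y} \<and> x \<notin> W \<and> y \<in> W" if e: "e \<in> edges G" "e \<inter> W \<noteq> {}" for e
  proof -
    have "card e = 2" using e(1) G by (simp add: mixed_graph_def)
    then obtain a c where ac: "e = {a, c}" by (auto simp: card_2_iff)
    then have "{a, c} \<in> edges G" "{c, a} \<in> edges G" using e(1) by (simp_all add: insert_commute)
    then have "a \<in> W \<Longrightarrow> c \<notin> W" "c \<in> W \<Longrightarrow> a \<notin> W" using indep by blast+
    then show ?thesis using e(2) ac by blast
  qed
  show ?thesis
  proof
    show "mixed_graph (retwist G W)"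
      unfolding mixed_graph_def
    proof (intro conjI)
      show "finite (verts (retwist G W))"
        "\<forall>e\<in>edges (retwist G W). e \<subseteq> verts (retwist G W) \<and> card e = 2"
        using G by (simp_all add: retwist_def mixed_graph_def)
      show "dedges (retwist G W) \<subseteq> edges (retwist G W)" by (auto simp: retwist_def)
      show "\<forall>e\<in>dedges (retwist G W). e = {origin (retwist G W) e, terminus (retwist G W) e}"
      proof
        fix e assume "e \<in> dedges (retwist G W)"
        then obtain x y where "e = {x, y}" "x \<notin> W" "y \<in> W"
          using cases[of e] by (auto simp: retwist_def)
        then show "e = {origin (retwist G W) e, terminus (retwist G W) e}" using ot by simp
      qed
    qed
    show "W \<subseteq> verts (retwist G W)" using W by (simp add: retwist_def)
  next
    fix x y assume "undirected_edge (retwist G W) x y"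
    then show "x \<notin> W" by (auto simp: undirected_edge_def retwist_def)
  next
    fix x y assume d: "directed_edge (retwist G W) x y"
    then have e: "{x, y} \<in> edges G" "{x, y} \<inter> W \<noteq> {}"
      by (auto simp: directed_edge_def retwist_def)
    then have "{y, x} \<in> edges G" by (simp add: insert_commute)
    then have ind: "x \<in> W \<Longrightarrow> y \<notin> W" "y \<in> W \<Longrightarrow> x \<notin> W" using indep e(1) by blast+
    show "x \<notin> W \<and> y \<in> W"
    proof (cases "x \<in> W")
      case True
      then have "terminus (retwist G W) {y, x} = x" using ot(2) ind by blast
      moreover have "{y, x} = {x, y}" by (rule insert_commute)
      ultimately have "x = y" using d by (simp add: directed_edge_def)
      then show ?thesis using True ind by blast
    next
      case False
      then show ?thesis using e(2) by blast
    qed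
  qed
qed

text \<open>Inverting both sides of c w c = w gives the same relation for the inverse of w. This
  serves the map that undoes multiplication by a sinkhole.\<close>

lemma (in group) inverts_inv:
  assumes "c \<in> carrier G" "w \<in> carrier G" "c \<otimes> (w \<otimes> c) = w"
  shows "c \<otimes> (inv w \<otimes> c) = inv w"
proof -
  have "inv w = inv (c \<otimes> (w \<otimes> c))" using assms(3) by simp
  also have "\<dots> = inv c \<otimes> inv w \<otimes> inv c" using assms(1,2) by (simp add: inv_mult_group)
  finally have "c \<otimes> (inv w \<otimes> c) = c \<otimes> (inv c \<otimes> inv w \<otimes> inv c \<otimes> c)" by (simp add: assms(1,2) m_assoc)
  also have "\<dots> = c \<otimes> (inv c \<otimes> inv w)" using assms(1,2) by (simp add: m_assoc)
  also have "\<dots> = inv w" using assms(1,2) by (simp add: m_assoc[symmetric])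
  finally show ?thesis .
qed

text \<open>Multiplying \<open>v\<close> by an element that inverts its neighbours exchanges commuting with a
  neighbour and inverting it.\<close>

lemma flip_hom:
  assumes J: "twisted_graph J W" and K: "twisted_graph K W'"
    and same: "verts K = verts J" "edges K = edges J"
    and W: "\<And>x. x \<noteq> v \<Longrightarrow> x \<in> W' \<longleftrightarrow> x \<in> W" "v \<in> W' \<longleftrightarrow> v \<notin> W"
    and v: "v \<in> verts J"
    and z: "z \<in> carrier (TRAAG K)"
      "\<And>c. c \<in> link J v \<Longrightarrow> gen K c \<otimes>\<^bsub>TRAAG K\<^esub> (z \<otimes>\<^bsub>TRAAG K\<^esub> gen K c) = z"
    and lW: "\<And>c. c \<in> link J v \<Longrightarrow> c \<notin> W"
  shows "\<exists>h\<in>hom (TRAAG J) (TRAAG K). \<forall>a\<in>verts J.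
    h (gen J a) = (if a = v then gen K v \<otimes>\<^bsub>TRAAG K\<^esub> z else gen K a)"
proof -
  interpret J: twisted_graph J W by fact
  interpret K: twisted_graph K W' by fact
  interpret T: group "TRAAG K" by (rule group_TRAAG)
  let ?f = "\<lambda>a. if a = v then gen K v \<otimes>\<^bsub>TRAAG K\<^esub> z else gen K a"
  note gc = gen_carrier[of _ K, unfolded same(1)]
  have f: "?f \<in> verts J \<rightarrow> carrier (TRAAG K)" using gc v z(1) by auto
  \<comment> \<open>If \<open>v\<close> is outside \<open>W\<close>, it is twisted in
    \<open>K\<close>, so c v c = v there. Hence v z c = (c v c)(z c) = c v (c z c) = c v z.\<close>
  have ucomm: "?f v \<otimes>\<^bsub>TRAAG K\<^esub> gen K c = gen K c \<otimes>\<^bsub>TRAAG K\<^esub> ?f v"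
    if e: "{c, v} \<in> edges J" "v \<notin> W" for c
  proof -
    have l: "c \<in> link J v" using e(1) by (simp add: link_def)
    have C: "gen K c \<in> carrier (TRAAG K)" "gen K v \<in> carrier (TRAAG K)"
      using gc J.edgeD[OF e(1)] by simp_all
    have "directed_edge K c v" using K.edge_W e same W by simp
    note d = gen_directed[OF K.mixed_graph this]
    have "gen K v \<otimes>\<^bsub>TRAAG K\<^esub> z \<otimes>\<^bsub>TRAAG K\<^esub> gen K c =
        (gen K c \<otimes>\<^bsub>TRAAG K\<^esub> (gen K v \<otimes>\<^bsub>TRAAG K\<^esub> gen K c)) \<otimes>\<^bsub>TRAAG K\<^esub> (z \<otimes>\<^bsub>TRAAG K\<^esub> gen K c)"
      using d C z(1) by (simp add: T.m_assoc)
    also have "\<dots> = gen K c \<otimes>\<^bsub>TRAAG K\<^esub> (gen K v \<otimes>\<^bsub>TRAAG K\<^esub>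
        (gen K c \<otimes>\<^bsub>TRAAG K\<^esub> (z \<otimes>\<^bsub>TRAAG K\<^esub> gen K c)))"
      using C z(1) by (simp add: T.m_assoc del: W)
    also have "\<dots> = gen K c \<otimes>\<^bsub>TRAAG K\<^esub> (gen K v \<otimes>\<^bsub>TRAAG K\<^esub> z)"
      using z(2)[OF l] by simp
    finally show ?thesis by simp
  qed
  have "\<exists>h\<in>hom (TRAAG J) (TRAAG K). \<forall>w\<in>words (verts J). h (cls J w) = word_eval (TRAAG K) ?f w"
  proof (rule TRAAG_universal[OF J.mixed_graph group_TRAAG f])
    fix a c assume u: "undirected_edge J a c"
    have e: "{a, c} \<in> edges J" "{c, a} \<in> edges J"
      using undirected_edgeD[OF u] by (simp_all add: insert_commute)
    have "undirected_edge J c a" using u by (simp add: undirected_edge_def insert_commute)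
    then have nW: "a \<notin> W" "c \<notin> W" using u J.undirected by blast+
    have ne: "a \<noteq> c" using J.edgeD[OF e(1)] by simp
    consider "a = v" "c \<noteq> v" | "c = v" "a \<noteq> v" | "a \<noteq> v" "c \<noteq> v" using ne by blast
    then show "?f a \<otimes>\<^bsub>TRAAG K\<^esub> ?f c = ?f c \<otimes>\<^bsub>TRAAG K\<^esub> ?f a"
    proof cases
      case 1
      then show ?thesis using ucomm[of c] e nW by simp
    next
      case 2
      then show ?thesis using ucomm[of a] e nW by simp
    next
      case 3
      then have "undirected_edge K a c" using K.edge_not_W[of a c] e same nW W(1) by simp
      from gen_undirected[OF K.mixed_graph this] show ?thesis using 3 by simp
    qed
  next
    fix a c assume d: "directed_edge J a c"
    have e: "{a, c} \<in> edges J" by (rule directed_edgeD[OF J.mixed_graph d])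
    have aW: "a \<notin> W" "c \<in> W" using J.directed[OF d] by simp_all
    have av: "a \<noteq> v"
    proof
      assume "a = v"
      then have "c \<in> link J v" using e by (simp add: link_def insert_commute)
      then show False using lW aW by blast
    qed
    have C: "gen K a \<in> carrier (TRAAG K)" "gen K c \<in> carrier (TRAAG K)"
      using gc J.edgeD[OF e] by simp_all
    show "?f a \<otimes>\<^bsub>TRAAG K\<^esub> (?f c \<otimes>\<^bsub>TRAAG K\<^esub> ?f a) = ?f c"
    proof (cases "c = v")
      case True
      then have l: "a \<in> link J v" using e by (simp add: link_def)
      \<comment> \<open>Now \<open>v\<close> has lost its twist in \<open>K\<close> and commutes
        with \<open>a\<close>, so a (v z) a = v (a z a) = v z.\<close>
      have "undirected_edge K a v" using K.edge_not_W[of a v] e same aW W av True by simp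
      note u = gen_undirected[OF K.mixed_graph this]
      have "gen K a \<otimes>\<^bsub>TRAAG K\<^esub> (gen K v \<otimes>\<^bsub>TRAAG K\<^esub> z \<otimes>\<^bsub>TRAAG K\<^esub> gen K a) =
          (gen K a \<otimes>\<^bsub>TRAAG K\<^esub> gen K v) \<otimes>\<^bsub>TRAAG K\<^esub> (z \<otimes>\<^bsub>TRAAG K\<^esub> gen K a)"
        using C True z(1) by (simp add: T.m_assoc)
      also have "\<dots> = gen K v \<otimes>\<^bsub>TRAAG K\<^esub> (gen K a \<otimes>\<^bsub>TRAAG K\<^esub> (z \<otimes>\<^bsub>TRAAG K\<^esub> gen K a))"
        unfolding u using C True z(1) by (simp add: T.m_assoc)
      finally show ?thesis using z(2)[OF l] av True by simp
    next
      case False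
      then have "directed_edge K a c" using K.edge_W e same aW W(1) by simp
      from gen_directed[OF K.mixed_graph this] show ?thesis using av False by simp
    qed
  qed
  then obtain h where h: "h \<in> hom (TRAAG J) (TRAAG K)"
    "\<And>w. w \<in> words (verts J) \<Longrightarrow> h (cls J w) = word_eval (TRAAG K) ?f w" by blast
  have "h (gen J a) = ?f a" if a: "a \<in> verts J" for a
  proof -
    have "h (gen J a) = word_eval (TRAAG K) ?f [(a, True)]"
      using h(2)[of "[(a, True)]"] a by (simp add: gen_def[of J])
    moreover have "?f a \<in> carrier (TRAAG K)" using f a by blast
    ultimately show ?thesis by (simp add: word_eval_def)
  qed
  with h(1) show ?thesis by blast
qed

text \<open>Every neighbour of \<open>v\<close> is a neighbour of \<open>w\<close> and hence is
  inverted by it. So \<open>flip_hom\<close> applies in both directions, with \<open>w\<close> and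
  then with its inverse as the multiplier; the two homomorphisms fix the other generators and undo
  each other on \<open>v\<close>.\<close>

lemma flip_iso:
  assumes J: "twisted_graph J W" and K: "twisted_graph K W'"
    and same: "verts K = verts J" "edges K = edges J"
    and W: "\<And>x. x \<noteq> v \<Longrightarrow> x \<in> W' \<longleftrightarrow> x \<in> W" "v \<in> W' \<longleftrightarrow> v \<notin> W"
    and v: "v \<in> verts J" and w: "w \<in> W" "w \<noteq> v" and sub: "link J v \<subseteq> link J w"
  shows "TRAAG J \<cong> TRAAG K"
proof -
  interpret J: twisted_graph J W by fact
  interpret K: twisted_graph K W' by fact
  interpret TJ: group "TRAAG J" by (rule group_TRAAG)
  interpret TK: group "TRAAG K" by (rule group_TRAAG)
  have wV: "w \<in> verts J" using w(1) J.W_verts by blast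
  have w': "w \<in> W'" using w W(1) by simp
  have lK: "link K = link J" by (simp add: link_def fun_eq_iff same(2))
  have lW: "c \<notin> W" if "c \<in> link J v" for c using J.link_W[OF w(1)] that sub by blast
  have lW': "c \<notin> W'" if "c \<in> link K v" for c
    using K.link_W[OF w'] that sub unfolding lK by blast
  have gw: "gen J w \<in> carrier (TRAAG J)" "gen K w \<in> carrier (TRAAG K)"
    and gv: "gen J v \<in> carrier (TRAAG J)" "gen K v \<in> carrier (TRAAG K)"
    using gen_carrier wV v same(1) by metis+
  have inJ: "gen J c \<otimes>\<^bsub>TRAAG J\<^esub> (inv\<^bsub>TRAAG J\<^esub> gen J w \<otimes>\<^bsub>TRAAG J\<^esub> gen J c) = inv\<^bsub>TRAAG J\<^esub> gen J w"
    if c: "c \<in> link K v" for c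
  proof -
    have e: "{c, w} \<in> edges J" using c sub unfolding lK by (auto simp: link_def)
    have "gen J c \<in> carrier (TRAAG J)" using J.edgeD[OF e] by (simp add: gen_carrier)
    then show ?thesis
      using TJ.inverts_inv gw(1) gen_directed[OF J.mixed_graph J.edge_W[OF e w(1)]] by blast
  qed
  have inK: "gen K c \<otimes>\<^bsub>TRAAG K\<^esub> (gen K w \<otimes>\<^bsub>TRAAG K\<^esub> gen K c) = gen K w" if c: "c \<in> link J v" for c
  proof -
    have e: "{c, w} \<in> edges K" using c sub unfolding same(2) by (auto simp: link_def)
    show ?thesis by (rule gen_directed[OF K.mixed_graph K.edge_W[OF e w']])
  qed
  have "\<exists>h\<in>hom (TRAAG J) (TRAAG K). \<forall>a\<in>verts J.
      h (gen J a) = (if a = v then gen K v \<otimes>\<^bsub>TRAAG K\<^esub> gen K w else gen K a)"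
    by (rule flip_hom[OF J K same W v gw(2) inK lW])
  then obtain h where h: "h \<in> hom (TRAAG J) (TRAAG K)"
    "\<And>a. a \<in> verts J \<Longrightarrow> h (gen J a) = (if a = v then gen K v \<otimes>\<^bsub>TRAAG K\<^esub> gen K w else gen K a)"
    by blast
  have "\<exists>k\<in>hom (TRAAG K) (TRAAG J). \<forall>a\<in>verts K.
      k (gen K a) = (if a = v then gen J v \<otimes>\<^bsub>TRAAG J\<^esub> inv\<^bsub>TRAAG J\<^esub> gen J w else gen J a)"
    by (rule flip_hom[OF K J]) (use same W v gw inJ lW' in auto)
  then obtain k where k: "k \<in> hom (TRAAG K) (TRAAG J)"
    "\<And>a. a \<in> verts J \<Longrightarrow> k (gen K a) =
      (if a = v then gen J v \<otimes>\<^bsub>TRAAG J\<^esub> inv\<^bsub>TRAAG J\<^esub> gen J w else gen J a)"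
    unfolding same(1) by blast
  interpret h: group_hom "TRAAG J" "TRAAG K" h by unfold_locales (rule h(1))
  interpret k: group_hom "TRAAG K" "TRAAG J" k by unfold_locales (rule k(1))
  show ?thesis
  proof (rule TRAAG_iso_of_inverse_homs[OF h(1) k(1)])
    fix a assume a: "a \<in> verts J"
    show "k (h (gen J a)) = gen J a"
    proof (cases "a = v")
      case True
      then have "k (h (gen J a)) = k (gen K v) \<otimes>\<^bsub>TRAAG J\<^esub> k (gen K w)"
        using h(2)[OF a] gw gv by simp
      also have "\<dots> = gen J v" using k(2)[OF v] k(2)[OF wV] w(2) gw gv by (simp add: TJ.m_assoc)
      finally show ?thesis using True by simp
    qed (use h(2)[OF a] k(2)[OF a] in simp)
  next
    fix a assume "a \<in> verts K"
    then have a: "a \<in> verts J" by (simp add: same(1))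
    show "h (k (gen K a)) = gen K a"
    proof (cases "a = v")
      case True
      then have "h (k (gen K a)) = h (gen J v) \<otimes>\<^bsub>TRAAG K\<^esub> inv\<^bsub>TRAAG K\<^esub> h (gen J w)"
        using k(2)[OF a] gw gv by simp
      also have "\<dots> = gen K v" using h(2)[OF v] h(2)[OF wV] w(2) gw gv by (simp add: TK.m_assoc)
      finally show ?thesis using True by simp
    qed (use h(2)[OF a] k(2)[OF a] in simp)
  qed
qed

lemma card_dedges_isomorphism_le:
  assumes G: "mixed_graph G" and H: "mixed_graph H" and f: "mixed_graph_isomorphism f G H"
  shows "card (dedges G) \<le> card (dedges H)"
proof (rule card_inj_on_le)
  have inj: "inj_on f (verts G)" using f by (simp add: mixed_graph_isomorphism_def bij_betw_def)
  have sub: "e \<subseteq> verts G" if "e \<in> dedges G" for e using that G by (auto simp: mixed_graph_def)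
  show "inj_on ((`) f) (dedges G)"
  proof (rule inj_onI)
    fix d e assume d: "d \<in> dedges G" and e: "e \<in> dedges G" and eq: "f ` d = f ` e"
    show "d = e" using inj_on_image_eq_iff[OF inj sub[OF d] sub[OF e]] eq by simp
  qed
  show "(`) f ` dedges G \<subseteq> dedges H"
  proof
    fix e' assume "e' \<in> (`) f ` dedges G"
    then obtain e where e: "e \<in> dedges G" "e' = f ` e" by blast
    have "card e = 2" using e(1) G by (auto simp: mixed_graph_def)
    then obtain a c where ac: "e = {a, c}" by (auto simp: card_2_iff)
    have "a \<in> verts G" "c \<in> verts G" using sub[OF e(1)] ac by simp_all
    then have "{f a, f c} \<in> dedges H"
      using f e(1) unfolding mixed_graph_isomorphism_def ac by simp
    then show "e' \<in> dedges H" using e(2) ac by simp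
  qed
  have "dedges H \<subseteq> Pow (verts H)" "finite (verts H)"
    using H by (auto simp: mixed_graph_def)
  then show "finite (dedges H)" by (intro finite_subset[of "dedges H" "Pow (verts H)"]) simp_all
qed

text \<open>Toggling the membership of the satellite \<open>v\<close> in \<open>W\<close> retwists
  the edges at \<open>v\<close> without changing the group. Such edges exist and their other ends
  are not in \<open>W\<close>, so the number of directed edges changes, while rigidity would
  preserve it.\<close>

lemma rigid_no_satellite:
  fixes G :: "'v mixed_graph"
  assumes G: "mixed_graph G" and sp: "special G" and r: "rigid G"
  shows "\<not> has_satellites G"
proof
  assume "has_satellites G"
  then obtain w v where w: "sinkhole G w" and sat: "satellite G w v"
    unfolding has_satellites_def by blast
  define W where "W = {x \<in> verts G. sinkhole G x}"
  interpret twisted_graph G W unfolding W_def by (rule special_twisted_graph[OF G sp])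
  have wW: "w \<in> W" using sinkhole_verts[OF G w] w by (simp add: W_def)
  have v: "v \<in> verts G" "v \<noteq> w" "link G v \<noteq> {}" "link G v \<subseteq> link G w"
    using sat satellite_iff[OF G] by blast+
  have nW: "x \<notin> W" if "x \<in> link G v" for x using link_W[OF wW] v(4) that by blast
  define W' where "W' = (if v \<in> W then W - {v} else insert v W)"
  have W': "x \<in> W' \<longleftrightarrow> x \<in> W" if "x \<noteq> v" for x using that by (simp add: W'_def)
  have vW': "v \<in> W' \<longleftrightarrow> v \<notin> W" by (simp add: W'_def)
  have indep: "y \<notin> W'" if e: "{x, y} \<in> edges G" "x \<in> W'" for x y
  proof (cases "x = v \<or> y = v")
    case True
    have "x \<noteq> y" using edgeD[OF e(1)] by simp
    moreover have "x = v \<Longrightarrow> y \<in> link G v" "y = v \<Longrightarrow> x \<in> link G v"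
      using e(1) link_sym[of x G y] by (auto simp: link_def)
    ultimately show ?thesis using True nW[of y] nW[of x] W'[of y] W'[of x] e(2) by auto
  next
    case False
    then have "x \<in> W" "y \<in> W \<longleftrightarrow> y \<in> W'" using W' e(2) by simp_all
    moreover have "y \<in> link G x" using e(1) by (simp add: link_def insert_commute)
    ultimately show ?thesis using link_W by blast
  qed
  have "W' \<subseteq> verts G" using W_verts v(1) by (auto simp: W'_def split: if_splits)
  then have tw: "twisted_graph (retwist G W') W'"
    by (rule twisted_graph_retwist[OF G]) (rule indep)
  let ?H = "retwist G W'"
  interpret H: twisted_graph ?H W' by (rule tw)
  have same: "verts ?H = verts G" "edges ?H = edges G" by (simp_all add: retwist_def)
  have "TRAAG G \<cong> TRAAG ?H"
    by (rule flip_iso[OF twisted_graph_axioms tw same W' vW' v(1) wW v(2)[symmetric] v(4)])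
  then obtain f where f: "mixed_graph_isomorphism f G ?H"
    using rigidD[OF r G H.mixed_graph] unfolding mixed_graphs_isomorphic_def by blast
  have "card (dedges G) = card (dedges ?H)"
    using card_dedges_isomorphism_le[OF G H.mixed_graph f]
      card_dedges_isomorphism_le[OF H.mixed_graph G mixed_graph_isomorphism_inv[OF G H.mixed_graph f]]
    by simp
  moreover have "card (dedges G) \<noteq> card (dedges ?H)"
  proof -
    obtain u where u: "{u, v} \<in> edges G" using v(3) by (auto simp: link_def)
    have uW: "u \<notin> W" "u \<notin> W'" "u \<noteq> v"
      using nW[of u] W'[of u] u edgeD[OF u] by (simp_all add: link_def)
    have fin: "finite (edges G)"
    proof -
      have "edges G \<subseteq> Pow (verts G)" using G by (auto simp: mixed_graph_def)
      then show ?thesis by (rule finite_subset) simp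
    qed
    then have finD: "finite (dedges G)" "finite (dedges ?H)"
      unfolding dedges_eq H.dedges_eq same by simp_all
    \<comment> \<open>The edge between \<open>u\<close> and \<open>v\<close> meets only the larger
      of the two sets.\<close>
    have strict: "{e \<in> edges G. e \<inter> A \<noteq> {}} \<subset> {e \<in> edges G. e \<inter> insert v A \<noteq> {}}"
      if "u \<notin> A" "v \<notin> A" for A
    proof (rule psubsetI)
      have "{u, v} \<notin> {e \<in> edges G. e \<inter> A \<noteq> {}}" using that by simp
      moreover have "{u, v} \<in> {e \<in> edges G. e \<inter> insert v A \<noteq> {}}" using u by simp
      ultimately show "{e \<in> edges G. e \<inter> A \<noteq> {}} \<noteq> {e \<in> edges G. e \<inter> insert v A \<noteq> {}}"
        by metis
    qed blast
    show ?thesis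
    proof (cases "v \<in> W")
      case True
      then have "insert v W' = W" by (auto simp: W'_def)
      then have "dedges ?H \<subset> dedges G"
        unfolding dedges_eq H.dedges_eq same using strict[OF uW(2)] vW' True by simp
      from psubset_card_mono[OF finD(1) this] show ?thesis by simp
    next
      case False
      then have "insert v W = W'" by (simp add: W'_def)
      then have "dedges G \<subset> dedges ?H"
        unfolding dedges_eq H.dedges_eq same using strict[OF uW(1) False] by simp
      from psubset_card_mono[OF finD(2) this] show ?thesis by simp
    qed
  qed
  ultimately show False by simp
qed

theorem theorem1p4:
  fixes \<Gamma> :: "'v mixed_graph"
  assumes "mixed_graph \<Gamma>" and "special \<Gamma>"
  shows "(rigid \<Gamma> \<longrightarrow> \<not> has_satellites \<Gamma>) \<and>
         ((\<exists>w. sinkhole \<Gamma> w \<and> (\<forall>v\<in>verts \<Gamma>. v \<noteq> w \<longrightarrow> joined \<Gamma> v w)) \<longrightarrow> rigid \<Gamma>) \<and>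
         (droms \<Gamma> \<longrightarrow> (rigid \<Gamma> \<longleftrightarrow> \<not> has_satellites \<Gamma>))"
proof (intro conjI impI)
  show "\<not> has_satellites \<Gamma>" if "rigid \<Gamma>" by (rule rigid_no_satellite[OF assms that])
  assume "\<exists>w. sinkhole \<Gamma> w \<and> (\<forall>v\<in>verts \<Gamma>. v \<noteq> w \<longrightarrow> joined \<Gamma> v w)"
  then obtain w where "sinkhole \<Gamma> w" "\<And>v. v \<in> verts \<Gamma> \<Longrightarrow> v \<noteq> w \<Longrightarrow> {v, w} \<in> edges \<Gamma>"
    unfolding joined_def by blast
  then show "rigid \<Gamma>" by (rule cone_rigid[OF assms])
next
  assume "droms \<Gamma>"
  then show "rigid \<Gamma> \<longleftrightarrow> \<not> has_satellites \<Gamma>"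
    using rigid_no_satellite[OF assms] droms_rigid[OF assms(1)] by metis
qed

end
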